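(* Let $\mathcal C$ be a small category and let $(\mathcal G_x,\varphi_g,u_{g,h})$ be data describing a $\mathcal C$-shaped diagram of tight group correspondences, with fundamental group $\Pi_1$. Let $\mathcal U^\triangleright$ be the groupoid model for the extension of this diagram to the category $\mathcal C^\triangleright$. Then the groupoid $\mathcal U^\triangleright$ is isomorphic to the product of the group $\Pi_1$ with the pair groupoid of the set $\mathcal C^0\sqcup\{\infty\}$. So it is (Morita) equivalent to $\Pi_1$.
   Context: Conventions. For a category, $\mathcal C$ also denotes the set of arrows, $\mathcal C^0$ the objects, identified with identity arrows; $g\colon x\leftarrow y$ means $r(g)=x$, $s(g)=y$, and $gh$ is defined iff $s(g)=r(h)$. Groups are discrete groupoids with one object. The pair groupoid of a set $X$ is $X\times X$ with exactly one arrow between any two objects. Data. For a small category $\mathcal C$, data $(\mathcal G_x,\varphi_g,u_{g,h})$ consists of groups $\mathcal G_x$ for $x\in\mathcal C^0$, group homomorphisms $\varphi_g\colon\mathcal G_{r(g)}\to\mathcal G_{s(g)}$ for $g\in\mathcal C$, and elements $u_{g,h}\in\mathcal G_{s(h)}$ for composable $g,h\in\mathcal C$, such that $u_{g,h}\,\varphi_h(\varphi_g(\gamma))\,u_{g,h}^{-1}=\varphi_{gh}(\gamma)$ for $\gamma\in\mathcal G_{r(g)}$; $u_{gh,k}\,\varphi_k(u_{g,h})=u_{g,hk}\,u_{h,k}$ for composable $g,h,k$; $\varphi_x=\mathrm{id}$ for identity arrows $x$; $u_{r(g),g}=1$ and $u_{g,s(g)}=1$ for all $g$. It describes the diagram $F=(\mathcal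 G_x,\mathcal X_g,\mu_{g,h})$, where $\mathcal X_g$ is the set $\mathcal G_{s(g)}$ with left $\mathcal G_{r(g)}$-action $\gamma\cdot\xi=\varphi_g(\gamma)\xi$ and right $\mathcal G_{s(g)}$-action by multiplication, with multiplication maps $\mathcal X_g\times\mathcal X_h\to\mathcal X_{gh}$, $\gamma_1\cdot\gamma_2:=u_{g,h}\,\varphi_h(\gamma_1)\,\gamma_2$ (product in $\mathcal G_{s(h)}$). Fundamental group. $\Pi_1$ is the group generated by the set $\mathcal C\sqcup\bigsqcup_{x\in\mathcal C^0}\mathcal G_x$ with the relations: (1) $\gamma_1\cdot\gamma_2=\gamma_1\gamma_2$ for $\gamma_1,\gamma_2\in\mathcal G_x$ for the same $x$; (2) $g\cdot\varphi_g(\gamma)=\gamma\cdot g$ for $g\in\mathcal C$, $\gamma\in\mathcal G_{r(g)}$; (3) $g\cdot h=(gh)\cdot u_{g,h}$ for composable $g,h\in\mathcal C$; (4) $x=1$ for each identity arrow $x\in\mathcal C^0\subseteq\mathcal C$. Extension. $\mathcal C^\triangleright$ is the category with object set $\mathcal C^0\sqcup\{\infty\}$, arrow set $(\mathcal C\times\{0,\infty\})\sqcup\{\mathrm{id}_\infty\}$, $s(g,0)=s(g)$, $r(g,0)=r(g)$, $s(g,\infty)=s(g)$, $r(g,\infty)=\infty$, and composition $(g,0)(h,0)=(gh,0)$, $(g,\infty)(h,0)=(gh,\infty)$. The data is extended to $\mathcal C^\triangleright$ by $\mathcal G_\infty=\{1\}$, $\varphi_{(g,0)}=\varphi_g$,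 $\varphi_{(g,\infty)}\colon\{1\}\to\mathcal G_{s(g)}$ the unique homomorphism, $u_{(g,0),(h,0)}=u_{(g,\infty),(h,0)}=u_{g,h}$, and $u_{\mathrm{id}_\infty,g}=1$ if $r(g)=\infty$, $u_{g,\mathrm{id}_\infty}=1$ if $s(g)=\infty$. Actions and groupoid model of a diagram $F$ described by such data (over any small category $\mathcal C$). An $F$-action on a topological space $Y$ consists of a partition $Y=\bigsqcup_{x\in\mathcal C^0}Y_x$ into clopen subsets and open, continuous, surjective maps $\mathcal X_g\times Y_{s(g)}\to Y_{r(g)}$, $(\gamma,y)\mapsto\gamma\cdot y$, for all $g\in\mathcal C$ ($\mathcal X_g$ discrete), such that (i) $\gamma_1\cdot(\gamma_2\cdot y)=(\gamma_1\cdot\gamma_2)\cdot y$ for composable $g_1,g_2$, $\gamma_i\in\mathcal X_{g_i}$, $y\in Y_{s(g_2)}$; (ii) if $\gamma\cdot y=\gamma'\cdot y'$ with $\gamma,\gamma'\in\mathcal X_g$, $y,y'\in Y_{s(g)}$, then there is $\eta\in\mathcal G_{s(g)}=\mathcal X_{s(g)}$ with $\gamma'=\gamma\eta$ and $y=\eta\cdot y'$. A continuous map $\varphi\colon Y\to Y'$ is $F$-equivariant if $\varphi(Y_x)\subseteq Y'_x$ and $\varphi(\gamma\cdot y)=\gamma\cdot\varphi(y)$ always. A groupoid model for $F$ is an étale topological groupoid $\mathcal U$ with natural bijections, for all spaces $Y$, between left $\mathcal U$-actions on $Y$ and $F$-actions on $Y$; naturality means that a continuous map $Y\to Y'$ is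 $\mathcal U$-equivariant iff it is $F$-equivariant. (It is unique up to isomorphism.) *)

theory Defs
  imports "HOL-Analysis.Analysis" "HOL-Algebra.Elementary_Groups"
begin

section \<open>Small categories\<close>

text \<open>Objects are identified with their identity arrows, so \<open>Obj C \<subseteq> Arr C\<close>.  An arrow
  \<open>g\<close> points from \<open>src C g\<close> to \<open>rng C g\<close>, and \<open>cmp C g h\<close> is the composite \<open>gh\<close>, meaningful
  when \<open>src C g = rng C h\<close>.\<close>

record 'a category =
  Arr :: "'a set"
  Obj :: "'a set"
  src :: "'a \<Rightarrow> 'a"
  rng :: "'a \<Rightarrow> 'a"
  cmp :: "'a \<Rightarrow> 'a \<Rightarrow> 'a"

definition composable :: "('a, 'm) category_scheme \<Rightarrow> 'a \<Rightarrow> 'a \<Rightarrow> bool" where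
  "composable C g h \<longleftrightarrow> g \<in> Arr C \<and> h \<in> Arr C \<and> src C g = rng C h"

locale small_category =
  fixes C :: "('a, 'm) category_scheme"
  assumes Obj_subset: "Obj C \<subseteq> Arr C"
    and src_Obj: "g \<in> Arr C \<Longrightarrow> src C g \<in> Obj C"
    and rng_Obj: "g \<in> Arr C \<Longrightarrow> rng C g \<in> Obj C"
    and src_ident: "x \<in> Obj C \<Longrightarrow> src C x = x"
    and rng_ident: "x \<in> Obj C \<Longrightarrow> rng C x = x"
    and cmp_Arr: "composable C g h \<Longrightarrow> cmp C g h \<in> Arr C"
    and src_cmp: "composable C g h \<Longrightarrow> src C (cmp C g h) = src C h"
    and rng_cmp: "composable C g h \<Longrightarrow> rng C (cmp C g h) = rng C g"
    and cmp_assoc: "composable C g h \<Longrightarrow> composable C h k \<Longrightarrow>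
          cmp C (cmp C g h) k = cmp C g (cmp C h k)"
    and cmp_ident_left: "g \<in> Arr C \<Longrightarrow> cmp C (rng C g) g = g"
    and cmp_ident_right: "g \<in> Arr C \<Longrightarrow> cmp C g (src C g) = g"

section \<open>Data describing diagrams of tight group correspondences\<close>

record ('a, 'g) diagram_data = "'a category" +
  Grp :: "'a \<Rightarrow> 'g monoid"
  phi :: "'a \<Rightarrow> 'g \<Rightarrow> 'g"
  cocyc :: "'a \<Rightarrow> 'a \<Rightarrow> 'g"

locale tight_diagram_data = small_category D
  for D :: "('a, 'g) diagram_data" +
  assumes group_Grp: "x \<in> Obj D \<Longrightarrow> group (Grp D x)"
    and phi_hom: "g \<in> Arr D \<Longrightarrow> phi D g \<in> hom (Grp D (rng D g)) (Grp D (src D g))"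
    and cocyc_closed: "composable D g h \<Longrightarrow> cocyc D g h \<in> carrier (Grp D (src D h))"
    and phi_cmp: "composable D g h \<Longrightarrow> \<gamma> \<in> carrier (Grp D (rng D g)) \<Longrightarrow>
          cocyc D g h \<otimes>\<^bsub>Grp D (src D h)\<^esub> phi D h (phi D g \<gamma>)
            \<otimes>\<^bsub>Grp D (src D h)\<^esub> inv\<^bsub>Grp D (src D h)\<^esub> (cocyc D g h)
          = phi D (cmp D g h) \<gamma>"
    and cocyc_cmp: "composable D g h \<Longrightarrow> composable D h k \<Longrightarrow>
          cocyc D (cmp D g h) k \<otimes>\<^bsub>Grp D (src D k)\<^esub> phi D k (cocyc D g h)
          = cocyc D g (cmp D h k) \<otimes>\<^bsub>Grp D (src D k)\<^esub> cocyc D h k"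
    and phi_ident: "x \<in> Obj D \<Longrightarrow> \<gamma> \<in> carrier (Grp D x) \<Longrightarrow> phi D x \<gamma> = \<gamma>"
    and cocyc_ident_left: "g \<in> Arr D \<Longrightarrow> cocyc D (rng D g) g = \<one>\<^bsub>Grp D (src D g)\<^esub>"
    and cocyc_ident_right: "g \<in> Arr D \<Longrightarrow> cocyc D g (src D g) = \<one>\<^bsub>Grp D (src D g)\<^esub>"

text \<open>The correspondence \<open>\<X>\<^sub>g\<close> has underlying set \<open>\<G>\<^bsub>s(g)\<^esub>\<close>, with \<open>\<G>\<^bsub>s(g)\<^esub>\<close> acting on the right by
  multiplication.\<close>

definition corr_set :: "('a, 'g) diagram_data \<Rightarrow> 'a \<Rightarrow> 'g set" where
  "corr_set D g = carrier (Grp D (src D g))"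

definition corr_right :: "('a, 'g) diagram_data \<Rightarrow> 'a \<Rightarrow> 'g \<Rightarrow> 'g \<Rightarrow> 'g" where
  "corr_right D g \<xi> \<eta> = \<xi> \<otimes>\<^bsub>Grp D (src D g)\<^esub> \<eta>"

definition corr_mult :: "('a, 'g) diagram_data \<Rightarrow> 'a \<Rightarrow> 'a \<Rightarrow> 'g \<Rightarrow> 'g \<Rightarrow> 'g" where
  "corr_mult D g h \<gamma>\<^sub>1 \<gamma>\<^sub>2 =
     cocyc D g h \<otimes>\<^bsub>Grp D (src D h)\<^esub> phi D h \<gamma>\<^sub>1 \<otimes>\<^bsub>Grp D (src D h)\<^esub> \<gamma>\<^sub>2"

section \<open>Groups given by generators and relations\<close>

text \<open>The letter \<open>(True, x)\<close> stands for the generator \<open>x\<close> and \<open>(False, x)\<close> for its formal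
  inverse.  A relation is a pair of words that are to become equal.\<close>

type_synonym 's word = "(bool \<times> 's) list"

definition words :: "'s set \<Rightarrow> 's word set" where
  "words S = lists (UNIV \<times> S)"

inductive word_eq :: "'s set \<Rightarrow> ('s word \<times> 's word) set \<Rightarrow> 's word \<Rightarrow> 's word \<Rightarrow> bool"
  for S R where
  refl: "w \<in> words S \<Longrightarrow> word_eq S R w w"
| sym: "word_eq S R v w \<Longrightarrow> word_eq S R w v"
| trans: "word_eq S R v w \<Longrightarrow> word_eq S R w z \<Longrightarrow> word_eq S R v z"
| congruence: "word_eq S R v w \<Longrightarrow> a \<in> words S \<Longrightarrow> b \<in> words S \<Longrightarrow>
    word_eq S R (a @ v @ b) (a @ w @ b)"
| cancel: "x \<in> S \<Longrightarrow> word_eq S R [(e, x), (\<not> e, x)] []"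
| relation: "(v, w) \<in> R \<Longrightarrow> v \<in> words S \<Longrightarrow> w \<in> words S \<Longrightarrow> word_eq S R v w"

definition presented_group :: "'s set \<Rightarrow> ('s word \<times> 's word) set \<Rightarrow> 's word set monoid" where
  "presented_group S R =
     (let E = {(v, w). word_eq S R v w} in
      \<lparr>carrier = words S // E,
       mult = (\<lambda>A B. E `` {a @ b | a b. a \<in> A \<and> b \<in> B}),
       one = E `` {[]}\<rparr>)"

section \<open>The fundamental group\<close>

datatype ('a, 'g) pi1_gen = Arrow 'a | Elt 'a 'g

abbreviation arrow_word :: "'a \<Rightarrow> ('a, 'g) pi1_gen word" where
  "arrow_word g \<equiv> [(True, Arrow g)]"

abbreviation elt_word :: "'a \<Rightarrow> 'g \<Rightarrow> ('a, 'g) pi1_gen word" where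
  "elt_word x \<gamma> \<equiv> [(True, Elt x \<gamma>)]"

definition pi1_gens :: "('a, 'g) diagram_data \<Rightarrow> ('a, 'g) pi1_gen set" where
  "pi1_gens D = Arrow ` Arr D \<union> {Elt x \<gamma> | x \<gamma>. x \<in> Obj D \<and> \<gamma> \<in> carrier (Grp D x)}"

definition pi1_rels :: "('a, 'g) diagram_data \<Rightarrow>
    (('a, 'g) pi1_gen word \<times> ('a, 'g) pi1_gen word) set" where
  "pi1_rels D =
     {(elt_word x \<gamma>\<^sub>1 @ elt_word x \<gamma>\<^sub>2, elt_word x (\<gamma>\<^sub>1 \<otimes>\<^bsub>Grp D x\<^esub> \<gamma>\<^sub>2)) | x \<gamma>\<^sub>1 \<gamma>\<^sub>2.
        x \<in> Obj D \<and> \<gamma>\<^sub>1 \<in> carrier (Grp D x) \<and> \<gamma>\<^sub>2 \<in> carrier (Grp D x)}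
   \<union> {(arrow_word g @ elt_word (src D g) (phi D g \<gamma>), elt_word (rng D g) \<gamma> @ arrow_word g) | g \<gamma>.
        g \<in> Arr D \<and> \<gamma> \<in> carrier (Grp D (rng D g))}
   \<union> {(arrow_word g @ arrow_word h,
       arrow_word (cmp D g h) @ elt_word (src D h) (cocyc D g h)) | g h.
        composable D g h}
   \<union> {(arrow_word x, []) | x. x \<in> Obj D}"

definition fundamental_group ::
    "('a, 'g) diagram_data \<Rightarrow> ('a, 'g) pi1_gen word set monoid" where
  "fundamental_group D = presented_group (pi1_gens D) (pi1_rels D)"

section \<open>The cone extension\<close>

text \<open>\<open>Base g\<close>, \<open>Cone g\<close> and \<open>Apex\<close> are the arrows \<open>(g, 0)\<close>, \<open>(g, \<infinity>)\<close> and \<open>id\<^sub>\<infinity>\<close>; the object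
  \<open>\<infinity>\<close> is identified with \<open>Apex\<close> and \<open>x \<in> Obj C\<close> with \<open>Base x\<close>.\<close>

datatype 'a ext_arrow = Base 'a | Cone 'a | Apex

fun ext_src :: "('a, 'm) category_scheme \<Rightarrow> 'a ext_arrow \<Rightarrow> 'a ext_arrow" where
  "ext_src C (Base g) = Base (src C g)"
| "ext_src C (Cone g) = Base (src C g)"
| "ext_src C Apex = Apex"

fun ext_rng :: "('a, 'm) category_scheme \<Rightarrow> 'a ext_arrow \<Rightarrow> 'a ext_arrow" where
  "ext_rng C (Base g) = Base (rng C g)"
| "ext_rng C (Cone g) = Apex"
| "ext_rng C Apex = Apex"

fun ext_cmp :: "('a, 'm) category_scheme \<Rightarrow> 'a ext_arrow \<Rightarrow> 'a ext_arrow \<Rightarrow> 'a ext_arrow" where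
  "ext_cmp C (Base g) (Base h) = Base (cmp C g h)"
| "ext_cmp C (Cone g) (Base h) = Cone (cmp C g h)"
| "ext_cmp C Apex k = k"
| "ext_cmp C _ _ = undefined"

fun ext_Grp :: "('a, 'g) diagram_data \<Rightarrow> 'a ext_arrow \<Rightarrow> 'g monoid" where
  "ext_Grp D (Base x) = Grp D x"
| "ext_Grp D Apex = singleton_group undefined"
| "ext_Grp D (Cone _) = undefined"

fun ext_phi :: "('a, 'g) diagram_data \<Rightarrow> 'a ext_arrow \<Rightarrow> 'g \<Rightarrow> 'g" where
  "ext_phi D (Base g) = phi D g"
| "ext_phi D (Cone g) = (\<lambda>_. \<one>\<^bsub>Grp D (src D g)\<^esub>)"
| "ext_phi D Apex = id"

text \<open>The only arrow with source \<open>\<infinity>\<close> is \<open>Apex\<close>, so composition with \<open>Apex\<close> on the right is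
  covered by the clauses for \<open>Apex\<close> on the left.\<close>

fun ext_cocyc :: "('a, 'g) diagram_data \<Rightarrow> 'a ext_arrow \<Rightarrow> 'a ext_arrow \<Rightarrow> 'g" where
  "ext_cocyc D (Base g) (Base h) = cocyc D g h"
| "ext_cocyc D (Cone g) (Base h) = cocyc D g h"
| "ext_cocyc D Apex k = \<one>\<^bsub>ext_Grp D (ext_src D k)\<^esub>"
| "ext_cocyc D _ _ = undefined"

definition extended_data :: "('a, 'g) diagram_data \<Rightarrow> ('a ext_arrow, 'g) diagram_data" where
  "extended_data D =
     \<lparr>Arr = Base ` Arr D \<union> Cone ` Arr D \<union> {Apex},
      Obj = Base ` Obj D \<union> {Apex},
      src = ext_src D, rng = ext_rng D, cmp = ext_cmp D,
      Grp = ext_Grp D, phi = ext_phi D, cocyc = ext_cocyc D\<rparr>"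

section \<open>Topological groupoids\<close>

record 'u top_groupoid = "'u category" +
  ginv :: "'u \<Rightarrow> 'u"
  topo :: "'u topology"

definition obj_topo :: "'u top_groupoid \<Rightarrow> 'u topology" where
  "obj_topo G = subtopology (topo G) (Obj G)"

definition local_homeomorphism :: "'a topology \<Rightarrow> 'b topology \<Rightarrow> ('a \<Rightarrow> 'b) \<Rightarrow> bool" where
  "local_homeomorphism X Y f \<longleftrightarrow>
     (\<forall>x \<in> topspace X. \<exists>V. openin X V \<and> x \<in> V \<and> openin Y (f ` V) \<and>
        homeomorphic_map (subtopology X V) (subtopology Y (f ` V)) f)"

locale topological_groupoid = small_category G
  for G :: "'u top_groupoid" +
  assumes ginv_Arr: "g \<in> Arr G \<Longrightarrow> ginv G g \<in> Arr G"
    and src_ginv: "g \<in> Arr G \<Longrightarrow> src G (ginv G g) = rng G g"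
    and rng_ginv: "g \<in> Arr G \<Longrightarrow> rng G (ginv G g) = src G g"
    and cmp_ginv_right: "g \<in> Arr G \<Longrightarrow> cmp G g (ginv G g) = rng G g"
    and cmp_ginv_left: "g \<in> Arr G \<Longrightarrow> cmp G (ginv G g) g = src G g"
    and topspace_topo: "topspace (topo G) = Arr G"
    and continuous_src: "continuous_map (topo G) (obj_topo G) (src G)"
    and continuous_rng: "continuous_map (topo G) (obj_topo G) (rng G)"
    and continuous_ginv: "continuous_map (topo G) (topo G) (ginv G)"
    and continuous_cmp: "continuous_map
          (subtopology (prod_topology (topo G) (topo G)) {(g, h). composable G g h})
          (topo G) (\<lambda>(g, h). cmp G g h)"

locale etale_groupoid = topological_groupoid +
  assumes local_homeomorphism_src: "local_homeomorphism (topo G) (obj_topo G) (src G)"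
    and local_homeomorphism_rng: "local_homeomorphism (topo G) (obj_topo G) (rng G)"

definition groupoid_iso :: "'u top_groupoid \<Rightarrow> 'v top_groupoid \<Rightarrow> ('u \<Rightarrow> 'v) \<Rightarrow> bool" where
  "groupoid_iso G H f \<longleftrightarrow>
     homeomorphic_map (topo G) (topo H) f \<and>
     bij_betw f (Arr G) (Arr H) \<and>
     f ` Obj G = Obj H \<and>
     (\<forall>g \<in> Arr G. src H (f g) = f (src G g) \<and> rng H (f g) = f (rng G g)) \<and>
     (\<forall>g h. composable G g h \<longrightarrow> f (cmp G g h) = cmp H (f g) (f h))"

definition isomorphic_groupoids :: "'u top_groupoid \<Rightarrow> 'v top_groupoid \<Rightarrow> bool" where
  "isomorphic_groupoids G H \<longleftrightarrow> (\<exists>f. groupoid_iso G H f)"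

definition group_groupoid :: "'g monoid \<Rightarrow> 'g top_groupoid" where
  "group_groupoid K =
     \<lparr>Arr = carrier K, Obj = {\<one>\<^bsub>K\<^esub>},
      src = (\<lambda>_. \<one>\<^bsub>K\<^esub>), rng = (\<lambda>_. \<one>\<^bsub>K\<^esub>), cmp = (\<lambda>g h. g \<otimes>\<^bsub>K\<^esub> h),
      ginv = (\<lambda>g. inv\<^bsub>K\<^esub> g), topo = discrete_topology (carrier K)\<rparr>"

text \<open>The arrow \<open>(x, y)\<close> of the pair groupoid goes from \<open>y\<close> to \<open>x\<close>.\<close>

definition pair_groupoid :: "'x set \<Rightarrow> ('x \<times> 'x) top_groupoid" where
  "pair_groupoid X =
     \<lparr>Arr = X \<times> X, Obj = (\<lambda>x. (x, x)) ` X,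
      src = (\<lambda>(x, y). (y, y)), rng = (\<lambda>(x, y). (x, x)), cmp = (\<lambda>(x, y) (y', z). (x, z)),
      ginv = (\<lambda>(x, y). (y, x)), topo = discrete_topology (X \<times> X)\<rparr>"

definition prod_groupoid :: "'u top_groupoid \<Rightarrow> 'v top_groupoid \<Rightarrow> ('u \<times> 'v) top_groupoid" where
  "prod_groupoid G H =
     \<lparr>Arr = Arr G \<times> Arr H, Obj = Obj G \<times> Obj H,
      src = map_prod (src G) (src H), rng = map_prod (rng G) (rng H),
      cmp = (\<lambda>(g, h) (g', h'). (cmp G g g', cmp H h h')),
      ginv = map_prod (ginv G) (ginv H), topo = prod_topology (topo G) (topo H)\<rparr>"

section \<open>Actions of topological groupoids\<close>

text \<open>The functions that make up an action are required to be \<open>undefined\<close> outside their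
  mathematical domains, so that equality of records is equality of actions.\<close>

record ('u, 'y) groupoid_action =
  anchor :: "'y \<Rightarrow> 'u"
  act :: "'u \<Rightarrow> 'y \<Rightarrow> 'y"

definition act_dom :: "'u top_groupoid \<Rightarrow> 'y topology \<Rightarrow> ('u, 'y) groupoid_action \<Rightarrow> ('u \<times> 'y) set"
  where "act_dom G Y A = {(g, y). g \<in> Arr G \<and> y \<in> topspace Y \<and> src G g = anchor A y}"

definition left_action :: "'u top_groupoid \<Rightarrow> 'y topology \<Rightarrow> ('u, 'y) groupoid_action \<Rightarrow> bool" where
  "left_action G Y A \<longleftrightarrow>
     anchor A \<in> extensional (topspace Y) \<and>
     (\<forall>g y. (g, y) \<notin> act_dom G Y A \<longrightarrow> act A g y = undefined) \<and>
     continuous_map Y (obj_topo G) (anchor A) \<and>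
     continuous_map (subtopology (prod_topology (topo G) Y) (act_dom G Y A)) Y
       (\<lambda>(g, y). act A g y) \<and>
     (\<forall>(g, y) \<in> act_dom G Y A. anchor A (act A g y) = rng G g) \<and>
     (\<forall>g h y. composable G g h \<longrightarrow> (h, y) \<in> act_dom G Y A \<longrightarrow>
        act A (cmp G g h) y = act A g (act A h y)) \<and>
     (\<forall>y \<in> topspace Y. act A (anchor A y) y = y)"

definition equivariant :: "'u top_groupoid \<Rightarrow> 'y topology \<Rightarrow> ('u, 'y) groupoid_action \<Rightarrow>
    ('u, 'z) groupoid_action \<Rightarrow> ('y \<Rightarrow> 'z) \<Rightarrow> bool" where
  "equivariant G Y A A' f \<longleftrightarrow>
     (\<forall>y \<in> topspace Y. anchor A' (f y) = anchor A y) \<and>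
     (\<forall>(g, y) \<in> act_dom G Y A. f (act A g y) = act A' g (f y))"

section \<open>Actions of diagrams and groupoid models\<close>

text \<open>\<open>piece A x\<close> is \<open>Y\<^sub>x\<close> and \<open>dact A g \<gamma> y\<close> is \<open>\<gamma> \<cdot> y\<close> for \<open>\<gamma> \<in> \<X>\<^sub>g\<close> and \<open>y \<in> Y\<^bsub>s(g)\<^esub>\<close>.  Both
  take a fixed default value outside their mathematical domains.\<close>

record ('a, 'g, 'y) diagram_action =
  piece :: "'a \<Rightarrow> 'y set"
  dact :: "'a \<Rightarrow> 'g \<Rightarrow> 'y \<Rightarrow> 'y"

definition is_diagram_action ::
    "('a, 'g) diagram_data \<Rightarrow> 'y topology \<Rightarrow> ('a, 'g, 'y) diagram_action \<Rightarrow> bool" where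
  "is_diagram_action D Y A \<longleftrightarrow>
     (\<forall>x. x \<notin> Obj D \<longrightarrow> piece A x = {}) \<and>
     (\<forall>g \<gamma> y. \<not> (g \<in> Arr D \<and> \<gamma> \<in> corr_set D g \<and> y \<in> piece A (src D g)) \<longrightarrow>
        dact A g \<gamma> y = undefined) \<and>
     (\<Union>x \<in> Obj D. piece A x) = topspace Y \<and>
     disjoint_family_on (piece A) (Obj D) \<and>
     (\<forall>x \<in> Obj D. openin Y (piece A x) \<and> closedin Y (piece A x)) \<and>
     (\<forall>g \<in> Arr D.
        let X = prod_topology (discrete_topology (corr_set D g))
                  (subtopology Y (piece A (src D g)));
            Z = subtopology Y (piece A (rng D g));
            m = (\<lambda>(\<gamma>, y). dact A g \<gamma> y)
        in continuous_map X Z m \<and> open_map X Z m \<and> m ` topspace X = topspace Z) \<and>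
     (\<forall>g h. composable D g h \<longrightarrow>
        (\<forall>\<gamma>\<^sub>1 \<in> corr_set D g. \<forall>\<gamma>\<^sub>2 \<in> corr_set D h. \<forall>y \<in> piece A (src D h).
           dact A g \<gamma>\<^sub>1 (dact A h \<gamma>\<^sub>2 y) = dact A (cmp D g h) (corr_mult D g h \<gamma>\<^sub>1 \<gamma>\<^sub>2) y)) \<and>
     (\<forall>g \<in> Arr D. \<forall>\<gamma> \<in> corr_set D g. \<forall>\<gamma>' \<in> corr_set D g.
        \<forall>y \<in> piece A (src D g). \<forall>y' \<in> piece A (src D g).
          dact A g \<gamma> y = dact A g \<gamma>' y' \<longrightarrow>
          (\<exists>\<eta> \<in> carrier (Grp D (src D g)).
             \<gamma>' = corr_right D g \<gamma> \<eta> \<and> y = dact A (src D g) \<eta> y'))"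

definition diagram_equivariant :: "('a, 'g) diagram_data \<Rightarrow> ('a, 'g, 'y) diagram_action \<Rightarrow>
    ('a, 'g, 'z) diagram_action \<Rightarrow> ('y \<Rightarrow> 'z) \<Rightarrow> bool" where
  "diagram_equivariant D A A' f \<longleftrightarrow>
     (\<forall>x \<in> Obj D. f ` piece A x \<subseteq> piece A' x) \<and>
     (\<forall>g \<in> Arr D. \<forall>\<gamma> \<in> corr_set D g. \<forall>y \<in> piece A (src D g).
        f (dact A g \<gamma> y) = dact A' g \<gamma> (f y))"

text \<open>The type \<open>'y\<close> is the universe from which the points of the test spaces are drawn: the
  test spaces are all topological spaces whose underlying set is a subset of \<open>'y\<close>.\<close>

definition groupoid_model ::
    "'y itself \<Rightarrow> ('a, 'g) diagram_data \<Rightarrow> 'u top_groupoid \<Rightarrow> bool" where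
  "groupoid_model TYPE('y) D U \<longleftrightarrow>
     etale_groupoid U \<and>
     (\<exists>\<Phi> :: 'y topology \<Rightarrow> ('u, 'y) groupoid_action \<Rightarrow> ('a, 'g, 'y) diagram_action.
        (\<forall>Y. bij_betw (\<Phi> Y) {A. left_action U Y A} {B. is_diagram_action D Y B}) \<and>
        (\<forall>Y Y' A A' f. left_action U Y A \<longrightarrow> left_action U Y' A' \<longrightarrow> continuous_map Y Y' f \<longrightarrow>
           (equivariant U Y A A' f \<longleftrightarrow> diagram_equivariant D (\<Phi> Y A) (\<Phi> Y' A') f)))"

section \<open>Morita equivalence\<close>

definition opposite :: "'u top_groupoid \<Rightarrow> 'u top_groupoid" where
  "opposite G = G\<lparr>src := rng G, rng := src G, cmp := (\<lambda>g h. cmp G h g)\<rparr>"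

text \<open>\<open>principal_over G X A p Z\<close>: the action \<open>A\<close> of \<open>G\<close> on \<open>X\<close> is free and basic (the map
  \<open>(g, x) \<mapsto> (g \<cdot> x, x)\<close> is a homeomorphism onto its image), and \<open>p\<close> induces a homeomorphism
  from the orbit space to \<open>Z\<close>.\<close>

definition principal_over :: "'u top_groupoid \<Rightarrow> 'x topology \<Rightarrow> ('u, 'x) groupoid_action \<Rightarrow>
    ('x \<Rightarrow> 'z) \<Rightarrow> 'z topology \<Rightarrow> bool" where
  "principal_over G X A p Z \<longleftrightarrow>
     quotient_map X Z p \<and> open_map X Z p \<and>
     (\<forall>x \<in> topspace X. \<forall>x' \<in> topspace X.
        p x = p x' \<longleftrightarrow> (\<exists>g. (g, x) \<in> act_dom G X A \<and> x' = act A g x)) \<and>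
     embedding_map (subtopology (prod_topology (topo G) X) (act_dom G X A)) (prod_topology X X)
       (\<lambda>(g, x). (act A g x, x))"

text \<open>An equivalence is a space with commuting left \<open>G\<close>-action and right \<open>H\<close>-action (a left
  action of the opposite groupoid), each principal over the unit space of the other groupoid.
  Taking the points in \<open>'u \<times> 'v\<close> is no restriction: the fibres of \<open>X \<rightarrow> G\<^sup>0\<close> are orbits of free
  \<open>H\<close>-actions, so \<open>X\<close> injects into \<open>Obj G \<times> Arr H\<close>.\<close>

definition morita_equivalent :: "'u top_groupoid \<Rightarrow> 'v top_groupoid \<Rightarrow> bool" where
  "morita_equivalent G H \<longleftrightarrow>
     (\<exists>(X :: ('u \<times> 'v) topology) A B.
        left_action G X A \<and> left_action (opposite H) X B \<and>
        (\<forall>(g, x) \<in> act_dom G X A. anchor B (act A g x) = anchor B x) \<and>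
        (\<forall>(h, x) \<in> act_dom (opposite H) X B. anchor A (act B h x) = anchor A x) \<and>
        (\<forall>g h x. (g, x) \<in> act_dom G X A \<longrightarrow> (h, x) \<in> act_dom (opposite H) X B \<longrightarrow>
           act B h (act A g x) = act A g (act B h x)) \<and>
        principal_over G X A (anchor B) (obj_topo H) \<and>
        principal_over (opposite H) X B (anchor A) (obj_topo G))"

end

theory Submission
  imports Defs "HOL-Algebra.Bij"
begin

text \<open>
  In an action of a diagram on \<open>Y\<close>, the unit of the group at the source of \<open>g\<close> acts as a
  homeomorphism \<open>Y\<^bsub>s(g)\<^esub> \<rightarrow> Y\<^bsub>r(g)\<^esub>\<close>: it is onto because the action of \<open>\<gamma> \<in> \<X>\<^sub>g\<close> is the action of \<open>\<gamma>\<close> as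
  an element of the group on \<open>Y\<^bsub>s(g)\<^esub>\<close> followed by that of the unit, and injective by the cancellation
  condition (\<open>dact_homeomorphic\<close>).  In the extended diagram every object \<open>x\<close> has the cone arrow from \<open>x\<close> to \<open>\<infinity>\<close>,
  so all pieces \<open>Y\<^sub>x\<close> become identified with the one space \<open>Y\<^sub>\<infinity>\<close>.  Under these identifications each
  arrow \<open>g\<close> and each group element \<open>\<gamma>\<close> is a self-homeomorphism of \<open>Y\<^sub>\<infinity>\<close>, and what the laws of an
  action say about these homeomorphisms are the defining relations of the fundamental group \<open>\<Pi>\<^sub>1\<close>.  An
  action of the extended diagram is therefore a \<open>\<Pi>\<^sub>1\<close>-action on \<open>Y\<^sub>\<infinity>\<close> together with a copy of \<open>Y\<^sub>\<infinity>\<close> for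
  each object, which is an action of the product \<open>\<P>\<close> of \<open>\<Pi>\<^sub>1\<close> with the pair groupoid of the objects.
  This makes \<open>\<P>\<close> a groupoid model (\<open>groupoid_model_cone\<close>).

  It remains that a groupoid model is unique (\<open>groupoid_models_isomorphic\<close>).  For a unit \<open>x\<close> of a
  groupoid \<open>U\<close> the arrows with source \<open>x\<close> form the free \<open>U\<close>-space on one generator: every point \<open>y\<close>
  over \<open>x\<close> in any \<open>U\<close>-space receives the equivariant map \<open>u \<mapsto> u \<cdot> y\<close>.  If \<open>V\<close> has the same actions with
  the same equivariant maps, then these maps are \<open>V\<close>-equivariant too, so what an arrow of \<open>V\<close> does to
  \<open>y\<close> can be read off from what it does to the generator, which is an arrow of \<open>U\<close>.  This Yoneda
  argument, run in both directions, gives mutually inverse functors between \<open>U\<close> and \<open>V\<close>; both are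
  continuous because they are orbit maps for actions on the full arrow spaces.

  The groupoid \<open>\<P>\<close> is discrete and transitive with isotropy group \<open>\<Pi>\<^sub>1\<close>, so \<open>Obj U \<times> \<Pi>\<^sub>1\<close> is an
  equivalence between \<open>U\<close> and \<open>\<Pi>\<^sub>1\<close> (\<open>morita_equivalent_group_times_pair\<close>).
\<close>

section \<open>Presented groups\<close>

definition word_class :: "'s set \<Rightarrow> ('s word \<times> 's word) set \<Rightarrow> 's word \<Rightarrow> 's word set" where
  "word_class S R w = {(v, w). word_eq S R v w} `` {w}"

definition inverse_word :: "'s word \<Rightarrow> 's word" where
  "inverse_word w = rev (map (\<lambda>(e, x). (\<not> e, x)) w)"

lemma words_append [simp]: "a @ b \<in> words S \<longleftrightarrow> a \<in> words S \<and> b \<in> words S"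
  by (auto simp: words_def)

lemma words_Nil [simp]: "[] \<in> words S"
  by (auto simp: words_def)

lemma words_Cons [simp]: "(e, x) # w \<in> words S \<longleftrightarrow> x \<in> S \<and> w \<in> words S"
  by (auto simp: words_def)

lemma words_inverse_word [simp]: "w \<in> words S \<Longrightarrow> inverse_word w \<in> words S"
  by (induction w) (auto simp: inverse_word_def)

lemma word_eq_words: "word_eq S R v w \<Longrightarrow> v \<in> words S \<and> w \<in> words S"
  by (induction rule: word_eq.induct) auto

lemma equiv_word_eq: "equiv (words S) {(v, w). word_eq S R v w}"
proof (rule equivI)
  show "{(v, w). word_eq S R v w} \<subseteq> words S \<times> words S"
    using word_eq_words by fast
  show "refl_on (words S) {(v, w). word_eq S R v w}"
    by (auto simp: refl_on_def intro: word_eq.refl)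
  show "sym {(v, w). word_eq S R v w}"
    by (auto intro!: symI intro: word_eq.sym)
  show "trans {(v, w). word_eq S R v w}"
    by (rule transI) (use word_eq.trans in fastforce)
qed

lemma word_eq_append:
  assumes "word_eq S R a a'" "word_eq S R b b'"
  shows "word_eq S R (a @ b) (a' @ b')"
proof -
  have "word_eq S R (a @ b) (a' @ b)"
    using word_eq.congruence[OF assms(1), of "[]" b] word_eq_words[OF assms(2)] by simp
  moreover have "word_eq S R (a' @ b) (a' @ b')"
    using word_eq.congruence[OF assms(2), of a' "[]"] word_eq_words[OF assms(1)] by simp
  ultimately show ?thesis by (rule word_eq.trans)
qed

lemma word_class_eq_iff:
  "v \<in> words S \<Longrightarrow> w \<in> words S \<Longrightarrow> word_class S R v = word_class S R w \<longleftrightarrow> word_eq S R v w"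
  unfolding word_class_def using eq_equiv_class_iff[OF equiv_word_eq] by fastforce

lemma carrier_presented_group: "carrier (presented_group S R) = word_class S R ` words S"
  by (auto simp: presented_group_def Let_def quotient_def word_class_def)

lemma one_presented_group: "\<one>\<^bsub>presented_group S R\<^esub> = word_class S R []"
  by (simp add: presented_group_def Let_def word_class_def)

lemma word_class_mult:
  assumes "a \<in> words S" "b \<in> words S"
  shows "word_class S R a \<otimes>\<^bsub>presented_group S R\<^esub> word_class S R b = word_class S R (a @ b)"
proof -
  let ?E = "{(v, w). word_eq S R v w}"
  have 1: "\<And>v. v \<in> word_class S R a \<longleftrightarrow> word_eq S R a v" "\<And>v. v \<in> word_class S R b \<longleftrightarrow> word_eq S R b v"
    by (auto simp: word_class_def)
  have "?E `` {a' @ b' | a' b'. a' \<in> word_class S R a \<and> b' \<in> word_class S R b} = ?E `` {a @ b}"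
  proof (intro equalityI subsetI)
    fix v assume "v \<in> ?E `` {a' @ b' | a' b'. a' \<in> word_class S R a \<and> b' \<in> word_class S R b}"
    then obtain a' b' where "word_eq S R a a'" "word_eq S R b b'" "word_eq S R (a' @ b') v"
      unfolding 1 by blast
    then have "word_eq S R (a @ b) v"
      using word_eq_append word_eq.trans by metis
    then show "v \<in> ?E `` {a @ b}"
      by simp
  next
    fix v assume "v \<in> ?E `` {a @ b}"
    moreover have "a @ b \<in> {a' @ b' | a' b'. a' \<in> word_class S R a \<and> b' \<in> word_class S R b}"
      unfolding 1 using assms[THEN word_eq.refl] by blast
    ultimately show "v \<in> ?E `` {a' @ b' | a' b'. a' \<in> word_class S R a \<and> b' \<in> word_class S R b}"
      by blast
  qed
  then show ?thesis
    by (simp add: presented_group_def Let_def word_class_def)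
qed

lemma word_eq_inverse_word:
  "w \<in> words S \<Longrightarrow> word_eq S R (inverse_word w @ w) []"
proof (induction w)
  case Nil
  then show ?case by (simp add: inverse_word_def word_eq.refl)
next
  case (Cons s w)
  obtain e x where s: "s = (e, x)" by (cases s)
  have x: "x \<in> S" "w \<in> words S" using Cons.prems by (auto simp: s)
  have "word_eq S R (inverse_word w @ [(\<not> e, x), (\<not> \<not> e, x)] @ w) (inverse_word w @ [] @ w)"
    by (intro word_eq.congruence word_eq.cancel) (use x in auto)
  moreover have "inverse_word (s # w) @ s # w = inverse_word w @ [(\<not> e, x), (\<not> \<not> e, x)] @ w"
    by (simp add: inverse_word_def s)
  ultimately show ?case
    using word_eq.trans Cons.IH x by (metis append_Nil)
qed

lemma group_presented_group: "group (presented_group S R)"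
proof (rule groupI)
  fix x y z
  assume "x \<in> carrier (presented_group S R)" "y \<in> carrier (presented_group S R)"
    "z \<in> carrier (presented_group S R)"
  then obtain a b c where abc: "a \<in> words S" "b \<in> words S" "c \<in> words S"
    "x = word_class S R a" "y = word_class S R b" "z = word_class S R c"
    by (auto simp: carrier_presented_group)
  show "x \<otimes>\<^bsub>presented_group S R\<^esub> y \<otimes>\<^bsub>presented_group S R\<^esub> z
      = x \<otimes>\<^bsub>presented_group S R\<^esub> (y \<otimes>\<^bsub>presented_group S R\<^esub> z)"
    using abc by (simp add: word_class_mult)
next
  fix x assume "x \<in> carrier (presented_group S R)"
  then obtain a where a: "a \<in> words S" "x = word_class S R a"
    by (auto simp: carrier_presented_group)
  then have "word_class S R (inverse_word a) \<otimes>\<^bsub>presented_group S R\<^esub> x = \<one>\<^bsub>presented_group S R\<^esub>"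
    by (simp add: word_class_mult one_presented_group word_class_eq_iff word_eq_inverse_word)
  then show "\<exists>y\<in>carrier (presented_group S R).
      y \<otimes>\<^bsub>presented_group S R\<^esub> x = \<one>\<^bsub>presented_group S R\<^esub>"
    using a by (auto simp: carrier_presented_group)
next
  fix x y assume "x \<in> carrier (presented_group S R)" "y \<in> carrier (presented_group S R)"
  then show "x \<otimes>\<^bsub>presented_group S R\<^esub> y \<in> carrier (presented_group S R)"
    using words_append by (force simp: carrier_presented_group word_class_mult simp del: words_append)
next
  show "\<one>\<^bsub>presented_group S R\<^esub> \<in> carrier (presented_group S R)"
    by (simp add: carrier_presented_group one_presented_group)
next
  fix x assume "x \<in> carrier (presented_group S R)"
  then obtain a where "a \<in> words S" "x = word_class S R a"
    by (auto simp: carrier_presented_group)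
  then show "\<one>\<^bsub>presented_group S R\<^esub> \<otimes>\<^bsub>presented_group S R\<^esub> x = x"
    by (simp add: one_presented_group word_class_mult)
qed

lemma word_class_closed [simp]:
  "w \<in> words S \<Longrightarrow> word_class S R w \<in> carrier (presented_group S R)"
  by (simp add: carrier_presented_group)

lemma word_class_relation:
  "(v, w) \<in> R \<Longrightarrow> v \<in> words S \<Longrightarrow> w \<in> words S \<Longrightarrow> word_class S R v = word_class S R w"
  by (simp add: word_class_eq_iff word_eq.relation)

lemma inv_word_class_letter:
  assumes "x \<in> S"
  shows "inv\<^bsub>presented_group S R\<^esub> (word_class S R [(True, x)]) = word_class S R [(False, x)]"
proof (rule group.inv_equality[OF group_presented_group])
  have "word_eq S R [(False, x), (\<not> False, x)] []"
    by (rule word_eq.cancel) (fact assms)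
  then show "word_class S R [(False, x)] \<otimes>\<^bsub>presented_group S R\<^esub> word_class S R [(True, x)]
      = \<one>\<^bsub>presented_group S R\<^esub>"
    using assms by (simp add: word_class_mult one_presented_group word_class_eq_iff)
qed (use assms in auto)

text \<open>A word is built letter by letter from the left, so every element arises from the unit by
  multiplying with generators and their inverses from the left.\<close>

lemma presented_group_induct [consumes 1, case_names one gen inv_gen]:
  assumes p: "p \<in> carrier (presented_group S R)"
    and one: "P \<one>\<^bsub>presented_group S R\<^esub>"
    and gen: "\<And>s p. s \<in> S \<Longrightarrow> p \<in> carrier (presented_group S R) \<Longrightarrow> P p \<Longrightarrow>
      P (word_class S R [(True, s)] \<otimes>\<^bsub>presented_group S R\<^esub> p)"
    and inv_gen: "\<And>s p. s \<in> S \<Longrightarrow> p \<in> carrier (presented_group S R) \<Longrightarrow> P p \<Longrightarrow>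
      P (inv\<^bsub>presented_group S R\<^esub> (word_class S R [(True, s)]) \<otimes>\<^bsub>presented_group S R\<^esub> p)"
  shows "P p"
proof -
  have "w \<in> words S \<Longrightarrow> P (word_class S R w)" for w
  proof (induction w)
    case Nil
    then show ?case using one by (simp add: one_presented_group)
  next
    case (Cons l w)
    obtain e s where l: "l = (e, s)" by (cases l)
    have s: "s \<in> S" "w \<in> words S" using Cons.prems by (auto simp: l)
    show ?case
      using gen[of s "word_class S R w"] inv_gen[of s "word_class S R w"] s Cons.IH
      by (cases e) (simp_all add: l inv_word_class_letter word_class_mult)
  qed
  then show ?thesis using p by (auto simp: carrier_presented_group)
qed

fun word_value :: "('k, 'm) monoid_scheme \<Rightarrow> ('s \<Rightarrow> 'k) \<Rightarrow> 's word \<Rightarrow> 'k" where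
  "word_value K f [] = \<one>\<^bsub>K\<^esub>"
| "word_value K f ((e, s) # w) = (if e then f s else inv\<^bsub>K\<^esub> (f s)) \<otimes>\<^bsub>K\<^esub> word_value K f w"

lemma (in group) word_value_closed:
  "f \<in> S \<rightarrow> carrier G \<Longrightarrow> w \<in> words S \<Longrightarrow> word_value G f w \<in> carrier G"
  by (induction w) (auto simp: Pi_iff)

lemma (in group) word_value_append:
  assumes f: "f \<in> S \<rightarrow> carrier G" and w: "w \<in> words S"
  shows "v \<in> words S \<Longrightarrow> word_value G f (v @ w) = word_value G f v \<otimes> word_value G f w"
proof (induction v)
  case Nil
  then show ?case using word_value_closed[OF f w] by simp
next
  case (Cons l v)
  obtain e s where l: "l = (e, s)" by (cases l)
  have "f s \<in> carrier G" "v \<in> words S" using f Cons.prems by (auto simp: l Pi_iff)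
  then show ?case
    using Cons.IH word_value_closed[OF f w] word_value_closed[OF f, of v] by (simp add: l m_assoc)
qed

lemma (in group) word_eq_imp_word_value_eq:
  assumes f: "f \<in> S \<rightarrow> carrier G"
    and rels: "\<And>v w. (v, w) \<in> R \<Longrightarrow> v \<in> words S \<Longrightarrow> w \<in> words S \<Longrightarrow>
      word_value G f v = word_value G f w"
    and "word_eq S R v w"
  shows "word_value G f v = word_value G f w"
  using assms(3)
proof (induction rule: word_eq.induct)
  case (congruence v w a b)
  then show ?case
    using word_eq_words[OF congruence.hyps(1)] by (simp add: word_value_append[OF f])
next
  case (cancel x e)
  then show ?case using f by (cases e) (auto simp: Pi_iff)
qed (auto simp: rels)

text \<open>Von Dyck's theorem.  Evaluation of words respects cancellation in any group and respects \<open>R\<close> by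
  assumption, hence it respects \<open>word_eq\<close> and does not depend on the representative of a class.\<close>

lemma (in group) presented_group_universal:
  assumes f: "f \<in> S \<rightarrow> carrier G"
    and rels: "\<And>v w. (v, w) \<in> R \<Longrightarrow> v \<in> words S \<Longrightarrow> w \<in> words S \<Longrightarrow>
      word_value G f v = word_value G f w"
  obtains h where "h \<in> hom (presented_group S R) G"
    and "\<And>s. s \<in> S \<Longrightarrow> h (word_class S R [(True, s)]) = f s"
proof -
  define h where "h p = word_value G f (SOME w. w \<in> words S \<and> p = word_class S R w)" for p
  have h: "h (word_class S R w) = word_value G f w" if w: "w \<in> words S" for w
  proof -
    let ?v = "SOME v. v \<in> words S \<and> word_class S R w = word_class S R v"
    have "?v \<in> words S \<and> word_class S R w = word_class S R ?v"
      by (rule someI[of _ w]) (simp add: w)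
    then have "word_eq S R w ?v" using w word_class_eq_iff by blast
    then show ?thesis
      unfolding h_def using word_eq_imp_word_value_eq[OF f rels] by metis
  qed
  show thesis
  proof
    show "h \<in> hom (presented_group S R) G"
      by (auto simp: hom_def carrier_presented_group h word_value_closed[OF f] word_class_mult
          word_value_append[OF f])
    show "h (word_class S R [(True, s)]) = f s" if "s \<in> S" for s
      using f that by (simp add: h Pi_iff)
  qed
qed

section \<open>A groupoid is determined by its actions\<close>

lemma left_actionD:
  assumes "left_action G Y A"
  shows "y \<in> topspace Y \<Longrightarrow> anchor A y \<in> Obj G"
    and "(g, y) \<in> act_dom G Y A \<Longrightarrow> anchor A (act A g y) = rng G g"
    and "composable G g h \<Longrightarrow> (h, y) \<in> act_dom G Y A \<Longrightarrow>
      act A (cmp G g h) y = act A g (act A h y)"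
    and "y \<in> topspace Y \<Longrightarrow> act A (anchor A y) y = y"
    and "continuous_map Y (obj_topo G) (anchor A)"
    and "continuous_map (subtopology (prod_topology (topo G) Y) (act_dom G Y A)) Y
       (\<lambda>(g, y). act A g y)"
proof -
  show c: "continuous_map Y (obj_topo G) (anchor A)"
    and d: "continuous_map (subtopology (prod_topology (topo G) Y) (act_dom G Y A)) Y
       (\<lambda>(g, y). act A g y)"
    using assms by (auto simp: left_action_def)
  show "anchor A y \<in> Obj G" if "y \<in> topspace Y"
    using continuous_map_image_subset_topspace[OF c] that by (auto simp: obj_topo_def)
  show "(g, y) \<in> act_dom G Y A \<Longrightarrow> anchor A (act A g y) = rng G g"
    using assms by (auto simp: left_action_def)
  show "composable G g h \<Longrightarrow> (h, y) \<in> act_dom G Y A \<Longrightarrow>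
      act A (cmp G g h) y = act A g (act A h y)"
    using assms by (auto simp: left_action_def)
  show "y \<in> topspace Y \<Longrightarrow> act A (anchor A y) y = y"
    using assms by (auto simp: left_action_def)
qed

lemma (in topological_groupoid) act_closed:
  assumes "left_action G Y A" "(g, y) \<in> act_dom G Y A"
  shows "act A g y \<in> topspace Y"
  using continuous_map_image_subset_topspace[OF left_actionD(6)[OF assms(1)]] assms(2)
  by (fastforce simp: act_dom_def topspace_topo)

text \<open>Test spaces have their points in \<open>'y\<close>, so a set \<open>S\<close> of arrows enters through an injection \<open>i\<close>.
  Pulling the topology back along a left inverse of \<open>i\<close> makes \<open>i\<close> a homeomorphism from \<open>S\<close> onto the
  copy.\<close>

definition translation_space :: "('u \<Rightarrow> 'y) \<Rightarrow> 'u top_groupoid \<Rightarrow> 'u set \<Rightarrow> 'y topology" where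
  "translation_space i G S = pullback_topology (i ` S) (inv_into UNIV i) (topo G)"

definition translation_action ::
    "('u \<Rightarrow> 'y) \<Rightarrow> 'u top_groupoid \<Rightarrow> 'u set \<Rightarrow> ('u, 'y) groupoid_action" where
  "translation_action i G S =
     \<lparr>anchor = restrict (\<lambda>y. rng G (inv_into UNIV i y)) (i ` S),
      act = (\<lambda>g y. if g \<in> Arr G \<and> y \<in> i ` S \<and> src G g = rng G (inv_into UNIV i y)
                   then i (cmp G g (inv_into UNIV i y)) else undefined)\<rparr>"

text \<open>The star at a unit carries the free action generated by the unit itself; the orbit maps out of
  it, \<open>orbit_map\<close>, are the ones determined by the image of this generator.\<close>

definition star :: "'u top_groupoid \<Rightarrow> 'u \<Rightarrow> 'u set" where
  "star G x = {g \<in> Arr G. src G g = x}"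

context topological_groupoid
begin

lemma topspace_translation_space:
  "inj i \<Longrightarrow> S \<subseteq> Arr G \<Longrightarrow> topspace (translation_space i G S) = i ` S"
  by (auto simp: translation_space_def topspace_pullback_topology topspace_topo)

lemma continuous_inv_translation_space:
  "continuous_map (translation_space i G S) (topo G) (inv_into UNIV i)"
  unfolding translation_space_def
  using continuous_map_pullback[OF continuous_map_id, of "i ` S" "inv_into UNIV i" "topo G"] by simp

lemma continuous_into_translation_space:
  assumes "inj i" "continuous_map Z (topo G) f" "f ` topspace Z \<subseteq> S"
  shows "continuous_map Z (translation_space i G S) (\<lambda>z. i (f z))"
  unfolding translation_space_def
  by (rule continuous_map_pullback') (use assms in \<open>auto simp: o_def\<close>)

lemma act_translation_action:
  "inj i \<Longrightarrow> S \<subseteq> Arr G \<Longrightarrow> s \<in> S \<Longrightarrow> composable G g s \<Longrightarrow>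
    act (translation_action i G S) g (i s) = i (cmp G g s)"
  by (auto simp: translation_action_def composable_def)

lemma anchor_translation_action:
  "inj i \<Longrightarrow> s \<in> S \<Longrightarrow> anchor (translation_action i G S) (i s) = rng G s"
  by (auto simp: translation_action_def)

lemma act_dom_translation_action:
  "inj i \<Longrightarrow> S \<subseteq> Arr G \<Longrightarrow>
   act_dom G (translation_space i G S) (translation_action i G S)
     = {(g, i s) | g s. s \<in> S \<and> composable G g s}"
  by (auto simp: act_dom_def topspace_translation_space anchor_translation_action composable_def;
      blast)

lemma left_action_translation:
  assumes i: "inj i" and S: "S \<subseteq> Arr G"
    and invariant: "\<And>g s. s \<in> S \<Longrightarrow> composable G g s \<Longrightarrow> cmp G g s \<in> S"
  shows "left_action G (translation_space i G S) (translation_action i G S)" (is "left_action G ?Y ?A")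
proof -
  have dom: "act_dom G ?Y ?A = {(g, i s) | g s. s \<in> S \<and> composable G g s}"
    using i S by (rule act_dom_translation_action)
  have top: "topspace ?Y = i ` S" using i S by (rule topspace_translation_space)
  have "continuous_map ?Y (obj_topo G) (\<lambda>y. rng G (inv_into UNIV i y))"
    using continuous_map_compose[OF continuous_inv_translation_space continuous_rng]
    by (simp add: o_def)
  then have anchor: "continuous_map ?Y (obj_topo G) (anchor ?A)"
    by (rule continuous_map_eq) (simp add: top translation_action_def)
  let ?W = "subtopology (prod_topology (topo G) ?Y) (act_dom G ?Y ?A)"
  have W: "topspace ?W = act_dom G ?Y ?A"
    by (auto simp: act_dom_def topspace_topo)
  have "continuous_map ?W (prod_topology (topo G) (topo G)) (\<lambda>(g, y). (g, inv_into UNIV i y))"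
    by (rule continuous_map_from_subtopology)
      (simp add: case_prod_unfold continuous_map_pairedI continuous_map_fst
        continuous_map_compose[OF continuous_map_snd continuous_inv_translation_space, unfolded o_def])
  then have "continuous_map ?W
      (subtopology (prod_topology (topo G) (topo G)) {(g, h). composable G g h})
      (\<lambda>(g, y). (g, inv_into UNIV i y))"
    unfolding continuous_map_in_subtopology W
    using i by (auto simp: dom)
  from continuous_map_compose[OF this continuous_cmp]
  have "continuous_map ?W (topo G) (\<lambda>(g, y). cmp G g (inv_into UNIV i y))"
    by (simp add: o_def case_prod_unfold)
  then have "continuous_map ?W ?Y (\<lambda>w. i ((\<lambda>(g, y). cmp G g (inv_into UNIV i y)) w))"
    by (rule continuous_into_translation_space[OF i]) (use i invariant in \<open>auto simp: W dom\<close>)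
  then have act: "continuous_map ?W ?Y (\<lambda>(g, y). act ?A g y)"
    by (rule continuous_map_eq)
      (use i S in \<open>auto simp: W dom act_translation_action\<close>)
  show ?thesis
    unfolding left_action_def
  proof (intro conjI allI impI ballI)
    show "anchor ?A \<in> extensional (topspace ?Y)"
      by (simp add: top) (simp add: translation_action_def)
    show "act ?A g y = undefined" if "(g, y) \<notin> act_dom G ?Y ?A" for g y
      using that i S unfolding dom by (auto simp: translation_action_def composable_def)
    show "case w of (g, y) \<Rightarrow> anchor ?A (act ?A g y) = rng G g" if "w \<in> act_dom G ?Y ?A" for w
      using that i S invariant
      by (auto simp: dom act_translation_action anchor_translation_action rng_cmp)
    show "act ?A (cmp G g h) y = act ?A g (act ?A h y)"
      if gh: "composable G g h" and hy: "(h, y) \<in> act_dom G ?Y ?A" for g h y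
    proof -
      obtain s where s: "y = i s" "s \<in> S" "composable G h s" using hy by (auto simp: dom)
      have "composable G (cmp G g h) s" "composable G g (cmp G h s)"
        using gh s(3) by (auto simp: composable_def cmp_Arr src_cmp rng_cmp)
      then show ?thesis
        using s gh i S invariant by (simp add: act_translation_action cmp_assoc)
    qed
    show "act ?A (anchor ?A y) y = y" if y: "y \<in> topspace ?Y" for y
    proof -
      obtain s where s: "y = i s" "s \<in> S" using y by (auto simp: top)
      then have "composable G (rng G s) s"
        using S Obj_subset rng_Obj by (auto simp: composable_def src_ident)
      then show ?thesis
        using s i S by (auto simp: act_translation_action anchor_translation_action cmp_ident_left)
    qed
  qed (fact anchor act)+
qed

lemma star_subset: "star G x \<subseteq> Arr G"
  by (auto simp: star_def)

lemma left_action_star: "inj i \<Longrightarrow>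
    left_action G (translation_space i G (star G x)) (translation_action i G (star G x))"
  by (rule left_action_translation) (auto simp: star_def cmp_Arr src_cmp)

lemma left_action_full: "inj i \<Longrightarrow>
    left_action G (translation_space i G (Arr G)) (translation_action i G (Arr G))"
  by (rule left_action_translation) (auto simp: cmp_Arr)

text \<open>A point \<open>y\<close> with anchor \<open>x\<close> corresponds to the equivariant map from the star at \<open>x\<close> that sends the
  generator \<open>x\<close> to \<open>y\<close>.\<close>

lemma orbit_map:
  assumes i: "inj i" and A: "left_action G Y A" and y: "y \<in> topspace Y"
  defines "x \<equiv> anchor A y"
  shows "continuous_map (translation_space i G (star G x)) Y (\<lambda>z. act A (inv_into UNIV i z) y)" (is ?c)
    and "equivariant G (translation_space i G (star G x)) (translation_action i G (star G x)) A
      (\<lambda>z. act A (inv_into UNIV i z) y)" (is ?e)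
proof -
  let ?Y = "translation_space i G (star G x)"
  have top: "topspace ?Y = i ` star G x" by (simp add: i star_subset topspace_translation_space)
  have "continuous_map ?Y (prod_topology (topo G) Y) (\<lambda>z. (inv_into UNIV i z, y))"
    by (simp add: continuous_map_pairedI continuous_inv_translation_space y)
  then have "continuous_map ?Y (subtopology (prod_topology (topo G) Y) (act_dom G Y A))
      (\<lambda>z. (inv_into UNIV i z, y))"
    unfolding continuous_map_in_subtopology top
    using i y by (auto simp: act_dom_def star_def x_def)
  from continuous_map_compose[OF this left_actionD(6)[OF A]]
  show ?c by (simp add: o_def)
  have dom: "(g, y) \<in> act_dom G Y A" if "g \<in> star G x" for g
    using that y by (auto simp: act_dom_def star_def x_def)
  show ?e
    unfolding equivariant_def
    using i star_subset[of x]
    by (auto simp: top act_dom_translation_action anchor_translation_action act_translation_action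
      left_actionD(2)[OF A dom] left_actionD(3)[OF A _ dom])
qed

end

text \<open>Both groupoids act on the same spaces, \<open>T\<close> matches their actions, and matching actions have the
  same equivariant maps.  A relation \<open>T\<close> instead of a bijection keeps the situation symmetric in \<open>U\<close>
  and \<open>V\<close>, so that each result can be used with the roles exchanged (\<open>swap\<close>).\<close>

locale action_correspondence = U: topological_groupoid U + V: topological_groupoid V
  for U :: "'u top_groupoid" and V :: "'v top_groupoid" +
  fixes i :: "'u \<Rightarrow> 'y" and j :: "'v \<Rightarrow> 'y"
    and T :: "'y topology \<Rightarrow> ('u, 'y) groupoid_action \<Rightarrow> ('v, 'y) groupoid_action \<Rightarrow> bool"
  assumes inj_i: "inj i" and inj_j: "inj j"
    and T_left: "T Y A B \<Longrightarrow> left_action U Y A"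
    and T_right: "T Y A B \<Longrightarrow> left_action V Y B"
    and T_total: "left_action U Y A \<Longrightarrow> \<exists>B. T Y A B"
    and T_surj: "left_action V Y B \<Longrightarrow> \<exists>A. T Y A B"
    and T_equivariant: "T Y A B \<Longrightarrow> T Y' A' B' \<Longrightarrow> continuous_map Y Y' f \<Longrightarrow>
      equivariant U Y A A' f \<longleftrightarrow> equivariant V Y B B' f"
begin

lemma swap: "action_correspondence V U j i (\<lambda>Y B A. T Y A B)"
  by unfold_locales (use inj_i inj_j T_left T_right T_total T_surj T_equivariant in blast)+

text \<open>The pair consists of the map \<open>\<theta>\<close> on units and the map \<open>f\<close> on arrows along which every \<open>V\<close>-action
  restricts to the matching \<open>U\<close>-action.  On units the two maps turn out to agree.\<close>

definition intertwiner :: "('u \<Rightarrow> 'v) \<Rightarrow> ('u \<Rightarrow> 'v) \<Rightarrow> bool" where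
  "intertwiner \<theta> f \<longleftrightarrow> (\<forall>Y A B y. T Y A B \<longrightarrow> y \<in> topspace Y \<longrightarrow>
     anchor B y = \<theta> (anchor A y) \<and>
     (\<forall>u \<in> Arr U. src U u = anchor A y \<longrightarrow>
        f u \<in> Arr V \<and> src V (f u) = \<theta> (src U u) \<and> act A u y = act B (f u) y))"

text \<open>Let \<open>B' x\<close> be the \<open>V\<close>-action that matches left translation on the star at \<open>x\<close>.  The orbit map of \<open>y\<close>
  is \<open>U\<close>-equivariant, hence also \<open>V\<close>-equivariant, and sends the generator \<open>x\<close> to \<open>y\<close>.  So the anchor of
  \<open>y\<close> is that of the generator, and if \<open>p\<close> moves the generator to the arrow \<open>u = F x p\<close> of \<open>U\<close>, then it
  moves \<open>y\<close> to \<open>u \<cdot> y\<close>.\<close>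

lemma orbit_transfer:
  obtains \<theta> F where "\<And>Y A B y. T Y A B \<Longrightarrow> y \<in> topspace Y \<Longrightarrow> anchor B y = \<theta> (anchor A y)"
    and "\<And>Y A B y p. T Y A B \<Longrightarrow> y \<in> topspace Y \<Longrightarrow> p \<in> Arr V \<Longrightarrow> src V p = anchor B y \<Longrightarrow>
      F (anchor A y) p \<in> star U (anchor A y) \<and> act B p y = act A (F (anchor A y) p) y"
proof -
  let ?Y = "\<lambda>x. translation_space i U (star U x)" and ?L = "\<lambda>x. translation_action i U (star U x)"
  obtain B' where B': "\<And>x. T (?Y x) (?L x) (B' x)"
    using T_total[OF U.left_action_star[OF inj_i]] by metis
  define \<theta> where "\<theta> x = anchor (B' x) (i x)" for x
  define F where "F x p = inv_into UNIV i (act (B' x) p (i x))" for x p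
  have top: "topspace (?Y x) = i ` star U x" for x
    by (simp add: inj_i U.star_subset U.topspace_translation_space)
  have main: "anchor B y = \<theta> (anchor A y)"
    "p \<in> Arr V \<Longrightarrow> src V p = anchor B y \<Longrightarrow>
      F (anchor A y) p \<in> star U (anchor A y) \<and> act B p y = act A (F (anchor A y) p) y"
    if T: "T Y A B" and y: "y \<in> topspace Y" for Y A B y p
  proof -
    define x where "x = anchor A y"
    let ?o = "\<lambda>z. act A (inv_into UNIV i z) y"
    note A = T_left[OF T]
    have x: "x \<in> star U x"
      using left_actionD(1)[OF A y] U.Obj_subset by (auto simp: star_def x_def U.src_ident)
    have equi: "equivariant V (?Y x) (B' x) B ?o"
      using T_equivariant[OF B' T] U.orbit_map[OF inj_i A y] by (simp add: x_def)
    have ox: "?o (i x) = y" using left_actionD(4)[OF A y] by (simp add: inj_i x_def)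
    have ix: "i x \<in> topspace (?Y x)" using x by (simp add: top)
    show \<theta>: "anchor B y = \<theta> (anchor A y)"
      using equi ix ox unfolding equivariant_def \<theta>_def x_def by metis
    show "F (anchor A y) p \<in> star U (anchor A y) \<and> act B p y = act A (F (anchor A y) p) y"
      if p: "p \<in> Arr V" "src V p = anchor B y"
    proof -
      have dom: "(p, i x) \<in> act_dom V (?Y x) (B' x)"
        using p \<theta> ix by (simp add: act_dom_def \<theta>_def x_def)
      then have "act (B' x) p (i x) \<in> i ` star U x"
        using V.act_closed[OF T_right[OF B'] dom] by (simp add: top)
      then have "F x p \<in> star U x" using inj_i by (auto simp: F_def)
      moreover have "?o (act (B' x) p (i x)) = act B p (?o (i x))"
        using equi dom unfolding equivariant_def by blast
      then have "act A (F x p) y = act B p y" by (simp only: ox F_def)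
      ultimately show ?thesis by (simp add: x_def)
    qed
  qed
  show thesis by (rule that[of \<theta> F]) (use main in blast)+
qed

text \<open>The arrow map is the transfer \<open>F'\<close> obtained with the roles of \<open>U\<close> and \<open>V\<close> exchanged.  It depends on
  an arrow of \<open>U\<close> and on a unit of \<open>V\<close>, and \<open>\<theta>\<close> supplies the latter.\<close>

lemma intertwiner_exists: obtains \<theta> f where "intertwiner \<theta> f"
proof -
  interpret S: action_correspondence V U j i "\<lambda>Y B A. T Y A B" by (rule swap)
  obtain \<theta> F where \<theta>: "\<And>Y A B y. T Y A B \<Longrightarrow> y \<in> topspace Y \<Longrightarrow> anchor B y = \<theta> (anchor A y)"
    by (rule orbit_transfer) blast
  obtain \<theta>' F' where F': "\<And>Y A B y u. T Y A B \<Longrightarrow> y \<in> topspace Y \<Longrightarrow> u \<in> Arr U \<Longrightarrow>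
      src U u = anchor A y \<Longrightarrow>
      F' (anchor B y) u \<in> star V (anchor B y) \<and> act A u y = act B (F' (anchor B y) u) y"
    by (rule S.orbit_transfer) blast
  have "intertwiner \<theta> (\<lambda>u. F' (\<theta> (src U u)) u)"
    unfolding intertwiner_def
    using \<theta> F' by (fastforce simp: star_def)
  then show thesis by (rule that)
qed

text \<open>Translating the generator of a star by \<open>u\<close> gives back \<open>u\<close>.  On the other hand, passing to the
  \<open>V\<close>-action and back replaces \<open>u\<close> by \<open>f' (f u)\<close> without changing the result.\<close>

lemma intertwiner_inverse:
  assumes f: "intertwiner \<theta> f"
    and f': "action_correspondence.intertwiner V U (\<lambda>Y B A. T Y A B) \<theta>' f'"
    and u: "u \<in> Arr U"
  shows "f u \<in> Arr V" "f' (f u) = u" "\<theta>' (\<theta> (src U u)) = src U u" "\<theta> (src U u) \<in> Obj V"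
    "src V (f u) = \<theta> (src U u)"
proof -
  interpret S: action_correspondence V U j i "\<lambda>Y B A. T Y A B" by (rule swap)
  let ?x = "src U u"
  let ?Y = "translation_space i U (star U ?x)" and ?L = "translation_action i U (star U ?x)"
  obtain B where B: "T ?Y ?L B"
    using T_total[OF U.left_action_star[OF inj_i]] by blast
  have x: "?x \<in> star U ?x" "?x \<in> Obj U"
    using U.src_Obj[OF u] U.Obj_subset by (auto simp: star_def U.src_ident)
  have y: "i ?x \<in> topspace ?Y"
    using x by (simp add: inj_i U.star_subset U.topspace_translation_space)
  have a: "anchor ?L (i ?x) = ?x"
    using x by (simp add: inj_i U.anchor_translation_action U.rng_ident)
  have act: "act ?L v (i ?x) = i v" if "v \<in> Arr U" "src U v = ?x" for v
    using that x U.act_translation_action[OF inj_i U.star_subset x(1), of v] U.cmp_ident_right[of v]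
    by (auto simp: composable_def star_def U.rng_ident)
  have 1: "anchor B (i ?x) = \<theta> ?x" "f u \<in> Arr V" "src V (f u) = \<theta> ?x"
    "act ?L u (i ?x) = act B (f u) (i ?x)"
    using f[unfolded intertwiner_def, rule_format, OF B y] u unfolding a by auto
  have 2: "?x = \<theta>' (\<theta> ?x)" "f' (f u) \<in> Arr U" "src U (f' (f u)) = \<theta>' (\<theta> ?x)"
    "act B (f u) (i ?x) = act ?L (f' (f u)) (i ?x)"
    using f'[unfolded S.intertwiner_def, rule_format, OF B y] 1 unfolding a by auto
  show "f u \<in> Arr V" "\<theta>' (\<theta> ?x) = ?x" "src V (f u) = \<theta> ?x" using 1 2 by auto
  show "\<theta> ?x \<in> Obj V" using left_actionD(1)[OF T_right[OF B] y] 1 by simp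
  have "i u = i (f' (f u))" using act u 1 2 by metis
  then show "f' (f u) = u" using inj_i by (simp add: inj_eq)
qed

text \<open>Here the test space is a star of \<open>V\<close>, on which \<open>f u\<close> can be recovered as the image of the generator
  under \<open>u\<close>.  The functor laws are then the laws of the \<open>U\<close>-action on this star.\<close>

lemma intertwiner_functor:
  assumes f: "intertwiner \<theta> f"
    and f': "action_correspondence.intertwiner V U (\<lambda>Y B A. T Y A B) \<theta>' f'"
  shows "x \<in> Obj U \<Longrightarrow> f x = \<theta> x"
    and "u \<in> Arr U \<Longrightarrow> rng V (f u) = \<theta> (rng U u)"
    and "composable U g h \<Longrightarrow> f (cmp U g h) = cmp V (f g) (f h)"
proof -
  interpret S: action_correspondence V U j i "\<lambda>Y B A. T Y A B" by (rule swap)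
  let ?Y = "\<lambda>x. translation_space j V (star V (\<theta> x))"
    and ?L = "\<lambda>x. translation_action j V (star V (\<theta> x))"
  have ob: "\<theta> x \<in> star V (\<theta> x)" "\<theta> x \<in> Obj V" "\<theta>' (\<theta> x) = x" if "x \<in> Obj U" for x
    using that intertwiner_inverse(3,4)[OF f f', of x] U.Obj_subset V.Obj_subset
    by (auto simp: star_def V.src_ident U.src_ident)
  have "\<exists>A. T (?Y x) A (?L x)" for x
    using T_surj[OF V.left_action_star[OF inj_j]] by blast
  then obtain A where A: "\<And>x. T (?Y x) (A x) (?L x)" by metis
  have top: "topspace (?Y x) = j ` star V (\<theta> x)" for x
    by (simp add: inj_j V.star_subset V.topspace_translation_space)
  have y: "j (\<theta> x) \<in> topspace (?Y x)" if "x \<in> Obj U" for x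
    using ob(1)[OF that] by (simp add: top)
  have a: "anchor (A x) (j (\<theta> x)) = x" if x: "x \<in> Obj U" for x
    using f'[unfolded S.intertwiner_def, rule_format, OF A y[OF x]] ob[OF x]
    by (simp add: inj_j V.anchor_translation_action V.rng_ident)
  have act: "act (A (src U u)) u (j (\<theta> (src U u))) = j (f u)"
    "(u, j (\<theta> (src U u))) \<in> act_dom U (?Y (src U u)) (A (src U u))"
    "f u \<in> star V (\<theta> (src U u))" if u: "u \<in> Arr U" for u
  proof -
    let ?x = "src U u"
    have x: "?x \<in> Obj U" by (rule U.src_Obj[OF u])
    have fu: "f u \<in> Arr V" "src V (f u) = \<theta> ?x"
      "act (A ?x) u (j (\<theta> ?x)) = act (?L ?x) (f u) (j (\<theta> ?x))"
      using f[unfolded intertwiner_def, rule_format, OF A y[OF x]] u unfolding a[OF x] by auto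
    have "act (?L ?x) (f u) (j (\<theta> ?x)) = j (cmp V (f u) (\<theta> ?x))"
      using V.act_translation_action[OF inj_j V.star_subset ob(1)[OF x], of "f u"] fu ob[OF x]
        V.Obj_subset by (auto simp: composable_def V.rng_ident)
    also have "cmp V (f u) (\<theta> ?x) = f u" using V.cmp_ident_right fu by metis
    finally show "act (A ?x) u (j (\<theta> ?x)) = j (f u)" using fu by simp
    show "(u, j (\<theta> ?x)) \<in> act_dom U (?Y ?x) (A ?x)"
      using u y[OF x] a[OF x] by (simp add: act_dom_def)
    show "f u \<in> star V (\<theta> ?x)" using fu by (simp add: star_def)
  qed
  show "f x = \<theta> x" if x: "x \<in> Obj U" for x
  proof -
    have "j (f x) = act (A x) x (j (\<theta> x))" using act(1)[of x] x U.Obj_subset by (auto simp: U.src_ident)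
    also have "\<dots> = j (\<theta> x)" using left_actionD(4)[OF T_left[OF A] y[OF x]] a[OF x] by simp
    finally show ?thesis using inj_j by (simp add: inj_eq)
  qed
  have acty: "j (f u) \<in> topspace (?Y (src U u))" if u: "u \<in> Arr U" for u
    using U.act_closed[OF T_left[OF A] act(2)[OF u]] act(1)[OF u] by simp
  have actA: "anchor (A (src U u)) (j (f u)) = rng U u" if u: "u \<in> Arr U" for u
    using left_actionD(2)[OF T_left[OF A] act(2)[OF u]] act(1)[OF u] by simp
  show rng: "rng V (f u) = \<theta> (rng U u)" if u: "u \<in> Arr U" for u
    using f[unfolded intertwiner_def, rule_format, OF A acty[OF u]] actA[OF u]
      V.anchor_translation_action[OF inj_j act(3)[OF u]] by simp
  show "f (cmp U g h) = cmp V (f g) (f h)" if gh: "composable U g h"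
  proof -
    have g: "g \<in> Arr U" and h: "h \<in> Arr U" and s: "src U g = rng U h"
      using gh by (auto simp: composable_def)
    let ?x = "src U h"
    have comp: "composable V (f g) (f h)"
      using intertwiner_inverse(1,5)[OF f f'] g h s rng[OF h] by (simp add: composable_def)
    have "j (f (cmp U g h)) = act (A ?x) (cmp U g h) (j (\<theta> ?x))"
      using act(1)[OF U.cmp_Arr[OF gh]] by (simp add: U.src_cmp[OF gh])
    also have "\<dots> = act (A ?x) g (j (f h))"
      using left_actionD(3)[OF T_left[OF A] gh act(2)[OF h]] act(1)[OF h] by simp
    also have "\<dots> = act (?L ?x) (f g) (j (f h))"
      using f[unfolded intertwiner_def, rule_format, OF A acty[OF h]] g s actA[OF h] by simp
    also have "\<dots> = j (cmp V (f g) (f h))"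
      by (rule V.act_translation_action[OF inj_j V.star_subset act(3)[OF h] comp])
    finally show ?thesis using inj_j by (simp add: inj_eq)
  qed
qed

text \<open>The map \<open>f\<close> is \<open>u \<mapsto> u \<cdot> \<theta> (src U u)\<close> for the \<open>U\<close>-action on all arrows of \<open>V\<close>, so it inherits
  continuity from this action and from \<open>\<theta>\<close>.  In turn, \<open>\<theta>\<close> composed with the range map is the anchor map
  of a \<open>V\<close>-action on the arrows of \<open>U\<close>.  The sources vary here, so the stars do not suffice as test
  spaces.\<close>

lemma intertwiner_continuous:
  assumes f: "intertwiner \<theta> f"
    and f': "action_correspondence.intertwiner V U (\<lambda>Y B A. T Y A B) \<theta>' f'"
  shows "continuous_map (topo U) (topo V) f"
proof -
  interpret S: action_correspondence V U j i "\<lambda>Y B A. T Y A B" by (rule swap)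
  let ?Y = "translation_space i U (Arr U)" and ?L = "translation_action i U (Arr U)"
  let ?Y' = "translation_space j V (Arr V)" and ?L' = "translation_action j V (Arr V)"
  have top: "topspace ?Y = i ` Arr U" "topspace ?Y' = j ` Arr V"
    by (simp_all add: inj_i inj_j U.topspace_translation_space V.topspace_translation_space)
  obtain B where B: "T ?Y ?L B" using T_total[OF U.left_action_full[OF inj_i]] by blast
  obtain A where A: "T ?Y' A ?L'" using T_surj[OF V.left_action_full[OF inj_j]] by blast
  have "continuous_map (topo U) ?Y i"
    using U.continuous_into_translation_space[OF inj_i continuous_map_id, of "Arr U"]
    by (simp add: U.topspace_topo)
  then have "continuous_map (topo U) (obj_topo V) (anchor B \<circ> i)"
    using left_actionD(5)[OF T_right[OF B]] by (rule continuous_map_compose)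
  then have "continuous_map (topo U) (obj_topo V) (\<lambda>u. \<theta> (rng U u))"
  proof (rule continuous_map_eq)
    fix u assume "u \<in> topspace (topo U)"
    then have "u \<in> Arr U" by (simp add: U.topspace_topo)
    then show "(anchor B \<circ> i) u = \<theta> (rng U u)"
      using f[unfolded intertwiner_def, rule_format, OF B, of "i u"]
      by (simp add: top inj_i U.anchor_translation_action)
  qed
  then have rng: "continuous_map (topo U) (topo V) (\<lambda>u. \<theta> (rng U u))"
    unfolding obj_topo_def continuous_map_in_subtopology by blast
  have "continuous_map (topo U) (topo U) (src U)"
    using U.continuous_src unfolding obj_topo_def continuous_map_in_subtopology by blast
  (* The range of a unit is the unit itself, which turns continuity along the range map into
     continuity along the source map. *)
  then have "continuous_map (topo U) (topo V) (\<lambda>u. \<theta> (rng U (src U u)))"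
    using continuous_map_compose[OF _ rng, of "topo U" "src U"] by (simp add: o_def)
  then have "continuous_map (topo U) (topo V) (\<lambda>u. \<theta> (src U u))"
    by (rule continuous_map_eq) (simp add: U.topspace_topo U.src_Obj U.rng_ident)
  then have base: "continuous_map (topo U) ?Y' (\<lambda>u. j (\<theta> (src U u)))"
    by (rule V.continuous_into_translation_space[OF inj_j])
      (use intertwiner_inverse(4)[OF f f'] V.Obj_subset in \<open>auto simp: U.topspace_topo\<close>)
  have y: "\<theta> (src U u) \<in> Arr V" "\<theta> (src U u) \<in> Obj V" "anchor A (j (\<theta> (src U u))) = src U u"
    if u: "u \<in> Arr U" for u
  proof -
    show *: "\<theta> (src U u) \<in> Obj V" by (rule intertwiner_inverse(4)[OF f f' u])
    then show **: "\<theta> (src U u) \<in> Arr V" using V.Obj_subset by blast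
    show "anchor A (j (\<theta> (src U u))) = src U u"
      using f'[unfolded S.intertwiner_def, rule_format, OF A, of "j (\<theta> (src U u))"] * **
        intertwiner_inverse(3)[OF f f' u]
      by (simp add: top inj_j V.anchor_translation_action V.rng_ident)
  qed
  have "continuous_map (topo U) (prod_topology (topo U) ?Y') (\<lambda>u. (u, j (\<theta> (src U u))))"
    by (simp add: continuous_map_pairedI base)
  then have "continuous_map (topo U) (subtopology (prod_topology (topo U) ?Y') (act_dom U ?Y' A))
      (\<lambda>u. (u, j (\<theta> (src U u))))"
    unfolding continuous_map_in_subtopology
    using y by (auto simp: U.topspace_topo act_dom_def top)
  from continuous_map_compose[OF this left_actionD(6)[OF T_left[OF A]]]
  have "continuous_map (topo U) ?Y' (\<lambda>u. act A u (j (\<theta> (src U u))))"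
    by (simp add: o_def)
  from continuous_map_compose[OF this V.continuous_inv_translation_space]
  have "continuous_map (topo U) (topo V) (\<lambda>u. inv_into UNIV j (act A u (j (\<theta> (src U u)))))"
    by (simp add: o_def)
  then show ?thesis
  proof (rule continuous_map_eq)
    fix u assume "u \<in> topspace (topo U)"
    then have u: "u \<in> Arr U" by (simp add: U.topspace_topo)
    have fu: "f u \<in> Arr V" "src V (f u) = \<theta> (src U u)"
      by (rule intertwiner_inverse(1,5)[OF f f' u])+
    have "act A u (j (\<theta> (src U u))) = act ?L' (f u) (j (\<theta> (src U u)))"
      using f[unfolded intertwiner_def, rule_format, OF A, of "j (\<theta> (src U u))"] u y[OF u]
      by (simp add: top)
    also have "\<dots> = j (cmp V (f u) (\<theta> (src U u)))"
      by (rule V.act_translation_action[OF inj_j])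
        (use y[OF u] fu in \<open>auto simp: composable_def V.rng_ident\<close>)
    also have "cmp V (f u) (\<theta> (src U u)) = f u" using V.cmp_ident_right fu by metis
    finally show "inv_into UNIV j (act A u (j (\<theta> (src U u)))) = f u" by (simp add: inj_j)
  qed
qed

theorem corresponding_groupoids_isomorphic: "isomorphic_groupoids U V"
proof -
  interpret S: action_correspondence V U j i "\<lambda>Y B A. T Y A B" by (rule swap)
  obtain \<theta> f where f: "intertwiner \<theta> f" by (rule intertwiner_exists)
  obtain \<theta>' f' where f': "S.intertwiner \<theta>' f'" by (rule S.intertwiner_exists)
  note inv = intertwiner_inverse[OF f f'] and inv' = S.intertwiner_inverse[OF f' f]
  note funct = intertwiner_functor[OF f f'] and funct' = S.intertwiner_functor[OF f' f]
  have hom: "homeomorphic_maps (topo U) (topo V) f f'"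
    unfolding homeomorphic_maps_def
    using intertwiner_continuous[OF f f'] S.intertwiner_continuous[OF f' f] inv(2) inv'(2)
    by (simp add: U.topspace_topo V.topspace_topo)
  have ob: "f x \<in> Obj V" if "x \<in> Obj U" for x
    using inv(4)[of x] funct(1)[of x] that U.Obj_subset by (auto simp: U.src_ident)
  have ob': "f' x \<in> Obj U" if "x \<in> Obj V" for x
    using inv'(4)[of x] funct'(1)[of x] that V.Obj_subset by (auto simp: V.src_ident)
  have "groupoid_iso U V f"
    unfolding groupoid_iso_def
  proof (intro conjI ballI allI impI)
    show "homeomorphic_map (topo U) (topo V) f" using hom homeomorphic_maps_map by blast
    show "bij_betw f (Arr U) (Arr V)"
      by (rule bij_betw_byWitness[of _ f']) (use inv inv' in auto)
    show "f ` Obj U = Obj V"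
    proof (intro equalityI subsetI)
      fix y assume y: "y \<in> Obj V"
      then have "f (f' y) = y" using inv'(2) V.Obj_subset by blast
      then show "y \<in> f ` Obj U" using ob'[OF y] by force
    qed (use ob in auto)
    show "src V (f g) = f (src U g)" "rng V (f g) = f (rng U g)" if "g \<in> Arr U" for g
      using that inv(5) funct(1,2) U.src_Obj U.rng_Obj by simp_all
    show "f (cmp U g h) = cmp V (f g) (f h)" if "composable U g h" for g h
      using that by (rule funct(3))
  qed
  then show ?thesis by (auto simp: isomorphic_groupoids_def)
qed

end

theorem groupoid_models_isomorphic:
  fixes D :: "('a, 'g) diagram_data" and U :: "'u top_groupoid" and V :: "'v top_groupoid"
    and i :: "'u \<Rightarrow> 'y" and j :: "'v \<Rightarrow> 'y"
  assumes i: "inj i" and j: "inj j"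
    and U: "groupoid_model TYPE('y) D U" and V: "groupoid_model TYPE('y) D V"
  shows "isomorphic_groupoids U V"
proof -
  obtain \<Phi> :: "'y topology \<Rightarrow> ('u, 'y) groupoid_action \<Rightarrow> _" where
    \<Phi>: "\<forall>Y. bij_betw (\<Phi> Y) {A. left_action U Y A} {B. is_diagram_action D Y B}"
    and \<Phi>e: "\<forall>Y Y' A A' f. left_action U Y A \<longrightarrow> left_action U Y' A' \<longrightarrow>
      continuous_map Y Y' f \<longrightarrow>
      (equivariant U Y A A' f \<longleftrightarrow> diagram_equivariant D (\<Phi> Y A) (\<Phi> Y' A') f)"
    using U unfolding groupoid_model_def by (elim conjE exE) blast
  obtain \<Psi> :: "'y topology \<Rightarrow> ('v, 'y) groupoid_action \<Rightarrow> _" where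
    \<Psi>: "\<forall>Y. bij_betw (\<Psi> Y) {A. left_action V Y A} {B. is_diagram_action D Y B}"
    and \<Psi>e: "\<forall>Y Y' A A' f. left_action V Y A \<longrightarrow> left_action V Y' A' \<longrightarrow>
      continuous_map Y Y' f \<longrightarrow>
      (equivariant V Y A A' f \<longleftrightarrow> diagram_equivariant D (\<Psi> Y A) (\<Psi> Y' A') f)"
    using V unfolding groupoid_model_def by (elim conjE exE) blast
  interpret U: etale_groupoid U using U by (simp add: groupoid_model_def)
  interpret V: etale_groupoid V using V by (simp add: groupoid_model_def)
  interpret action_correspondence U V i j
    "\<lambda>Y A B. left_action U Y A \<and> left_action V Y B \<and> \<Phi> Y A = \<Psi> Y B"
  proof unfold_locales
    fix Y :: "'y topology" and A assume A: "left_action U Y A"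
    then have "\<Phi> Y A \<in> \<Psi> Y ` {A. left_action V Y A}"
      using bij_betw_imp_surj_on[OF \<Phi>[rule_format, of Y]]
        bij_betw_imp_surj_on[OF \<Psi>[rule_format, of Y]] by blast
    with A show "\<exists>B. left_action U Y A \<and> left_action V Y B \<and> \<Phi> Y A = \<Psi> Y B" by auto
  next
    fix Y :: "'y topology" and B assume B: "left_action V Y B"
    then have "\<Psi> Y B \<in> \<Phi> Y ` {A. left_action U Y A}"
      using bij_betw_imp_surj_on[OF \<Phi>[rule_format, of Y]]
        bij_betw_imp_surj_on[OF \<Psi>[rule_format, of Y]] by blast
    with B show "\<exists>A. left_action U Y A \<and> left_action V Y B \<and> \<Phi> Y A = \<Psi> Y B" by force
  qed (use i j \<Phi>e \<Psi>e in auto)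
  show ?thesis by (rule corresponding_groupoids_isomorphic)
qed

section \<open>Actions of diagrams\<close>

lemma extended_data_simps [simp]:
  "Arr (extended_data D) = Base ` Arr D \<union> Cone ` Arr D \<union> {Apex}"
  "Obj (extended_data D) = Base ` Obj D \<union> {Apex}"
  "src (extended_data D) = ext_src D"
  "rng (extended_data D) = ext_rng D"
  "cmp (extended_data D) = ext_cmp D"
  "Grp (extended_data D) = ext_Grp D"
  "phi (extended_data D) = ext_phi D"
  "cocyc (extended_data D) = ext_cocyc D"
  by (simp_all add: extended_data_def)

lemma singleton_group_simps [simp]:
  "x \<otimes>\<^bsub>singleton_group a\<^esub> y = a" "\<one>\<^bsub>singleton_group a\<^esub> = a"
  by (simp_all add: singleton_group_def)

text \<open>An arrow to \<open>\<infinity>\<close> other than \<open>id\<^sub>\<infinity>\<close> has its source in the base, so it composes on the right only with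
  arrows of the base.\<close>

lemma composable_extended_data:
  "composable (extended_data D) k l \<longleftrightarrow>
     (\<exists>g h. composable D g h \<and> k = Base g \<and> l = Base h)
   \<or> (\<exists>g h. composable D g h \<and> k = Cone g \<and> l = Base h)
   \<or> (k = Apex \<and> l = Apex) \<or> (\<exists>h. h \<in> Arr D \<and> k = Apex \<and> l = Cone h)"
  by (cases k; cases l) (auto simp: composable_def)

context tight_diagram_data
begin

lemma cocyc_ident: "x \<in> Obj D \<Longrightarrow> cocyc D x x = \<one>\<^bsub>Grp D x\<^esub>" "x \<in> Obj D \<Longrightarrow> cmp D x x = x"
  using cocyc_ident_left[of x] cmp_ident_left[of x] Obj_subset by (auto simp: src_ident rng_ident)

lemma phi_closed: "g \<in> Arr D \<Longrightarrow> \<gamma> \<in> carrier (Grp D (rng D g)) \<Longrightarrow>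
    phi D g \<gamma> \<in> carrier (Grp D (src D g))"
  using phi_hom[of g] by (auto simp: hom_def)

lemma phi_one: "g \<in> Arr D \<Longrightarrow> phi D g \<one>\<^bsub>Grp D (rng D g)\<^esub> = \<one>\<^bsub>Grp D (src D g)\<^esub>"
  by (intro hom_one phi_hom group_Grp rng_Obj src_Obj)

lemma extended_category: "small_category (extended_data D)"
proof unfold_locales
  show "composable (extended_data D) k l \<Longrightarrow> cmp (extended_data D) k l \<in> Arr (extended_data D)" for k l
    by (auto simp: composable_extended_data cmp_Arr)
  show "composable (extended_data D) k l \<Longrightarrow>
    src (extended_data D) (cmp (extended_data D) k l) = src (extended_data D) l" for k l
    by (auto simp: composable_extended_data src_cmp)
  show "composable (extended_data D) k l \<Longrightarrow>
    rng (extended_data D) (cmp (extended_data D) k l) = rng (extended_data D) k" for k l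
    by (auto simp: composable_extended_data rng_cmp)
  show "composable (extended_data D) k l \<Longrightarrow> composable (extended_data D) l m \<Longrightarrow>
      cmp (extended_data D) (cmp (extended_data D) k l) m
      = cmp (extended_data D) k (cmp (extended_data D) l m)" for k l m
    by (auto simp: composable_extended_data cmp_assoc)
  show "Obj (extended_data D) \<subseteq> Arr (extended_data D)"
    using Obj_subset by auto
qed (auto simp: src_Obj rng_Obj src_ident rng_ident cmp_ident_left cmp_ident_right)

text \<open>The extended cocycle on a pair that starts with a cone arrow is the one of the underlying pair in
  the base, so the cocycle identities are inherited.  The pairs that involve \<open>id\<^sub>\<infinity>\<close> have trivial
  cocycle, and the maps \<open>\<phi>\<close> of cone arrows are trivial because the group at \<open>\<infinity>\<close> is.\<close>

lemma extended_tight: "tight_diagram_data (extended_data D)"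
proof -
  show ?thesis
  proof (intro tight_diagram_data.intro tight_diagram_data_axioms.intro extended_category)
    show "x \<in> Obj (extended_data D) \<Longrightarrow> Group.group (Grp (extended_data D) x)" for x
      by (auto simp: group_Grp)
    show "k \<in> Arr (extended_data D) \<Longrightarrow> phi (extended_data D) k
        \<in> hom (Grp (extended_data D) (rng (extended_data D) k))
            (Grp (extended_data D) (src (extended_data D) k))" for k
      by (auto simp: phi_hom hom_mult[OF phi_hom] phi_closed intro!: homI
          group.is_monoid[THEN monoid.one_closed] group_Grp src_Obj
          group.is_monoid[THEN monoid.r_one, symmetric])
    show "composable (extended_data D) k l \<Longrightarrow> cocyc (extended_data D) k l
        \<in> carrier (Grp (extended_data D) (src (extended_data D) l))" for k l
      by (auto simp: composable_extended_data cocyc_closed group_Grp src_Obj group.is_monoid)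
    show "cocyc (extended_data D) k l \<otimes>\<^bsub>Grp (extended_data D) (src (extended_data D) l)\<^esub>
          phi (extended_data D) l (phi (extended_data D) k \<gamma>)
          \<otimes>\<^bsub>Grp (extended_data D) (src (extended_data D) l)\<^esub>
          inv\<^bsub>Grp (extended_data D) (src (extended_data D) l)\<^esub> cocyc (extended_data D) k l
        = phi (extended_data D) (cmp (extended_data D) k l) \<gamma>"
      if kl: "composable (extended_data D) k l"
        and \<gamma>: "\<gamma> \<in> carrier (Grp (extended_data D) (rng (extended_data D) k))" for k l \<gamma>
    proof -
      from kl consider (bb) g h where "composable D g h" "k = Base g" "l = Base h"
        | (cb) g h where "composable D g h" "k = Cone g" "l = Base h"
        | (aa) "k = Apex" "l = Apex" | (ac) h where "h \<in> Arr D" "k = Apex" "l = Cone h"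
        unfolding composable_extended_data by blast
      then show ?thesis
      proof cases
        case bb
        then show ?thesis using \<gamma> by (simp add: phi_cmp)
      next
        case cb
        then have h: "h \<in> Arr D" "src D g = rng D h" by (auto simp: composable_def)
        interpret H: group "Grp D (src D h)" using h by (intro group_Grp src_Obj)
        show ?thesis
          using cb h phi_one[OF h(1)] cocyc_closed[OF cb(1)] src_cmp[OF cb(1)] by simp
      next
        case aa
        then show ?thesis using \<gamma> by simp
      next
        case ac
        interpret H: group "Grp D (src D h)" using ac by (intro group_Grp src_Obj)
        show ?thesis using ac by simp
      qed
    qed
    show "cocyc (extended_data D) (cmp (extended_data D) k l) m
          \<otimes>\<^bsub>Grp (extended_data D) (src (extended_data D) m)\<^esub>
          phi (extended_data D) m (cocyc (extended_data D) k l)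
        = cocyc (extended_data D) k (cmp (extended_data D) l m)
          \<otimes>\<^bsub>Grp (extended_data D) (src (extended_data D) m)\<^esub> cocyc (extended_data D) l m"
      if kl: "composable (extended_data D) k l" and lm: "composable (extended_data D) l m" for k l m
    proof -
      from kl lm consider (b) g h n where "composable D g h" "composable D h n"
          "k = Base g \<or> k = Cone g" "l = Base h" "m = Base n"
        | (aa) "k = Apex" "l = Apex" "m = Apex"
        | (aac) h where "h \<in> Arr D" "k = Apex" "l = Apex" "m = Cone h"
        | (acb) h n where "composable D h n" "k = Apex" "l = Cone h" "m = Base n"
        unfolding composable_extended_data by auto
      then show ?thesis
      proof cases
        case b
        then show ?thesis using cocyc_cmp by auto
      next
        case aa
        then show ?thesis by simp
      next
        case aac
        interpret H: group "Grp D (src D h)" using aac by (intro group_Grp src_Obj)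
        show ?thesis using aac by simp
      next
        case acb
        then have n: "n \<in> Arr D" "src D h = rng D n" by (auto simp: composable_def)
        interpret H: group "Grp D (src D n)" using n by (intro group_Grp src_Obj)
        show ?thesis
          using acb n phi_one[OF n(1)] cocyc_closed[OF acb(1)] src_cmp[OF acb(1)] by simp
      qed
    qed
    show "x \<in> Obj (extended_data D) \<Longrightarrow> \<gamma> \<in> carrier (Grp (extended_data D) x) \<Longrightarrow>
        phi (extended_data D) x \<gamma> = \<gamma>" for x \<gamma>
      by (auto simp: phi_ident)
    show "k \<in> Arr (extended_data D) \<Longrightarrow>
        cocyc (extended_data D) (rng (extended_data D) k) k
        = \<one>\<^bsub>Grp (extended_data D) (src (extended_data D) k)\<^esub>" for k
      by (auto simp: cocyc_ident_left)
    show "k \<in> Arr (extended_data D) \<Longrightarrow>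
        cocyc (extended_data D) k (src (extended_data D) k)
        = \<one>\<^bsub>Grp (extended_data D) (src (extended_data D) k)\<^esub>" for k
      by (auto simp: cocyc_ident_right)
  qed
qed

end

locale diagram_action = tight_diagram_data D for D :: "('a, 'g) diagram_data" +
  fixes Y :: "'y topology" and A :: "('a, 'g, 'y) diagram_action"
  assumes action: "is_diagram_action D Y A"
begin

lemma piece_cover: "(\<Union>x \<in> Obj D. piece A x) = topspace Y"
  and piece_openin: "x \<in> Obj D \<Longrightarrow> openin Y (piece A x)"
  and piece_empty: "x \<notin> Obj D \<Longrightarrow> piece A x = {}"
  and dact_undefined: "\<not> (g \<in> Arr D \<and> \<gamma> \<in> carrier (Grp D (src D g)) \<and> y \<in> piece A (src D g)) \<Longrightarrow>
    dact A g \<gamma> y = undefined"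
  using action unfolding is_diagram_action_def corr_set_def by (elim conjE; simp)+

lemma piece_disjoint:
  "x \<in> Obj D \<Longrightarrow> x' \<in> Obj D \<Longrightarrow> y \<in> piece A x \<Longrightarrow> y \<in> piece A x' \<Longrightarrow> x = x'"
  using action unfolding is_diagram_action_def disjoint_family_on_def by (elim conjE) blast

lemma piece_subset: "x \<in> Obj D \<Longrightarrow> piece A x \<subseteq> topspace Y"
  using piece_cover by blast

lemma dact_multiply:
  "composable D g h \<Longrightarrow> \<gamma>\<^sub>1 \<in> carrier (Grp D (src D g)) \<Longrightarrow> \<gamma>\<^sub>2 \<in> carrier (Grp D (src D h)) \<Longrightarrow>
    y \<in> piece A (src D h) \<Longrightarrow>
    dact A g \<gamma>\<^sub>1 (dact A h \<gamma>\<^sub>2 y) = dact A (cmp D g h) (corr_mult D g h \<gamma>\<^sub>1 \<gamma>\<^sub>2) y"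
  using action unfolding is_diagram_action_def corr_set_def by (elim conjE) simp

lemma dact_cancel:
  assumes "g \<in> Arr D" "\<gamma> \<in> carrier (Grp D (src D g))" "\<gamma>' \<in> carrier (Grp D (src D g))"
    "y \<in> piece A (src D g)" "y' \<in> piece A (src D g)" "dact A g \<gamma> y = dact A g \<gamma>' y'"
  obtains \<eta> where "\<eta> \<in> carrier (Grp D (src D g))"
    "\<gamma>' = \<gamma> \<otimes>\<^bsub>Grp D (src D g)\<^esub> \<eta>" "y = dact A (src D g) \<eta> y'"
proof -
  have "\<forall>g \<in> Arr D. \<forall>\<gamma> \<in> corr_set D g. \<forall>\<gamma>' \<in> corr_set D g.
        \<forall>y \<in> piece A (src D g). \<forall>y' \<in> piece A (src D g).
          dact A g \<gamma> y = dact A g \<gamma>' y' \<longrightarrow>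
          (\<exists>\<eta> \<in> carrier (Grp D (src D g)).
             \<gamma>' = corr_right D g \<gamma> \<eta> \<and> y = dact A (src D g) \<eta> y')"
    using action unfolding is_diagram_action_def by (elim conjE)
  then show thesis
    using assms that by (simp add: corr_set_def corr_right_def) blast
qed

lemma dact_map:
  assumes "g \<in> Arr D"
  defines "X \<equiv> prod_topology (discrete_topology (carrier (Grp D (src D g))))
        (subtopology Y (piece A (src D g)))"
  shows "continuous_map X (subtopology Y (piece A (rng D g))) (\<lambda>(\<gamma>, y). dact A g \<gamma> y)"
    and "open_map X (subtopology Y (piece A (rng D g))) (\<lambda>(\<gamma>, y). dact A g \<gamma> y)"
    and "(\<lambda>(\<gamma>, y). dact A g \<gamma> y) ` (carrier (Grp D (src D g)) \<times> piece A (src D g)) = piece A (rng D g)"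
proof -
  have *: "topspace Y \<inter> piece A (src D g) = piece A (src D g)"
    "topspace Y \<inter> piece A (rng D g) = piece A (rng D g)"
    using piece_subset src_Obj[OF assms(1)] rng_Obj[OF assms(1)] by blast+
  have "\<forall>g \<in> Arr D.
        let X = prod_topology (discrete_topology (corr_set D g))
                  (subtopology Y (piece A (src D g)));
            Z = subtopology Y (piece A (rng D g));
            m = (\<lambda>(\<gamma>, y). dact A g \<gamma> y)
        in continuous_map X Z m \<and> open_map X Z m \<and> m ` topspace X = topspace Z"
    using action unfolding is_diagram_action_def by (elim conjE)
  from bspec[OF this assms(1)]
  show "continuous_map X (subtopology Y (piece A (rng D g))) (\<lambda>(\<gamma>, y). dact A g \<gamma> y)"
    and "open_map X (subtopology Y (piece A (rng D g))) (\<lambda>(\<gamma>, y). dact A g \<gamma> y)"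
    and "(\<lambda>(\<gamma>, y). dact A g \<gamma> y) ` (carrier (Grp D (src D g)) \<times> piece A (src D g)) = piece A (rng D g)"
    by (simp_all add: X_def Let_def corr_set_def *)
qed

lemma dact_closed:
  "g \<in> Arr D \<Longrightarrow> \<gamma> \<in> carrier (Grp D (src D g)) \<Longrightarrow> y \<in> piece A (src D g) \<Longrightarrow>
    dact A g \<gamma> y \<in> piece A (rng D g)"
  using dact_map(3)[of g] by force

lemma dact_surj:
  assumes "g \<in> Arr D" "z \<in> piece A (rng D g)"
  obtains \<gamma> y where "\<gamma> \<in> carrier (Grp D (src D g))" "y \<in> piece A (src D g)" "z = dact A g \<gamma> y"
  using assms(2) unfolding dact_map(3)[OF assms(1), symmetric] by auto

lemma dact_group:
  assumes x: "x \<in> Obj D" and "\<gamma>\<^sub>1 \<in> carrier (Grp D x)" "\<gamma>\<^sub>2 \<in> carrier (Grp D x)" "y \<in> piece A x"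
  shows "dact A x \<gamma>\<^sub>1 (dact A x \<gamma>\<^sub>2 y) = dact A x (\<gamma>\<^sub>1 \<otimes>\<^bsub>Grp D x\<^esub> \<gamma>\<^sub>2) y"
proof -
  interpret X: group "Grp D x" using x by (rule group_Grp)
  have "composable D x x" using x Obj_subset by (auto simp: composable_def src_ident rng_ident)
  from dact_multiply[OF this, of \<gamma>\<^sub>1 \<gamma>\<^sub>2 y] show ?thesis
    using assms by (simp add: src_ident cocyc_ident corr_mult_def phi_ident)
qed

text \<open>The unit acts idempotently, and every point of the piece is of the form \<open>\<gamma> \<cdot> y'\<close>; absorbing the unit
  into \<open>\<gamma>\<close> shows that it fixes this point.\<close>

lemma dact_one:
  assumes x: "x \<in> Obj D" and y: "y \<in> piece A x"
  shows "dact A x \<one>\<^bsub>Grp D x\<^esub> y = y"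
proof -
  interpret X: group "Grp D x" using x by (rule group_Grp)
  have "x \<in> Arr D" using x Obj_subset by blast
  then obtain \<gamma> y' where "\<gamma> \<in> carrier (Grp D x)" "y' \<in> piece A x" "y = dact A x \<gamma> y'"
    using dact_surj[of x y] x y by (auto simp: src_ident rng_ident)
  then show ?thesis using dact_group[OF x] by simp
qed

lemma dact_split:
  assumes g: "g \<in> Arr D" and \<gamma>: "\<gamma> \<in> carrier (Grp D (src D g))" "\<gamma>' \<in> carrier (Grp D (src D g))"
    and y: "y \<in> piece A (src D g)"
  shows "dact A g \<gamma> (dact A (src D g) \<gamma>' y) = dact A g (\<gamma> \<otimes>\<^bsub>Grp D (src D g)\<^esub> \<gamma>') y"
proof -
  have x: "src D g \<in> Obj D" using g by (rule src_Obj)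
  interpret X: group "Grp D (src D g)" using x by (rule group_Grp)
  have "composable D g (src D g)" using g x Obj_subset by (auto simp: composable_def rng_ident)
  from dact_multiply[OF this, of \<gamma> \<gamma>' y] show ?thesis
    using assms x by (simp add: src_ident cocyc_ident_right corr_mult_def phi_ident cmp_ident_right)
qed

lemma dact_left:
  assumes g: "g \<in> Arr D" and \<gamma>: "\<gamma> \<in> carrier (Grp D (rng D g))" "\<gamma>' \<in> carrier (Grp D (src D g))"
    and y: "y \<in> piece A (src D g)"
  shows "dact A (rng D g) \<gamma> (dact A g \<gamma>' y) = dact A g (phi D g \<gamma> \<otimes>\<^bsub>Grp D (src D g)\<^esub> \<gamma>') y"
proof -
  have x: "src D g \<in> Obj D" "rng D g \<in> Obj D" using g by (auto intro: src_Obj rng_Obj)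
  interpret X: group "Grp D (src D g)" using x(1) by (rule group_Grp)
  have "composable D (rng D g) g" using g x Obj_subset by (auto simp: composable_def src_ident)
  from dact_multiply[OF this, of \<gamma> \<gamma>' y] show ?thesis
    using assms x phi_closed[OF g \<gamma>(1)]
    by (simp add: src_ident cocyc_ident_left corr_mult_def cmp_ident_left)
qed

text \<open>Onto: \<open>\<gamma>' \<cdot> y = \<gamma> \<cdot> (\<gamma>\<inverse>\<gamma>' \<cdot> y)\<close>.  Injective: in \<open>\<gamma> \<cdot> y = \<gamma> \<cdot> y'\<close> the element \<open>\<eta>\<close> provided by the
  cancellation condition satisfies \<open>\<gamma> = \<gamma>\<eta>\<close>, so it is the unit.\<close>

lemma dact_homeomorphic:
  assumes g: "g \<in> Arr D" and \<gamma>: "\<gamma> \<in> carrier (Grp D (src D g))"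
  shows "homeomorphic_map (subtopology Y (piece A (src D g))) (subtopology Y (piece A (rng D g)))
    (dact A g \<gamma>)"
proof (rule bijective_open_imp_homeomorphic_map)
  let ?S = "subtopology Y (piece A (src D g))" and ?R = "subtopology Y (piece A (rng D g))"
  let ?G = "Grp D (src D g)"
  have x: "src D g \<in> Obj D" "rng D g \<in> Obj D" using g by (auto intro: src_Obj rng_Obj)
  interpret X: group ?G using x(1) by (rule group_Grp)
  have top: "topspace ?S = piece A (src D g)" "topspace ?R = piece A (rng D g)"
    using piece_subset x by auto
  have "continuous_map ?S (prod_topology (discrete_topology (carrier ?G)) ?S) (\<lambda>y. (\<gamma>, y))"
    using \<gamma> by (simp add: continuous_map_pairedI)
  from continuous_map_compose[OF this dact_map(1)[OF g]]
  show "continuous_map ?S ?R (dact A g \<gamma>)" by (simp add: o_def)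
  show "open_map ?S ?R (dact A g \<gamma>)"
    unfolding open_map_def
  proof (intro allI impI)
    fix V assume "openin ?S V"
    then have "openin (prod_topology (discrete_topology (carrier ?G)) ?S) ({\<gamma>} \<times> V)"
      using \<gamma> by (simp add: openin_prod_Times_iff)
    then have "openin ?R ((\<lambda>(\<gamma>, y). dact A g \<gamma> y) ` ({\<gamma>} \<times> V))"
      using dact_map(2)[OF g] unfolding open_map_def by blast
    moreover have "(\<lambda>(\<gamma>, y). dact A g \<gamma> y) ` ({\<gamma>} \<times> V) = dact A g \<gamma> ` V" by force
    ultimately show "openin ?R (dact A g \<gamma> ` V)" by simp
  qed
  show "dact A g \<gamma> ` topspace ?S = topspace ?R"
    unfolding top
  proof (intro equalityI subsetI)
    fix z assume "z \<in> piece A (rng D g)"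
    then obtain \<gamma>' y where y: "\<gamma>' \<in> carrier ?G" "y \<in> piece A (src D g)" "z = dact A g \<gamma>' y"
      by (rule dact_surj[OF g])
    let ?\<eta> = "inv\<^bsub>?G\<^esub> \<gamma> \<otimes>\<^bsub>?G\<^esub> \<gamma>'"
    have "src D g \<in> Arr D" using x Obj_subset by blast
    then have "dact A (src D g) ?\<eta> y \<in> piece A (src D g)"
      using dact_closed[of "src D g" ?\<eta> y] x y \<gamma> by (simp add: src_ident rng_ident)
    moreover have "\<gamma> \<otimes>\<^bsub>?G\<^esub> ?\<eta> = \<gamma>'"
      using y(1) \<gamma> by (simp add: X.m_assoc[symmetric])
    then have "dact A g \<gamma> (dact A (src D g) ?\<eta> y) = z"
      using dact_split[OF g \<gamma> _ y(2), of ?\<eta>] y(1,3) \<gamma> by simp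
    ultimately show "z \<in> dact A g \<gamma> ` piece A (src D g)" by blast
  qed (use dact_closed[OF g \<gamma>] in auto)
  show "inj_on (dact A g \<gamma>) (topspace ?S)"
  proof (rule inj_onI)
    fix y y' assume "y \<in> topspace ?S" "y' \<in> topspace ?S" and eq: "dact A g \<gamma> y = dact A g \<gamma> y'"
    then have y: "y \<in> piece A (src D g)" "y' \<in> piece A (src D g)" by (simp_all only: top)
    obtain \<eta> where "\<eta> \<in> carrier ?G" "\<gamma> = \<gamma> \<otimes>\<^bsub>?G\<^esub> \<eta>" "y = dact A (src D g) \<eta> y'"
      using g \<gamma> \<gamma> y eq by (rule dact_cancel)
    then show "y = y'" using \<gamma> dact_one[OF x(1) y(2)] by simp
  qed
qed

end

section \<open>Products of a group with a pair groupoid\<close>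

text \<open>Over a discrete factor a map is continuous, or open, as soon as its slices are.  This reduces
  statements about actions of discrete groupoids and of the discrete sets \<open>\<X>\<^sub>g\<close> to single arrows.\<close>

lemma continuous_map_from_discrete_product:
  assumes W: "W \<subseteq> S \<times> topspace Y"
    and f: "\<And>s. s \<in> S \<Longrightarrow> continuous_map (subtopology Y {y. (s, y) \<in> W}) Z (\<lambda>y. f (s, y))"
  shows "continuous_map (subtopology (prod_topology (discrete_topology S) Y) W) Z f"
  unfolding continuous_map_openin_preimage_eq
proof (intro conjI allI impI)
  have top: "topspace (subtopology (prod_topology (discrete_topology S) Y) W) = W"
    using W by auto
  show "f \<in> topspace (subtopology (prod_topology (discrete_topology S) Y) W) \<rightarrow> topspace Z"
    unfolding top
  proof (rule funcsetI)
    fix w assume w: "w \<in> W"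
    then have s: "fst w \<in> S" "snd w \<in> topspace (subtopology Y {y. (fst w, y) \<in> W})" using W by auto
    from continuous_map_image_subset_topspace[OF f[OF s(1)]] s(2) show "f w \<in> topspace Z"
      by (cases w) (auto simp: image_subset_iff)
  qed
  fix U assume U: "openin Z U"
  have "\<forall>s\<in>S. \<exists>V. openin Y V \<and>
      {y \<in> topspace Y. (s, y) \<in> W \<and> f (s, y) \<in> U} = V \<inter> {y. (s, y) \<in> W}"
  proof
    fix s assume "s \<in> S"
    from openin_continuous_map_preimage[OF f[OF this] U]
    show "\<exists>V. openin Y V \<and>
        {y \<in> topspace Y. (s, y) \<in> W \<and> f (s, y) \<in> U} = V \<inter> {y. (s, y) \<in> W}"
      unfolding openin_subtopology by (simp add: conj_assoc)
  qed
  from bchoice[OF this] obtain V where "\<forall>s\<in>S. openin Y (V s) \<and>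
      {y \<in> topspace Y. (s, y) \<in> W \<and> f (s, y) \<in> U} = V s \<inter> {y. (s, y) \<in> W}" ..
  then have V: "\<And>s. s \<in> S \<Longrightarrow> openin Y (V s)"
    "\<And>s. s \<in> S \<Longrightarrow> {y \<in> topspace Y. (s, y) \<in> W \<and> f (s, y) \<in> U} = V s \<inter> {y. (s, y) \<in> W}"
    by auto
  have "openin (prod_topology (discrete_topology S) Y) (\<Union>s\<in>S. {s} \<times> V s)"
    using V(1) by (intro openin_Union) (auto simp: openin_prod_Times_iff)
  moreover have "W \<inter> f -` U = (\<Union>s\<in>S. {s} \<times> V s) \<inter> W"
  proof (intro equalityI subsetI)
    fix w assume w: "w \<in> W \<inter> f -` U"
    then have "snd w \<in> {y \<in> topspace Y. (fst w, y) \<in> W \<and> f (fst w, y) \<in> U}" "fst w \<in> S"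
      using W by auto
    then show "w \<in> (\<Union>s\<in>S. {s} \<times> V s) \<inter> W"
      using V(2)[of "fst w"] w by (cases w) auto
  next
    fix w assume w: "w \<in> (\<Union>s\<in>S. {s} \<times> V s) \<inter> W"
    then have "snd w \<in> V (fst w) \<inter> {y. (fst w, y) \<in> W}" "fst w \<in> S" by auto
    then show "w \<in> W \<inter> f -` U"
      using V(2)[of "fst w"] w by (cases w) auto
  qed
  ultimately show "openin (subtopology (prod_topology (discrete_topology S) Y) W)
      (topspace (subtopology (prod_topology (discrete_topology S) Y) W) \<inter> f -` U)"
    unfolding top openin_subtopology by blast
qed

lemma open_map_from_discrete_product:
  assumes f: "\<And>s. s \<in> S \<Longrightarrow> open_map Y Z (\<lambda>y. f (s, y))"
  shows "open_map (prod_topology (discrete_topology S) Y) Z f"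
  unfolding open_map_def
proof (intro allI impI)
  fix O' assume O: "openin (prod_topology (discrete_topology S) Y) O'"
  then have sub: "O' \<subseteq> S \<times> topspace Y" using openin_subset by fastforce
  have "openin Z ((\<lambda>y. f (s, y)) ` {y \<in> topspace Y. (s, y) \<in> O'})" if s: "s \<in> S" for s
  proof -
    have "continuous_map Y (prod_topology (discrete_topology S) Y) (\<lambda>y. (s, y))"
      using s by (simp add: continuous_map_pairedI)
    from openin_continuous_map_preimage[OF this O] show ?thesis
      using f[OF s] unfolding open_map_def by blast
  qed
  then have "openin Z (\<Union>s\<in>S. (\<lambda>y. f (s, y)) ` {y \<in> topspace Y. (s, y) \<in> O'})" by blast
  moreover have "f ` O' = (\<Union>s\<in>S. (\<lambda>y. f (s, y)) ` {y \<in> topspace Y. (s, y) \<in> O'})"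
    using sub by (auto simp: image_iff)
  ultimately show "openin Z (f ` O')" by simp
qed

lemma (in topological_groupoid) act_homeomorphic:
  assumes A: "left_action G Y A" and g: "g \<in> Arr G"
  shows "homeomorphic_maps (subtopology Y {y. anchor A y = src G g})
    (subtopology Y {y. anchor A y = rng G g}) (act A g) (act A (ginv G g))"
proof -
  have cont: "continuous_map (subtopology Y {y. anchor A y = src G g})
    (subtopology Y {y. anchor A y = rng G g}) (act A g)" if g: "g \<in> Arr G" for g
  proof -
    have dom: "(g, y) \<in> act_dom G Y A" if "y \<in> topspace Y" "anchor A y = src G g" for y
      using that g by (simp add: act_dom_def)
    have "continuous_map (subtopology Y {y. anchor A y = src G g}) (prod_topology (topo G) Y)
        (\<lambda>y. (g, y))"
      using g by (simp add: continuous_map_pairedI topspace_topo continuous_map_from_subtopology)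
    then have "continuous_map (subtopology Y {y. anchor A y = src G g})
        (subtopology (prod_topology (topo G) Y) (act_dom G Y A)) (\<lambda>y. (g, y))"
      unfolding continuous_map_in_subtopology using dom by auto
    from continuous_map_compose[OF this left_actionD(6)[OF A]]
    show ?thesis
      unfolding continuous_map_in_subtopology using left_actionD(2)[OF A dom] by (auto simp: o_def)
  qed
  have inverse: "act A (ginv G g) (act A g y) = y"
    if "g \<in> Arr G" "y \<in> topspace Y" "anchor A y = src G g" for g y
  proof -
    have "composable G (ginv G g) g" using that(1) by (simp add: composable_def ginv_Arr src_ginv)
    then have "act A (ginv G g) (act A g y) = act A (cmp G (ginv G g) g) y"
      using left_actionD(3)[OF A] that by (simp add: act_dom_def)
    then show ?thesis using left_actionD(4)[OF A that(2)] that by (simp add: cmp_ginv_left)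
  qed
  have invol: "ginv G (ginv G g) = g"
  proof -
    have c: "composable G (ginv G (ginv G g)) (ginv G g)" "composable G (ginv G g) g"
      using g by (simp_all add: composable_def ginv_Arr src_ginv)
    have "ginv G (ginv G g) = cmp G (ginv G (ginv G g)) (cmp G (ginv G g) g)"
      using g cmp_ident_right[of "ginv G (ginv G g)"]
      by (simp add: ginv_Arr src_ginv rng_ginv cmp_ginv_left)
    also have "\<dots> = g"
      using cmp_assoc[OF c] g cmp_ident_left[OF g] by (simp add: cmp_ginv_left ginv_Arr src_ginv)
    finally show ?thesis .
  qed
  show ?thesis
    unfolding homeomorphic_maps_def
    using cont[OF g] cont[OF ginv_Arr[OF g]] inverse[OF g] inverse[OF ginv_Arr[OF g]] g
    by (simp add: src_ginv rng_ginv invol)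
qed

lemma etale_groupoid_discrete:
  assumes "small_category G"
    and inv: "\<And>g. g \<in> Arr G \<Longrightarrow> ginv G g \<in> Arr G \<and> src G (ginv G g) = rng G g \<and>
      rng G (ginv G g) = src G g \<and> cmp G g (ginv G g) = rng G g \<and> cmp G (ginv G g) g = src G g"
    and topo: "topo G = discrete_topology (Arr G)"
  shows "etale_groupoid G"
proof -
  interpret small_category G by fact
  have obj: "obj_topo G = discrete_topology (Obj G)"
    using Obj_subset by (simp add: obj_topo_def topo Int_absorb1)
  have loc: "local_homeomorphism (topo G) (obj_topo G) f" if "f \<in> Arr G \<rightarrow> Obj G" for f
    unfolding local_homeomorphism_def topo obj
  proof (intro ballI exI conjI)
    fix x assume "x \<in> topspace (discrete_topology (Arr G))"
    then have x: "x \<in> Arr G" "f x \<in> Obj G" using that by auto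
    then show "openin (discrete_topology (Arr G)) {x}" "x \<in> {x}"
      "openin (discrete_topology (Obj G)) (f ` {x})"
      "homeomorphic_map (subtopology (discrete_topology (Arr G)) {x})
         (subtopology (discrete_topology (Obj G)) (f ` {x})) f"
      by (auto simp: homeomorphic_map_maps homeomorphic_maps_def intro!: exI[of _ "\<lambda>_. x"])
  qed
  show ?thesis
  proof unfold_locales
    show "continuous_map (subtopology (prod_topology (topo G) (topo G)) {(g, h). composable G g h})
        (topo G) (\<lambda>(g, h). cmp G g h)"
      by (auto simp: topo prod_topology_discrete_topology[symmetric] intro: cmp_Arr)
  qed (use inv src_Obj rng_Obj in \<open>auto simp: topo obj intro!: loc[unfolded topo obj]\<close>)
qed

abbreviation group_times_pair :: "'k monoid \<Rightarrow> 'x set \<Rightarrow> ('k \<times> 'x \<times> 'x) top_groupoid" where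
  "group_times_pair K X \<equiv> prod_groupoid (group_groupoid K) (pair_groupoid X)"

lemma group_times_pair_simps [simp]:
  "Arr (group_times_pair K X) = carrier K \<times> X \<times> X"
  "Obj (group_times_pair K X) = (\<lambda>x. (\<one>\<^bsub>K\<^esub>, x, x)) ` X"
  "src (group_times_pair K X) (p, x, y) = (\<one>\<^bsub>K\<^esub>, y, y)"
  "rng (group_times_pair K X) (p, x, y) = (\<one>\<^bsub>K\<^esub>, x, x)"
  "cmp (group_times_pair K X) (p, x, y) (q, y', z) = (p \<otimes>\<^bsub>K\<^esub> q, x, z)"
  "ginv (group_times_pair K X) (p, x, y) = (inv\<^bsub>K\<^esub> p, y, x)"
  "topo (group_times_pair K X) = discrete_topology (carrier K \<times> X \<times> X)"
  by (auto simp: prod_groupoid_def group_groupoid_def pair_groupoid_def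
      prod_topology_discrete_topology)

lemma composable_group_times_pair [simp]:
  "composable (group_times_pair K X) (p, x, y) (q, y', z) \<longleftrightarrow>
     p \<in> carrier K \<and> q \<in> carrier K \<and> x \<in> X \<and> y \<in> X \<and> z \<in> X \<and> y' = y"
  by (auto simp: composable_def)

lemma etale_group_times_pair:
  assumes "group K"
  shows "etale_groupoid (group_times_pair K X)"
proof -
  interpret group K by fact
  have "small_category (group_times_pair K X)"
    by unfold_locales (auto simp: m_assoc)
  then show ?thesis
    by (rule etale_groupoid_discrete) auto
qed

text \<open>A space cut into clopen pieces, each with a chart \<open>\<beta> x\<close> onto a fixed space \<open>Z\<close> on which the group \<open>K\<close>
  acts through \<open>h\<close>; \<open>b x\<close> is the inverse chart.  The arrow \<open>(k, x, x')\<close> then acts from the piece at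
  \<open>x'\<close> to the piece at \<open>x\<close> by \<open>k\<close> read in the charts.\<close>

locale trivialized_space = group K for K :: "'k monoid" (structure) +
  fixes X :: "'x set" and Y :: "'y topology" and Z :: "'z topology"
    and piece :: "'x \<Rightarrow> 'y set" and \<beta> :: "'x \<Rightarrow> 'y \<Rightarrow> 'z" and b :: "'x \<Rightarrow> 'z \<Rightarrow> 'y"
    and h :: "'k \<Rightarrow> 'z \<Rightarrow> 'z"
  assumes open_piece: "x \<in> X \<Longrightarrow> openin Y (piece x)"
    and cover: "(\<Union>x\<in>X. piece x) = topspace Y"
    and disjoint: "x \<in> X \<Longrightarrow> x' \<in> X \<Longrightarrow> y \<in> piece x \<Longrightarrow> y \<in> piece x' \<Longrightarrow> x = x'"
    and trivialization: "x \<in> X \<Longrightarrow> homeomorphic_maps (subtopology Y (piece x)) Z (\<beta> x) (b x)"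
    and continuous_h: "k \<in> carrier K \<Longrightarrow> continuous_map Z Z (h k)"
    and h_mult: "k \<in> carrier K \<Longrightarrow> l \<in> carrier K \<Longrightarrow> z \<in> topspace Z \<Longrightarrow> h (k \<otimes> l) z = h k (h l z)"
    and h_one: "z \<in> topspace Z \<Longrightarrow> h \<one> z = z"
begin

definition label :: "'y \<Rightarrow> 'x" where
  "label y = (THE x. x \<in> X \<and> y \<in> piece x)"

definition trivialized_action :: "('k \<times> 'x \<times> 'x, 'y) groupoid_action" where
  "trivialized_action =
     \<lparr>anchor = restrict (\<lambda>y. (\<one>, label y, label y)) (topspace Y),
      act = (\<lambda>(k, x, x') y. if k \<in> carrier K \<and> x \<in> X \<and> x' \<in> X \<and> y \<in> piece x'
                            then b x (h k (\<beta> x' y)) else undefined)\<rparr>"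

lemma label_eq: "x \<in> X \<Longrightarrow> y \<in> piece x \<Longrightarrow> label y = x"
  unfolding label_def using disjoint by blast

lemma piece_topspace: "x \<in> X \<Longrightarrow> y \<in> piece x \<Longrightarrow> y \<in> topspace Y"
  using cover by blast

lemma label_in: "y \<in> topspace Y \<Longrightarrow> label y \<in> X \<and> y \<in> piece (label y)"
  using cover label_eq by blast

lemma topspace_piece: "x \<in> X \<Longrightarrow> topspace (subtopology Y (piece x)) = piece x"
  using piece_topspace by auto

lemma chart:
  assumes "x \<in> X"
  shows "y \<in> piece x \<Longrightarrow> \<beta> x y \<in> topspace Z" "z \<in> topspace Z \<Longrightarrow> b x z \<in> piece x"
    "y \<in> piece x \<Longrightarrow> b x (\<beta> x y) = y" "z \<in> topspace Z \<Longrightarrow> \<beta> x (b x z) = z"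
    "continuous_map (subtopology Y (piece x)) Z (\<beta> x)" "continuous_map Z (subtopology Y (piece x)) (b x)"
proof -
  note * = trivialization[OF assms, unfolded homeomorphic_maps_def topspace_piece[OF assms]]
  show c: "continuous_map (subtopology Y (piece x)) Z (\<beta> x)"
    and d: "continuous_map Z (subtopology Y (piece x)) (b x)"
    using * by auto
  show "y \<in> piece x \<Longrightarrow> \<beta> x y \<in> topspace Z" "z \<in> topspace Z \<Longrightarrow> b x z \<in> piece x"
    using continuous_map_image_subset_topspace[OF c] continuous_map_image_subset_topspace[OF d]
    unfolding topspace_piece[OF assms] by auto
  show "y \<in> piece x \<Longrightarrow> b x (\<beta> x y) = y" "z \<in> topspace Z \<Longrightarrow> \<beta> x (b x z) = z"
    using * by auto
qed

lemma h_closed: "k \<in> carrier K \<Longrightarrow> z \<in> topspace Z \<Longrightarrow> h k z \<in> topspace Z"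
  using continuous_map_image_subset_topspace[OF continuous_h] by blast

lemma anchor_trivialized:
  "x \<in> X \<Longrightarrow> y \<in> piece x \<Longrightarrow> anchor trivialized_action y = (\<one>, x, x)"
  by (simp add: trivialized_action_def piece_topspace label_eq)

lemma act_trivialized:
  "k \<in> carrier K \<Longrightarrow> x \<in> X \<Longrightarrow> x' \<in> X \<Longrightarrow> y \<in> piece x' \<Longrightarrow>
    act trivialized_action (k, x, x') y = b x (h k (\<beta> x' y))"
  by (simp add: trivialized_action_def)

lemma anchor_trivialized_iff:
  assumes x: "x \<in> X" and y: "y \<in> topspace Y"
  shows "anchor trivialized_action y = (\<one>, x, x) \<longleftrightarrow> y \<in> piece x"
  using x y label_in[of y] anchor_trivialized[of "label y" y] anchor_trivialized[of x y] by auto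

lemma act_dom_trivialized:
  "act_dom (group_times_pair K X) Y trivialized_action
     = {((k, x, x'), y) | k x x' y. k \<in> carrier K \<and> x \<in> X \<and> x' \<in> X \<and> y \<in> piece x'}"
  using anchor_trivialized_iff by (auto simp: act_dom_def piece_topspace) (metis piece_topspace)+

lemma left_action_trivialized:
  "left_action (group_times_pair K X) Y trivialized_action" (is "left_action ?P Y ?A")
  unfolding left_action_def
proof (intro conjI allI impI ballI)
  show "anchor ?A \<in> extensional (topspace Y)" by (simp add: trivialized_action_def)
  show "act ?A g y = undefined" if "(g, y) \<notin> act_dom ?P Y ?A" for g y
    using that unfolding act_dom_trivialized
    by (cases g) (auto simp: trivialized_action_def)
  have obj: "obj_topo ?P = discrete_topology (Obj ?P)"
    by (auto simp: obj_topo_def intro!: arg_cong[of _ _ discrete_topology])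
  show "continuous_map Y (obj_topo ?P) (anchor ?A)"
    unfolding continuous_map_openin_preimage_eq obj
  proof (intro conjI allI impI)
    show "anchor ?A \<in> topspace Y \<rightarrow> topspace (discrete_topology (Obj ?P))"
      using label_in by (auto simp: trivialized_action_def)
    fix U
    have "topspace Y \<inter> anchor ?A -` U = (\<Union>x\<in>{x\<in>X. (\<one>, x, x) \<in> U}. piece x)"
    proof (intro equalityI subsetI)
      fix y assume y: "y \<in> topspace Y \<inter> anchor ?A -` U"
      with label_in[of y] show "y \<in> (\<Union>x\<in>{x\<in>X. (\<one>, x, x) \<in> U}. piece x)"
        using anchor_trivialized[of "label y" y] by auto
    qed (auto simp: piece_topspace anchor_trivialized)
    moreover have "openin Y (\<Union>x\<in>{x\<in>X. (\<one>, x, x) \<in> U}. piece x)"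
      using open_piece by blast
    ultimately show "openin Y (topspace Y \<inter> anchor ?A -` U)" by simp
  qed
  show "continuous_map (subtopology (prod_topology (topo ?P) Y) (act_dom ?P Y ?A)) Y
      (\<lambda>(g, y). act ?A g y)"
    unfolding group_times_pair_simps
  proof (rule continuous_map_from_discrete_product)
    show "act_dom ?P Y ?A \<subseteq> (carrier K \<times> X \<times> X) \<times> topspace Y"
      unfolding act_dom_trivialized using piece_topspace by auto
    fix g assume "g \<in> carrier K \<times> X \<times> X"
    then obtain k x x' where g: "g = (k, x, x')" "k \<in> carrier K" "x \<in> X" "x' \<in> X" by auto
    have dom: "{y. (g, y) \<in> act_dom ?P Y ?A} = piece x'"
      using g by (auto simp: act_dom_trivialized)
    have "continuous_map (subtopology Y (piece x')) Y (b x \<circ> (h k \<circ> \<beta> x'))"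
      using chart(5)[OF g(4)] continuous_h[OF g(2)] chart(6)[OF g(3)]
      by (intro continuous_map_compose) (auto simp: continuous_map_in_subtopology)
    then show "continuous_map (subtopology Y {y. (g, y) \<in> act_dom ?P Y ?A}) Y
        (\<lambda>y. case (g, y) of (g, y) \<Rightarrow> act ?A g y)"
      unfolding dom
      by (rule continuous_map_eq) (use g in \<open>auto simp: act_trivialized\<close>)
  qed
  show "case w of (g, y) \<Rightarrow> anchor ?A (act ?A g y) = rng ?P g" if "w \<in> act_dom ?P Y ?A" for w
    using that
    by (auto simp: act_dom_trivialized act_trivialized chart h_closed anchor_trivialized)
  show "act ?A (cmp ?P g g') y = act ?A g (act ?A g' y)"
    if "composable ?P g g'" "(g', y) \<in> act_dom ?P Y ?A" for g g' y
    using that by (cases g; cases g')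
      (auto simp: act_dom_trivialized act_trivialized chart h_closed h_mult)
  show "act ?A (anchor ?A y) y = y" if "y \<in> topspace Y" for y
    using label_in[OF that]
    by (simp add: anchor_trivialized[of "label y"] act_trivialized chart h_one)
qed

end

section \<open>Morita equivalence\<close>

lemma embedding_map_discrete:
  assumes "inj_on f S" "f ` S \<subseteq> R"
  shows "embedding_map (discrete_topology S) (discrete_topology R) f"
  by (rule injective_open_imp_embedding_map) (use assms in \<open>auto simp: open_map_def\<close>)

text \<open>Between discrete spaces principality is the algebraic statement: the action is free, and \<open>p\<close> is
  onto with the orbits as its fibres.\<close>

lemma principal_over_discrete:
  assumes topo: "topo G = discrete_topology (Arr G)"
    and p: "p ` S = R"
    and orbits: "\<And>x x'. x \<in> S \<Longrightarrow> x' \<in> S \<Longrightarrow>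
      p x = p x' \<longleftrightarrow> (\<exists>g. (g, x) \<in> act_dom G (discrete_topology S) A \<and> x' = act A g x)"
    and free: "\<And>g g' x. (g, x) \<in> act_dom G (discrete_topology S) A \<Longrightarrow>
      (g', x) \<in> act_dom G (discrete_topology S) A \<Longrightarrow> act A g x = act A g' x \<Longrightarrow> g = g'"
    and closed: "\<And>g x. (g, x) \<in> act_dom G (discrete_topology S) A \<Longrightarrow> act A g x \<in> S"
  shows "principal_over G (discrete_topology S) A p (discrete_topology R)"
  unfolding principal_over_def
proof (intro conjI)
  show "quotient_map (discrete_topology S) (discrete_topology R) p"
    using p by (auto simp: quotient_map_def)
  show "open_map (discrete_topology S) (discrete_topology R) p"
    using p by (auto simp: open_map_def)
  let ?D = "act_dom G (discrete_topology S) A"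
  have D: "?D \<subseteq> Arr G \<times> S" by (auto simp: act_dom_def)
  have "embedding_map (discrete_topology ?D) (discrete_topology (S \<times> S)) (\<lambda>(g, x). (act A g x, x))"
    by (rule embedding_map_discrete) (use free closed D in \<open>fastforce simp: inj_on_def\<close>)+
  moreover have "(Arr G \<times> S) \<inter> ?D = ?D" using D by blast
  ultimately show "embedding_map (subtopology (prod_topology (topo G) (discrete_topology S)) ?D)
      (prod_topology (discrete_topology S) (discrete_topology S)) (\<lambda>(g, x). (act A g x, x))"
    by (simp add: topo prod_topology_discrete_topology[symmetric])
qed (use orbits in simp)

lemma left_action_discrete:
  assumes topo: "topo G = discrete_topology (Arr G)" and "Obj G \<subseteq> Arr G"
    and ext: "anchor A \<in> extensional S"
    and undef: "\<And>g y. (g, y) \<notin> act_dom G (discrete_topology S) A \<Longrightarrow> act A g y = undefined"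
    and anchor: "\<And>y. y \<in> S \<Longrightarrow> anchor A y \<in> Obj G"
    and act: "\<And>g y. g \<in> Arr G \<Longrightarrow> y \<in> S \<Longrightarrow> src G g = anchor A y \<Longrightarrow>
      act A g y \<in> S \<and> anchor A (act A g y) = rng G g"
    and cmp: "\<And>g h y. composable G g h \<Longrightarrow> y \<in> S \<Longrightarrow> src G h = anchor A y \<Longrightarrow>
      act A (cmp G g h) y = act A g (act A h y)"
    and unit: "\<And>y. y \<in> S \<Longrightarrow> act A (anchor A y) y = y"
  shows "left_action G (discrete_topology S) A"
proof -
  have "(Arr G \<times> S) \<inter> act_dom G (discrete_topology S) A = act_dom G (discrete_topology S) A"
    by (auto simp: act_dom_def)
  then have sub: "subtopology (prod_topology (topo G) (discrete_topology S))
      (act_dom G (discrete_topology S) A) = discrete_topology (act_dom G (discrete_topology S) A)"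
    by (simp add: topo prod_topology_discrete_topology[symmetric])
  have obj: "obj_topo G = discrete_topology (Obj G)"
    using assms(2) by (simp add: obj_topo_def topo Int_absorb1)
  show ?thesis
    unfolding left_action_def sub obj
    using ext undef anchor act cmp unit by (auto simp: act_dom_def)
qed

text \<open>A transitive groupoid is equivalent to its isotropy group via the arrows with a fixed source.
  Under the isomorphism \<open>f\<close> such an arrow is determined by its range and its component in \<open>K\<close>, so the
  equivalence is \<open>Obj U \<times> K\<close>, where \<open>U\<close> acts through the \<open>K\<close>-component \<open>\<pi>\<close> of \<open>f\<close> from the left and \<open>K\<close>
  acts by multiplication from the right.\<close>

theorem morita_equivalent_group_times_pair:
  assumes U: "topological_groupoid U" and K: "group K" and X: "X \<noteq> {}"
    and iso: "groupoid_iso U (group_times_pair K X) f"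
  shows "morita_equivalent U (group_groupoid K)"
proof -
  interpret U: topological_groupoid U by (fact U)
  interpret K: group K by (fact K)
  let ?P = "group_times_pair K X" and ?H = "group_groupoid K"
  have bij: "bij_betw f (Arr U) (carrier K \<times> X \<times> X)"
    and ob: "f ` Obj U = (\<lambda>x. (\<one>\<^bsub>K\<^esub>, x, x)) ` X"
    and sr: "\<And>g. g \<in> Arr U \<Longrightarrow> src ?P (f g) = f (src U g) \<and> rng ?P (f g) = f (rng U g)"
    and cmp: "\<And>g h. composable U g h \<Longrightarrow> f (cmp U g h) = cmp ?P (f g) (f h)"
    and homeo: "homeomorphic_map (topo U) (discrete_topology (carrier K \<times> X \<times> X)) f"
    using iso unfolding groupoid_iso_def group_times_pair_simps by blast+
  note inj_f = inj_onD[OF bij_betw_imp_inj_on[OF bij]] and img = bij_betw_imp_surj_on[OF bij]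
  have topo: "topo U = discrete_topology (Arr U)"
  proof -
    have "openin (topo U) {u}" if u: "u \<in> Arr U" for u
    proof -
      have "f u \<in> carrier K \<times> X \<times> X" using u img by blast
      then have "openin (discrete_topology (carrier K \<times> X \<times> X)) {f u}" by simp
      from openin_continuous_map_preimage[OF homeomorphic_imp_continuous_map[OF homeo] this]
      have "openin (topo U) {v \<in> topspace (topo U). f v \<in> {f u}}" .
      moreover have "{v \<in> topspace (topo U). f v \<in> {f u}} = {u}"
        using u inj_f[of _ u] by (auto simp: U.topspace_topo)
      ultimately show ?thesis by simp
    qed
    then show ?thesis by (metis discrete_topology_unique U.topspace_topo)
  qed
  define \<pi> where "\<pi> u = fst (f u)" for u
  define l where "l x = fst (snd (f x))" for x
  have f_unit: "f x = (\<one>\<^bsub>K\<^esub>, l x, l x)" "l x \<in> X" if "x \<in> Obj U" for x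
  proof -
    have "f x \<in> (\<lambda>x. (\<one>\<^bsub>K\<^esub>, x, x)) ` X" using ob that by blast
    then show "f x = (\<one>\<^bsub>K\<^esub>, l x, l x)" "l x \<in> X" by (auto simp: l_def)
  qed
  have f_arr: "f u = (\<pi> u, l (rng U u), l (src U u))" "\<pi> u \<in> carrier K" if u: "u \<in> Arr U" for u
  proof -
    have "f u \<in> carrier K \<times> X \<times> X" using img u by blast
    then obtain p x y where pxy: "f u = (p, x, y)" "p \<in> carrier K" by auto
    then show "f u = (\<pi> u, l (rng U u), l (src U u))" "\<pi> u \<in> carrier K"
      using sr[OF u] f_unit(1)[OF U.src_Obj[OF u]] f_unit(1)[OF U.rng_Obj[OF u]]
      by (auto simp: \<pi>_def)
  qed
  have inj: "u = v" if "u \<in> Arr U" "v \<in> Arr U" "src U u = src U v" "rng U u = rng U v" "\<pi> u = \<pi> v" for u v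
    using that f_arr(1)[of u] f_arr(1)[of v] by (intro inj_f) simp_all
  have \<pi>_cmp: "\<pi> (cmp U g h) = \<pi> g \<otimes>\<^bsub>K\<^esub> \<pi> h" if gh: "composable U g h" for g h
    using cmp[OF gh] f_arr(1)[of g] f_arr(1)[of h] gh
    by (simp add: \<pi>_def[of "cmp U g h"] composable_def)
  have \<pi>_unit: "\<pi> x = \<one>\<^bsub>K\<^esub>" if "x \<in> Obj U" for x
    using f_unit[OF that] by (simp add: \<pi>_def)
  (* Transitivity with full isotropy: units and a group element can be prescribed freely. *)
  have fill: "\<exists>u\<in>Arr U. src U u = x \<and> rng U u = y \<and> \<pi> u = p"
    if x: "x \<in> Obj U" and y: "y \<in> Obj U" and p: "p \<in> carrier K" for x y p
  proof -
    have "(p, l y, l x) \<in> f ` Arr U" using f_unit(2)[OF x] f_unit(2)[OF y] p by (simp add: img)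
    then obtain u where u: "u \<in> Arr U" "f u = (p, l y, l x)" by auto
    have "l (src U u) = l x" "l (rng U u) = l y" "\<pi> u = p" using f_arr(1)[OF u(1)] u(2) by auto
    then have "f (src U u) = f x" "f (rng U u) = f y"
      using f_unit U.src_Obj[OF u(1)] U.rng_Obj[OF u(1)] x y by simp_all
    then have "src U u = x" "rng U u = y"
      using U.src_Obj[OF u(1)] U.rng_Obj[OF u(1)] x y U.Obj_subset by (blast intro: inj_f)+
    then show ?thesis using u \<open>\<pi> u = p\<close> by blast
  qed
  define S where "S = Obj U \<times> carrier K"
  have S_iff: "(x, p) \<in> S \<longleftrightarrow> x \<in> Obj U \<and> p \<in> carrier K" for x p
    by (simp add: S_def)
  define A where "A = \<lparr>anchor = restrict fst S, act = (\<lambda>u (x, p).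
      if u \<in> Arr U \<and> (x, p) \<in> S \<and> src U u = x then (rng U u, \<pi> u \<otimes>\<^bsub>K\<^esub> p) else undefined)\<rparr>"
  define B where "B = \<lparr>anchor = restrict (\<lambda>_. \<one>\<^bsub>K\<^esub>) S, act = (\<lambda>k (x, p).
      if k \<in> carrier K \<and> (x, p) \<in> S then (x, p \<otimes>\<^bsub>K\<^esub> k) else undefined)\<rparr>"
  have A_simps: "anchor A (x, p) = x" "u \<in> Arr U \<Longrightarrow> src U u = x \<Longrightarrow> act A u (x, p) = (rng U u, \<pi> u \<otimes>\<^bsub>K\<^esub> p)"
    if "x \<in> Obj U" "p \<in> carrier K" for x p u
    using that by (simp_all add: A_def S_def)
  have B_simps: "anchor B (x, p) = \<one>\<^bsub>K\<^esub>" "k \<in> carrier K \<Longrightarrow> act B k (x, p) = (x, p \<otimes>\<^bsub>K\<^esub> k)"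
    if "x \<in> Obj U" "p \<in> carrier K" for x p k
    using that by (simp_all add: B_def S_def)
  have H: "Arr (opposite ?H) = carrier K" "Obj (opposite ?H) = {\<one>\<^bsub>K\<^esub>}" "src (opposite ?H) k = \<one>\<^bsub>K\<^esub>"
    "rng (opposite ?H) k = \<one>\<^bsub>K\<^esub>" "cmp (opposite ?H) g k = k \<otimes>\<^bsub>K\<^esub> g"
    "topo (opposite ?H) = discrete_topology (carrier K)" for g k
    by (simp_all add: opposite_def group_groupoid_def)
  have domA: "act_dom U (discrete_topology S) A
      = {(u, (x, p)) | u x p. u \<in> Arr U \<and> x = src U u \<and> p \<in> carrier K}"
    using A_simps(1) U.src_Obj by (auto simp: act_dom_def S_def)
  have domB: "act_dom (opposite ?H) (discrete_topology S) B = carrier K \<times> S"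
    using B_simps(1) by (auto simp: act_dom_def S_def H)
  have obj: "obj_topo ?H = discrete_topology {\<one>\<^bsub>K\<^esub>}" "obj_topo U = discrete_topology (Obj U)"
    using U.Obj_subset by (auto simp: obj_topo_def group_groupoid_def topo Int_absorb1)
  have actA: "left_action U (discrete_topology S) A"
  proof (rule left_action_discrete[OF topo U.Obj_subset])
    show "act A u y = undefined" if "(u, y) \<notin> act_dom U (discrete_topology S) A" for u y
      using that unfolding domA by (cases y) (auto simp: A_def S_def)
    show "act A (cmp U g h) y = act A g (act A h y)"
      if gh: "composable U g h" and y: "y \<in> S" "src U h = anchor A y" for g h y
    proof -
      obtain x p where y': "y = (x, p)" "x \<in> Obj U" "p \<in> carrier K" using y by (auto simp: S_def)
      then have "src U h = x" "h \<in> Arr U" "g \<in> Arr U" "src U g = rng U h"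
        using y gh A_simps(1) by (auto simp: composable_def)
      then show ?thesis
        using gh y' by (simp add: A_simps U.cmp_Arr U.src_cmp U.rng_cmp U.rng_Obj \<pi>_cmp f_arr(2)
            K.m_assoc)
    qed
    show "act A (anchor A y) y = y" if "y \<in> S" for y
    proof -
      obtain x p where y: "y = (x, p)" "x \<in> Obj U" "p \<in> carrier K" using \<open>y \<in> S\<close> by (auto simp: S_def)
      moreover have "x \<in> Arr U" using y U.Obj_subset by blast
      ultimately show ?thesis by (simp add: A_simps U.src_ident U.rng_ident \<pi>_unit)
    qed
  qed (auto simp: S_def A_def U.rng_Obj f_arr(2))
  have actB: "left_action (opposite ?H) (discrete_topology S) B"
  proof (rule left_action_discrete)
    show "act B k y = undefined" if "(k, y) \<notin> act_dom (opposite ?H) (discrete_topology S) B" for k y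
      using that unfolding domB by (cases y) (auto simp: B_def)
    show "act B (cmp (opposite ?H) g h) y = act B g (act B h y)"
      if gh: "composable (opposite ?H) g h" and y: "y \<in> S" for g h y
    proof -
      obtain x p where "y = (x, p)" "x \<in> Obj U" "p \<in> carrier K" using y by (auto simp: S_def)
      moreover have "g \<in> carrier K" "h \<in> carrier K" using gh by (simp_all add: composable_def H)
      ultimately show ?thesis by (simp add: H B_simps K.m_assoc)
    qed
    show "act B k y \<in> S \<and> anchor B (act B k y) = rng (opposite ?H) k"
      if "k \<in> Arr (opposite ?H)" "y \<in> S" for k y
      using that by (cases y) (simp add: H B_simps S_def)
    show "act B (anchor B y) y = y" if "y \<in> S" for y
      using that by (cases y) (simp add: B_simps S_def)
  qed (simp_all add: H B_def)
  have prA: "principal_over U (discrete_topology S) A (anchor B) (obj_topo ?H)"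
    unfolding obj
  proof (rule principal_over_discrete[OF topo])
    obtain x where "x \<in> Obj U" using X ob by blast
    then have "(x, \<one>\<^bsub>K\<^esub>) \<in> S" by (simp add: S_def)
    moreover have "anchor B y = \<one>\<^bsub>K\<^esub>" if "y \<in> S" for y using that by (simp add: B_def)
    ultimately show "anchor B ` S = {\<one>\<^bsub>K\<^esub>}" by force
    fix y y' assume "y \<in> S" "y' \<in> S"
    then obtain x p x' p' where y: "y = (x, p)" "x \<in> Obj U" "p \<in> carrier K"
      "y' = (x', p')" "x' \<in> Obj U" "p' \<in> carrier K" by (auto simp: S_def)
    obtain u where "u \<in> Arr U" "src U u = x" "rng U u = x'" "\<pi> u = p' \<otimes>\<^bsub>K\<^esub> inv\<^bsub>K\<^esub> p"
      using fill[OF y(2,5), of "p' \<otimes>\<^bsub>K\<^esub> inv\<^bsub>K\<^esub> p"] y by auto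
    then have "(u, y) \<in> act_dom U (discrete_topology S) A \<and> y' = act A u y"
      using y by (simp add: domA A_simps K.m_assoc)
    moreover have "anchor B y = anchor B y'" using y by (simp add: B_simps)
    ultimately show "anchor B y = anchor B y' \<longleftrightarrow>
        (\<exists>u. (u, y) \<in> act_dom U (discrete_topology S) A \<and> y' = act A u y)"
      by blast
  next
    show "u = v" if uv: "(u, y) \<in> act_dom U (discrete_topology S) A"
      "(v, y) \<in> act_dom U (discrete_topology S) A" "act A u y = act A v y" for u v y
    proof -
      obtain x p where y: "y = (x, p)" by (cases y)
      then have uv': "u \<in> Arr U" "v \<in> Arr U" "src U u = x" "src U v = x" "p \<in> carrier K"
        using uv(1,2) unfolding domA by simp_all
      then have "x \<in> Obj U" using U.src_Obj by blast
      then have "rng U u = rng U v" "\<pi> u \<otimes>\<^bsub>K\<^esub> p = \<pi> v \<otimes>\<^bsub>K\<^esub> p"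
        using uv(3) uv' by (simp_all add: y A_simps)
      then show ?thesis using uv' inj[of u v] by (simp add: f_arr(2))
    qed
  qed (use U.act_closed[OF actA] in simp)
  have prB: "principal_over (opposite ?H) (discrete_topology S) B (anchor A) (obj_topo U)"
    unfolding obj
  proof (rule principal_over_discrete)
    have "anchor A y = fst y" if "y \<in> S" for y using that by (simp add: A_def)
    then have "anchor A ` S = fst ` S" by (rule image_cong[OF HOL.refl])
    then show "anchor A ` S = Obj U" by (auto simp: S_def)
    fix y y' assume "y \<in> S" "y' \<in> S"
    then obtain x p x' p' where y: "y = (x, p)" "x \<in> Obj U" "p \<in> carrier K"
      "y' = (x', p')" "x' \<in> Obj U" "p' \<in> carrier K" by (auto simp: S_def)
    show "anchor A y = anchor A y' \<longleftrightarrow>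
        (\<exists>k. (k, y) \<in> act_dom (opposite ?H) (discrete_topology S) B \<and> y' = act B k y)"
    proof
      assume "anchor A y = anchor A y'"
      then have "(inv\<^bsub>K\<^esub> p \<otimes>\<^bsub>K\<^esub> p', y) \<in> act_dom (opposite ?H) (discrete_topology S) B
          \<and> y' = act B (inv\<^bsub>K\<^esub> p \<otimes>\<^bsub>K\<^esub> p') y"
        using y by (simp add: A_simps B_simps domB S_iff K.m_assoc[symmetric])
      then show "\<exists>k. (k, y) \<in> act_dom (opposite ?H) (discrete_topology S) B \<and> y' = act B k y" ..
    qed (use y in \<open>auto simp: A_simps B_simps domB\<close>)
  next
    show "k = k'" if "(k, y) \<in> act_dom (opposite ?H) (discrete_topology S) B"
      "(k', y) \<in> act_dom (opposite ?H) (discrete_topology S) B" "act B k y = act B k' y" for k k' y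
      using that by (cases y) (simp add: domB B_simps S_iff)
    show "act B k y \<in> S" if "(k, y) \<in> act_dom (opposite ?H) (discrete_topology S) B" for k y
      using that by (cases y) (simp add: domB B_simps S_iff)
  qed (simp add: H)
  show ?thesis
    unfolding morita_equivalent_def
    by (intro exI[of _ "discrete_topology S"] exI[of _ A] exI[of _ B] conjI actA actB prA prB)
      (auto simp: domA domB S_iff A_simps B_simps U.src_Obj U.rng_Obj f_arr(2) K.m_assoc)
qed

section \<open>The group of self-homeomorphisms of a space\<close>

text \<open>Self-homeomorphisms are taken as functions that are \<open>undefined\<close> outside the space, so that equality
  in the group is equality on the space.\<close>

definition homeo_group :: "'z topology \<Rightarrow> ('z \<Rightarrow> 'z) monoid" where
  "homeo_group Z =
     (BijGroup (topspace Z))\<lparr>carrier := {f \<in> Bij (topspace Z). homeomorphic_map Z Z f}\<rparr>"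

lemma carrier_homeo_group:
  "f \<in> carrier (homeo_group Z) \<longleftrightarrow> f \<in> extensional (topspace Z) \<and> homeomorphic_map Z Z f"
  using homeomorphic_imp_injective_map[of Z Z f] homeomorphic_imp_surjective_map[of Z Z f]
  by (auto simp: homeo_group_def Bij_def bij_betw_def)

lemma mult_homeo_group:
  assumes "f \<in> carrier (homeo_group Z)" "g \<in> carrier (homeo_group Z)"
  shows "f \<otimes>\<^bsub>homeo_group Z\<^esub> g = compose (topspace Z) f g"
  using assms by (simp add: homeo_group_def BijGroup_def)

lemma one_homeo_group: "\<one>\<^bsub>homeo_group Z\<^esub> = (\<lambda>z\<in>topspace Z. z)"
  by (simp add: homeo_group_def BijGroup_def)

lemma group_homeo_group: "group (homeo_group Z)"
proof -
  interpret B: group "BijGroup (topspace Z)" by (rule group_BijGroup)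
  let ?H = "{f \<in> Bij (topspace Z). homeomorphic_map Z Z f}"
  have "subgroup ?H (BijGroup (topspace Z))"
  proof (rule B.subgroupI)
    show "?H \<subseteq> carrier (BijGroup (topspace Z))" by (auto simp: BijGroup_def)
    have "homeomorphic_map Z Z (\<lambda>z\<in>topspace Z. z)"
      by (rule homeomorphic_map_eq[OF homeomorphic_map_id[THEN iffD2]]) auto
    then show "?H \<noteq> {}" using id_Bij by blast
    show "inv\<^bsub>BijGroup (topspace Z)\<^esub> f \<in> ?H" if "f \<in> ?H" for f
    proof -
      from that obtain g where g: "homeomorphic_maps Z Z f g" by (auto simp: homeomorphic_map_maps)
      have inj: "inj_on f (topspace Z)" using that by (auto simp: Bij_def bij_betw_def)
      have "homeomorphic_map Z Z g"
        using g homeomorphic_maps_map by blast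
      moreover have "g z = (\<lambda>x\<in>topspace Z. inv_into (topspace Z) f x) z" if z: "z \<in> topspace Z" for z
      proof -
        have "g z \<in> topspace Z" "f (g z) = z"
          using g z continuous_map_image_subset_topspace[of Z Z g] by (auto simp: homeomorphic_maps_def)
        then show ?thesis using inv_into_f_f[OF inj, of "g z"] z by simp
      qed
      ultimately have "homeomorphic_map Z Z (\<lambda>x\<in>topspace Z. inv_into (topspace Z) f x)"
        by (rule homeomorphic_map_eq)
      then show ?thesis using that restrict_inv_into_Bij[of f "topspace Z"] by (auto simp: inv_BijGroup)
    qed
    show "f \<otimes>\<^bsub>BijGroup (topspace Z)\<^esub> g \<in> ?H" if "f \<in> ?H" "g \<in> ?H" for f g
    proof -
      have "homeomorphic_map Z Z (compose (topspace Z) f g)"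
        by (rule homeomorphic_map_eq[of _ _ "f \<circ> g"])
          (use that in \<open>auto intro: homeomorphic_map_compose simp: compose_def\<close>)
      then show ?thesis using that compose_Bij[of f "topspace Z" g] by (auto simp: BijGroup_def)
    qed
  qed
  then show ?thesis unfolding homeo_group_def by (rule B.subgroup_imp_group)
qed

section \<open>The arrows that an element of a correspondence induces\<close>

context tight_diagram_data
begin

definition pi1_class :: "('a, 'g) pi1_gen word \<Rightarrow> ('a, 'g) pi1_gen word set" where
  "pi1_class = word_class (pi1_gens D) (pi1_rels D)"

fun arrow_class :: "'a ext_arrow \<Rightarrow> ('a, 'g) pi1_gen word set" where
  "arrow_class (Base g) = pi1_class (arrow_word g)"
| "arrow_class (Cone g) = pi1_class (arrow_word g)"
| "arrow_class Apex = \<one>\<^bsub>fundamental_group D\<^esub>"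

fun elt_class :: "'a ext_arrow \<Rightarrow> 'g \<Rightarrow> ('a, 'g) pi1_gen word set" where
  "elt_class (Base x) \<gamma> = pi1_class (elt_word x \<gamma>)"
| "elt_class _ \<gamma> = \<one>\<^bsub>fundamental_group D\<^esub>"

abbreviation "\<Pi>\<^sub>1 \<equiv> fundamental_group D"
abbreviation "E \<equiv> extended_data D"

lemma group_fundamental_group: "group \<Pi>\<^sub>1"
  unfolding fundamental_group_def by (rule group_presented_group)

sublocale Pi1: group \<Pi>\<^sub>1
  by (rule group_fundamental_group)

lemma pi1_gensI: "g \<in> Arr D \<Longrightarrow> Arrow g \<in> pi1_gens D"
  "x \<in> Obj D \<Longrightarrow> \<gamma> \<in> carrier (Grp D x) \<Longrightarrow> Elt x \<gamma> \<in> pi1_gens D"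
  by (auto simp: pi1_gens_def)

lemma arrow_class_closed: "k \<in> Arr E \<Longrightarrow> arrow_class k \<in> carrier \<Pi>\<^sub>1"
  by (cases k) (auto simp: pi1_class_def fundamental_group_def pi1_gensI
      intro: monoid.one_closed[OF group.is_monoid[OF group_presented_group]])

lemma elt_class_closed:
  "x \<in> Obj E \<Longrightarrow> \<gamma> \<in> carrier (Grp E x) \<Longrightarrow> elt_class x \<gamma> \<in> carrier \<Pi>\<^sub>1"
  by (cases x) (auto simp: pi1_class_def fundamental_group_def pi1_gensI
      intro: monoid.one_closed[OF group.is_monoid[OF group_presented_group]])

lemma pi1_class_mult:
  "v \<in> words (pi1_gens D) \<Longrightarrow> w \<in> words (pi1_gens D) \<Longrightarrow>
    pi1_class v \<otimes>\<^bsub>\<Pi>\<^sub>1\<^esub> pi1_class w = pi1_class (v @ w)"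
  by (simp add: pi1_class_def fundamental_group_def word_class_mult)

lemma pi1_class_relation:
  "(v, w) \<in> pi1_rels D \<Longrightarrow> v \<in> words (pi1_gens D) \<Longrightarrow> w \<in> words (pi1_gens D) \<Longrightarrow>
    pi1_class v = pi1_class w"
  by (simp add: pi1_class_def word_class_relation)

lemma elt_class_mult:
  assumes x: "x \<in> Obj E" and \<gamma>: "\<gamma>\<^sub>1 \<in> carrier (Grp E x)" "\<gamma>\<^sub>2 \<in> carrier (Grp E x)"
  shows "elt_class x \<gamma>\<^sub>1 \<otimes>\<^bsub>\<Pi>\<^sub>1\<^esub> elt_class x \<gamma>\<^sub>2 = elt_class x (\<gamma>\<^sub>1 \<otimes>\<^bsub>Grp E x\<^esub> \<gamma>\<^sub>2)"
proof (cases x)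
  case (Base y)
  then have y: "y \<in> Obj D" "\<gamma>\<^sub>1 \<in> carrier (Grp D y)" "\<gamma>\<^sub>2 \<in> carrier (Grp D y)" using x \<gamma> by auto
  then have c: "\<gamma>\<^sub>1 \<otimes>\<^bsub>Grp D y\<^esub> \<gamma>\<^sub>2 \<in> carrier (Grp D y)"
    by (simp add: group.is_monoid group_Grp monoid.m_closed)
  have "(elt_word y \<gamma>\<^sub>1 @ elt_word y \<gamma>\<^sub>2, elt_word y (\<gamma>\<^sub>1 \<otimes>\<^bsub>Grp D y\<^esub> \<gamma>\<^sub>2)) \<in> pi1_rels D"
    using y unfolding pi1_rels_def by blast
  from pi1_class_relation[OF this] show ?thesis
    using Base y c by (simp add: pi1_class_mult pi1_gensI)
qed (use x in auto)

lemma arrow_class_unit: "x \<in> Obj E \<Longrightarrow> arrow_class x = \<one>\<^bsub>\<Pi>\<^sub>1\<^esub>"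
proof (cases x)
  case (Base y)
  assume "x \<in> Obj E"
  then have "(arrow_word y, []) \<in> pi1_rels D" "y \<in> Arr D"
    using Base Obj_subset unfolding pi1_rels_def by auto
  then show ?thesis
    using Base pi1_class_relation[of "arrow_word y" "[]"]
    by (simp add: pi1_gensI) (simp add: pi1_class_def fundamental_group_def one_presented_group)
qed auto

text \<open>In a group only the unit is idempotent.\<close>

lemma elt_class_one:
  assumes "x \<in> Obj E"
  shows "elt_class x \<one>\<^bsub>Grp E x\<^esub> = \<one>\<^bsub>\<Pi>\<^sub>1\<^esub>"
proof -
  interpret E: tight_diagram_data E by (rule extended_tight)
  interpret X: group "Grp E x" using assms by (rule E.group_Grp)
  have "elt_class x \<one>\<^bsub>Grp E x\<^esub> \<otimes>\<^bsub>\<Pi>\<^sub>1\<^esub> elt_class x \<one>\<^bsub>Grp E x\<^esub> = elt_class x \<one>\<^bsub>Grp E x\<^esub>"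
    using elt_class_mult[OF assms X.one_closed X.one_closed] by (simp del: extended_data_simps)
  then show ?thesis
    using elt_class_closed[OF assms X.one_closed] by (metis Pi1.r_cancel_one)
qed

text \<open>For arrows of the base this is the second family of relations, up to its orientation.  For a cone
  arrow both group elements are units.\<close>

lemma arrow_class_slide:
  assumes k: "k \<in> Arr E" and \<gamma>: "\<gamma> \<in> carrier (Grp E (rng E k))"
  shows "elt_class (rng E k) \<gamma> \<otimes>\<^bsub>\<Pi>\<^sub>1\<^esub> arrow_class k
    = arrow_class k \<otimes>\<^bsub>\<Pi>\<^sub>1\<^esub> elt_class (src E k) (phi E k \<gamma>)"
proof (cases k)
  case (Base g)
  then have g: "g \<in> Arr D" "\<gamma> \<in> carrier (Grp D (rng D g))" using k \<gamma> by auto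
  have "(arrow_word g @ elt_word (src D g) (phi D g \<gamma>), elt_word (rng D g) \<gamma> @ arrow_word g)
      \<in> pi1_rels D"
    using g unfolding pi1_rels_def by blast
  from pi1_class_relation[OF this] show ?thesis
    using Base g by (simp add: pi1_class_mult pi1_gensI src_Obj rng_Obj phi_closed)
next
  case (Cone g)
  then have "Base (src D g) \<in> Obj E" "k \<in> Arr E" using k by (auto simp: src_Obj)
  then show ?thesis
    using Cone elt_class_one[of "Base (src D g)"] arrow_class_closed[of k] by simp
qed auto

lemma arrow_class_cmp:
  assumes kl: "composable E k l"
  shows "arrow_class k \<otimes>\<^bsub>\<Pi>\<^sub>1\<^esub> arrow_class l
    = arrow_class (cmp E k l) \<otimes>\<^bsub>\<Pi>\<^sub>1\<^esub> elt_class (src E l) (cocyc E k l)"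
proof -
  consider (base) g h where "composable D g h" "k = Base g \<or> k = Cone g" "l = Base h"
    | (apex) "k = Apex" "l = Apex" | (cone) h where "h \<in> Arr D" "k = Apex" "l = Cone h"
    using kl unfolding composable_extended_data by blast
  then show ?thesis
  proof cases
    case base
    then have gh: "g \<in> Arr D" "h \<in> Arr D" "src D h \<in> Obj D"
      by (auto simp: composable_def src_Obj)
    have "(arrow_word g @ arrow_word h, arrow_word (cmp D g h) @ elt_word (src D h) (cocyc D g h))
        \<in> pi1_rels D"
      using base unfolding pi1_rels_def by blast
    from pi1_class_relation[OF this] show ?thesis
      using base gh cmp_Arr[OF base(1)] cocyc_closed[OF base(1)]
      by (auto simp: pi1_class_mult pi1_gensI)
  next
    case apex
    then show ?thesis by simp
  next
    case cone
    then have "Base (src D h) \<in> Obj E" "l \<in> Arr E" by (auto simp: src_Obj)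
    then show ?thesis
      using cone elt_class_one[of "Base (src D h)"] arrow_class_closed[of l] by simp
  qed
qed

abbreviation "\<P> \<equiv> group_times_pair \<Pi>\<^sub>1 (Obj E)"

text \<open>The arrow by which \<open>\<gamma> \<in> \<X>\<^sub>k\<close> acts in any action of the extended diagram.  It is the product of the
  class of \<open>k\<close> with that of \<open>\<gamma>\<close> because \<open>\<gamma> \<cdot> y\<close> arises by first moving \<open>y\<close> within its piece by \<open>\<gamma>\<close> and then
  along \<open>k\<close> by the unit of \<open>\<X>\<^sub>k\<close>.\<close>

definition kappa :: "'a ext_arrow \<Rightarrow> 'g \<Rightarrow> ('a, 'g) pi1_gen word set \<times> 'a ext_arrow \<times> 'a ext_arrow"
  where "kappa k \<gamma> = (arrow_class k \<otimes>\<^bsub>\<Pi>\<^sub>1\<^esub> elt_class (src E k) \<gamma>, rng E k, src E k)"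

lemma kappa_Arr:
  assumes "k \<in> Arr E" "\<gamma> \<in> carrier (Grp E (src E k))"
  shows "kappa k \<gamma> \<in> Arr \<P>" "src \<P> (kappa k \<gamma>) = (\<one>\<^bsub>\<Pi>\<^sub>1\<^esub>, src E k, src E k)"
    "rng \<P> (kappa k \<gamma>) = (\<one>\<^bsub>\<Pi>\<^sub>1\<^esub>, rng E k, rng E k)"
proof -
  interpret E: tight_diagram_data E by (rule extended_tight)
  show "kappa k \<gamma> \<in> Arr \<P>" "src \<P> (kappa k \<gamma>) = (\<one>\<^bsub>\<Pi>\<^sub>1\<^esub>, src E k, src E k)"
    "rng \<P> (kappa k \<gamma>) = (\<one>\<^bsub>\<Pi>\<^sub>1\<^esub>, rng E k, rng E k)"
    unfolding kappa_def group_times_pair_simps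
    using arrow_class_closed[OF assms(1)] elt_class_closed[OF E.src_Obj[OF assms(1)] assms(2)]
      E.src_Obj[OF assms(1)] E.rng_Obj[OF assms(1)]
    by blast+
qed

text \<open>The multiplication maps of the diagram become composition of arrows: \<open>[k] \<gamma>\<^sub>1 [l] \<gamma>\<^sub>2\<close> equals
  \<open>[k] [l] \<phi>\<^sub>l(\<gamma>\<^sub>1) \<gamma>\<^sub>2\<close> by sliding, and then \<open>[kl] u\<^bsub>k,l\<^esub> \<phi>\<^sub>l(\<gamma>\<^sub>1) \<gamma>\<^sub>2\<close> by the composition relation.\<close>

lemma kappa_mult:
  assumes kl: "composable E k l" and \<gamma>: "\<gamma>\<^sub>1 \<in> carrier (Grp E (src E k))"
    and \<gamma>': "\<gamma>\<^sub>2 \<in> carrier (Grp E (src E l))"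
  shows "cmp \<P> (kappa k \<gamma>\<^sub>1) (kappa l \<gamma>\<^sub>2) = kappa (cmp E k l) (corr_mult E k l \<gamma>\<^sub>1 \<gamma>\<^sub>2)"
proof -
  interpret E: tight_diagram_data E by (rule extended_tight)
  have k: "k \<in> Arr E" and l: "l \<in> Arr E" and s: "src E k = rng E l"
    using kl unfolding composable_def by blast+
  note \<gamma>1 = \<gamma>[unfolded s]
  note x = E.src_Obj[OF l] and phi = E.phi_closed[OF l \<gamma>1] and u = E.cocyc_closed[OF kl]
  interpret X: group "Grp E (src E l)" using x by (rule E.group_Grp)
  note closed = arrow_class_closed[OF k] arrow_class_closed[OF l]
    arrow_class_closed[OF E.cmp_Arr[OF kl]] elt_class_closed[OF x u] elt_class_closed[OF x phi]
    elt_class_closed[OF x \<gamma>'] elt_class_closed[OF E.rng_Obj[OF l] \<gamma>1]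
  have "(arrow_class k \<otimes>\<^bsub>\<Pi>\<^sub>1\<^esub> elt_class (rng E l) \<gamma>\<^sub>1) \<otimes>\<^bsub>\<Pi>\<^sub>1\<^esub> (arrow_class l \<otimes>\<^bsub>\<Pi>\<^sub>1\<^esub> elt_class (src E l) \<gamma>\<^sub>2)
      = arrow_class k \<otimes>\<^bsub>\<Pi>\<^sub>1\<^esub> (elt_class (rng E l) \<gamma>\<^sub>1 \<otimes>\<^bsub>\<Pi>\<^sub>1\<^esub> arrow_class l) \<otimes>\<^bsub>\<Pi>\<^sub>1\<^esub> elt_class (src E l) \<gamma>\<^sub>2"
    using closed by (simp only: Pi1.m_assoc Pi1.m_closed)
  also have "\<dots> = (arrow_class k \<otimes>\<^bsub>\<Pi>\<^sub>1\<^esub> arrow_class l) \<otimes>\<^bsub>\<Pi>\<^sub>1\<^esub> elt_class (src E l) (phi E l \<gamma>\<^sub>1)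
      \<otimes>\<^bsub>\<Pi>\<^sub>1\<^esub> elt_class (src E l) \<gamma>\<^sub>2"
    unfolding arrow_class_slide[OF l \<gamma>1] using closed by (simp only: Pi1.m_assoc Pi1.m_closed)
  also have "\<dots> = arrow_class (cmp E k l) \<otimes>\<^bsub>\<Pi>\<^sub>1\<^esub> (elt_class (src E l) (cocyc E k l)
      \<otimes>\<^bsub>\<Pi>\<^sub>1\<^esub> elt_class (src E l) (phi E l \<gamma>\<^sub>1) \<otimes>\<^bsub>\<Pi>\<^sub>1\<^esub> elt_class (src E l) \<gamma>\<^sub>2)"
    unfolding arrow_class_cmp[OF kl] using closed by (simp only: Pi1.m_assoc Pi1.m_closed)
  also have "\<dots> = arrow_class (cmp E k l) \<otimes>\<^bsub>\<Pi>\<^sub>1\<^esub> elt_class (src E l) (corr_mult E k l \<gamma>\<^sub>1 \<gamma>\<^sub>2)"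
    unfolding elt_class_mult[OF x u phi] elt_class_mult[OF x X.m_closed[OF u phi] \<gamma>'] corr_mult_def ..
  finally show ?thesis
    unfolding kappa_def s group_times_pair_simps E.src_cmp[OF kl] E.rng_cmp[OF kl] by simp
qed

lemma kappa_unit: "x \<in> Obj E \<Longrightarrow> kappa x \<one>\<^bsub>Grp E x\<^esub> = (\<one>\<^bsub>\<Pi>\<^sub>1\<^esub>, x, x)"
proof -
  interpret E: tight_diagram_data E by (rule extended_tight)
  assume x: "x \<in> Obj E"
  show ?thesis
    unfolding kappa_def E.src_ident[OF x] E.rng_ident[OF x] arrow_class_unit[OF x] elt_class_one[OF x]
    by simp
qed

text \<open>The cone arrow of an identity arrow \<open>x\<close> gives \<open>(1, \<infinity>, x)\<close>, since \<open>x = 1\<close> in \<open>\<Pi>\<^sub>1\<close>.  Composing with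
  these arrows and their inverses moves everything into the isotropy group at \<open>\<infinity>\<close> and back, and there
  the generators of \<open>\<Pi>\<^sub>1\<close> are available.\<close>

lemma kappa_generates:
  assumes kappa: "\<And>k \<gamma>. k \<in> Arr E \<Longrightarrow> \<gamma> \<in> carrier (Grp E (src E k)) \<Longrightarrow> kappa k \<gamma> \<in> Q"
    and cmp: "\<And>p q. p \<in> Q \<Longrightarrow> q \<in> Q \<Longrightarrow> composable \<P> p q \<Longrightarrow> cmp \<P> p q \<in> Q"
    and inv: "\<And>p. p \<in> Q \<Longrightarrow> p \<in> Arr \<P> \<Longrightarrow> ginv \<P> p \<in> Q"
  shows "Arr \<P> \<subseteq> Q"
proof -
  have apex: "Apex \<in> Obj E" by simp
  have cone: "(\<one>\<^bsub>\<Pi>\<^sub>1\<^esub>, Apex, x) \<in> Q" if x: "x \<in> Obj E" for x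
  proof (cases x)
    case (Base y)
    then have y: "y \<in> Obj D" "y \<in> Arr D" using x Obj_subset by auto
    have "kappa (Cone y) \<one>\<^bsub>Grp D y\<^esub> \<in> Q"
      using y by (intro kappa) (auto simp: src_ident group_Grp group.is_monoid)
    moreover have "kappa (Cone y) \<one>\<^bsub>Grp D y\<^esub> = (\<one>\<^bsub>\<Pi>\<^sub>1\<^esub>, Apex, x)"
      using y Base arrow_class_unit[of "Base y"] elt_class_one[of "Base y"]
      by (simp add: kappa_def src_ident)
    ultimately show ?thesis by simp
  next
    case Apex
    then show ?thesis using kappa[of Apex "\<one>\<^bsub>Grp E Apex\<^esub>"] kappa_unit[OF apex] by simp
  qed (use x in auto)
  have move: "(p, x, y) \<in> Q \<longleftrightarrow> (p, Apex, Apex) \<in> Q"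
    if p: "p \<in> carrier \<Pi>\<^sub>1" and x: "x \<in> Obj E" and y: "y \<in> Obj E" for p x y
  proof
    have inv_cone: "(\<one>\<^bsub>\<Pi>\<^sub>1\<^esub>, x, Apex) \<in> Q" "(\<one>\<^bsub>\<Pi>\<^sub>1\<^esub>, y, Apex) \<in> Q"
      using inv[OF cone[OF x]] inv[OF cone[OF y]] x y by auto
    show "(p, Apex, Apex) \<in> Q" if "(p, x, y) \<in> Q"
      using cmp[OF cmp[OF cone[OF x] that] inv_cone(2)] p x y by auto
    show "(p, x, y) \<in> Q" if "(p, Apex, Apex) \<in> Q"
      using cmp[OF cmp[OF inv_cone(1) that] cone[OF y]] p x y by auto
  qed
  have letter: "(pi1_class [(True, s)], Apex, Apex) \<in> Q \<and> pi1_class [(True, s)] \<in> carrier \<Pi>\<^sub>1"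
    if s: "s \<in> pi1_gens D" for s
  proof (cases s)
    case (Arrow g)
    then have g: "g \<in> Arr D" using s by (auto simp: pi1_gens_def)
    have "kappa (Base g) \<one>\<^bsub>Grp D (src D g)\<^esub> \<in> Q"
      using g by (intro kappa) (auto simp: src_Obj group_Grp group.is_monoid)
    moreover have "kappa (Base g) \<one>\<^bsub>Grp D (src D g)\<^esub>
        = (pi1_class [(True, s)], Base (rng D g), Base (src D g))"
      using g Arrow elt_class_one[of "Base (src D g)"] arrow_class_closed[of "Base g"]
      by (simp add: kappa_def src_Obj)
    ultimately show ?thesis
      using move[of "pi1_class [(True, s)]" "Base (rng D g)" "Base (src D g)"] g Arrow
        arrow_class_closed[of "Base g"] by (simp add: src_Obj rng_Obj)
  next
    case (Elt x \<gamma>)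
    then have x: "x \<in> Obj D" "x \<in> Arr D" "\<gamma> \<in> carrier (Grp D x)"
      using s Obj_subset by (auto simp: pi1_gens_def)
    have "kappa (Base x) \<gamma> \<in> Q"
      using x by (intro kappa) (auto simp: src_ident)
    moreover have "kappa (Base x) \<gamma> = (pi1_class [(True, s)], Base x, Base x)"
      using x Elt arrow_class_unit[of "Base x"] elt_class_closed[of "Base x" \<gamma>]
      by (simp add: kappa_def src_ident rng_ident)
    ultimately show ?thesis
      using move[of "pi1_class [(True, s)]" "Base x" "Base x"] x Elt
        elt_class_closed[of "Base x" \<gamma>] by simp
  qed
  have all: "(p, Apex, Apex) \<in> Q" if "p \<in> carrier \<Pi>\<^sub>1" for p
    using that unfolding fundamental_group_def
  proof (induction rule: presented_group_induct)
    case one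
    show ?case using cone[OF apex] by (simp add: fundamental_group_def)
  next
    case (gen s p)
    then show ?case
      using letter[of s] cmp[of "(pi1_class [(True, s)], Apex, Apex)" "(p, Apex, Apex)"]
      by (simp add: fundamental_group_def pi1_class_def)
  next
    case (inv_gen s p)
    then show ?case
      using letter[of s] inv[of "(pi1_class [(True, s)], Apex, Apex)"]
        cmp[of "(inv\<^bsub>\<Pi>\<^sub>1\<^esub> pi1_class [(True, s)], Apex, Apex)" "(p, Apex, Apex)"] Pi1.inv_closed
      by (simp add: fundamental_group_def pi1_class_def)
  qed
  show ?thesis
  proof (rule subsetI)
    fix q assume "q \<in> Arr \<P>"
    then obtain p x y where q: "q = (p, x, y)" "p \<in> carrier \<Pi>\<^sub>1" "x \<in> Obj E" "y \<in> Obj E"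
      unfolding group_times_pair_simps by blast
    then show "q \<in> Q" using move[THEN iffD2, OF q(2-4) all[OF q(2)]] by simp
  qed
qed

end

section \<open>The groupoid model of the cone\<close>

(* From here on the arguments apply the general theory of diagrams and their actions to the extended
   diagram as a whole; unfolding it would hide the instances of the general laws. *)
declare extended_data_simps [simp del]

context tight_diagram_data
begin

interpretation cone: tight_diagram_data E
  by (rule extended_tight)

interpretation product: etale_groupoid \<P>
  by (rule etale_group_times_pair) (rule group_fundamental_group)

text \<open>The passage from \<open>\<P>\<close>-actions to actions of the extended diagram: the pieces are the fibres of the
  anchor map, and \<open>\<gamma> \<in> \<X>\<^sub>k\<close> acts as the arrow \<open>kappa k \<gamma>\<close>.\<close>

definition diagram_action_of where
  "diagram_action_of Y B =
     \<lparr>piece = (\<lambda>x. {y \<in> topspace Y. x \<in> Obj E \<and> anchor B y = (\<one>\<^bsub>\<Pi>\<^sub>1\<^esub>, x, x)}),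
      dact = (\<lambda>k \<gamma> y. if k \<in> Arr E \<and> \<gamma> \<in> corr_set E k \<and> y \<in> topspace Y \<and>
            anchor B y = (\<one>\<^bsub>\<Pi>\<^sub>1\<^esub>, src E k, src E k)
          then act B (kappa k \<gamma>) y else undefined)\<rparr>"

lemma piece_diagram_action_of:
  "x \<in> Obj E \<Longrightarrow>
    piece (diagram_action_of Y B) x = {y \<in> topspace Y. anchor B y = (\<one>\<^bsub>\<Pi>\<^sub>1\<^esub>, x, x)}"
  by (simp add: diagram_action_of_def)

lemma dact_diagram_action_of:
  "k \<in> Arr E \<Longrightarrow> \<gamma> \<in> carrier (Grp E (src E k)) \<Longrightarrow> y \<in> piece (diagram_action_of Y B) (src E k) \<Longrightarrow>
    dact (diagram_action_of Y B) k \<gamma> y = act B (kappa k \<gamma>) y"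
  by (auto simp: diagram_action_of_def corr_set_def)

lemma act_dom_kappa:
  "k \<in> Arr E \<Longrightarrow> \<gamma> \<in> carrier (Grp E (src E k)) \<Longrightarrow>
    (kappa k \<gamma>, y) \<in> act_dom \<P> Y B \<longleftrightarrow> y \<in> piece (diagram_action_of Y B) (src E k)"
  using kappa_Arr[of k \<gamma>] cone.src_Obj[of k]
  by (auto simp: act_dom_def piece_diagram_action_of simp del: group_times_pair_simps)

lemma kappa_split:
  assumes k: "k \<in> Arr E" and \<gamma>: "\<gamma> \<in> carrier (Grp E (src E k))" "\<eta> \<in> carrier (Grp E (src E k))"
  shows "composable \<P> (kappa k \<gamma>) (kappa (src E k) \<eta>)"
    "cmp \<P> (kappa k \<gamma>) (kappa (src E k) \<eta>) = kappa k (\<gamma> \<otimes>\<^bsub>Grp E (src E k)\<^esub> \<eta>)"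
proof -
  have x: "src E k \<in> Obj E" "src E k \<in> Arr E" using cone.src_Obj[OF k] cone.Obj_subset by auto
  interpret X: group "Grp E (src E k)" using x(1) by (rule cone.group_Grp)
  have "composable E k (src E k)" using k x by (simp add: composable_def cone.rng_ident)
  then show "cmp \<P> (kappa k \<gamma>) (kappa (src E k) \<eta>) = kappa k (\<gamma> \<otimes>\<^bsub>Grp E (src E k)\<^esub> \<eta>)"
    using kappa_mult[of k "src E k" \<gamma> \<eta>] \<gamma> x k
    by (simp add: cone.src_ident cone.cmp_ident_right corr_mult_def cone.cocyc_ident_right
        cone.phi_ident)
  show "composable \<P> (kappa k \<gamma>) (kappa (src E k) \<eta>)"
    using kappa_Arr[OF k \<gamma>(1)] kappa_Arr[of "src E k" \<eta>] x \<gamma>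
    unfolding composable_def by (simp add: cone.src_ident cone.rng_ident)
qed

lemma composable_kappa:
  assumes "composable E k l" "\<gamma>\<^sub>1 \<in> carrier (Grp E (src E k))" "\<gamma>\<^sub>2 \<in> carrier (Grp E (src E l))"
  shows "composable \<P> (kappa k \<gamma>\<^sub>1) (kappa l \<gamma>\<^sub>2)"
  using kappa_Arr[of k \<gamma>\<^sub>1] kappa_Arr[of l \<gamma>\<^sub>2] assms unfolding composable_def by simp

lemma obj_topo_product: "obj_topo \<P> = discrete_topology (Obj \<P>)"
  using product.Obj_subset by (simp add: obj_topo_def Int_absorb1 del: group_times_pair_simps(1,2))
    (simp add: Int_absorb1)

text \<open>Each \<open>kappa k \<gamma>\<close> acts as a homeomorphism between fibres of the anchor map, which gives the
  topological conditions.  Cancellation holds with \<open>\<eta> = \<gamma>\<inverse>\<gamma>'\<close>, because \<open>\<gamma>'\<close> acts on \<open>y'\<close> as \<open>\<gamma>\<close> acts on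
  \<open>\<eta> \<cdot> y'\<close>.\<close>

lemma is_diagram_action_of:
  assumes B: "left_action \<P> Y B"
  shows "is_diagram_action E Y (diagram_action_of Y B)" (is "is_diagram_action E Y ?A")
proof -
  have piece: "subtopology Y (piece ?A x) = subtopology Y {y. anchor B y = (\<one>\<^bsub>\<Pi>\<^sub>1\<^esub>, x, x)}"
    if x: "x \<in> Obj E" for x
  proof -
    have "piece ?A x = topspace Y \<inter> {y. anchor B y = (\<one>\<^bsub>\<Pi>\<^sub>1\<^esub>, x, x)}"
      using piece_diagram_action_of[OF x, of Y B] by auto
    then show ?thesis by (simp only: subtopology_restrict)
  qed
  have homeo: "homeomorphic_map (subtopology Y (piece ?A (src E k))) (subtopology Y (piece ?A (rng E k)))
      (act B (kappa k \<gamma>))" if k: "k \<in> Arr E" and \<gamma>: "\<gamma> \<in> carrier (Grp E (src E k))" for k \<gamma>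
    unfolding piece[OF cone.src_Obj[OF k]] piece[OF cone.rng_Obj[OF k]]
    using product.act_homeomorphic[OF B kappa_Arr(1)[OF k \<gamma>], unfolded kappa_Arr(2,3)[OF k \<gamma>]]
      homeomorphic_maps_map by blast
  have top: "topspace (subtopology Y (piece ?A x)) = piece ?A x" if "x \<in> Obj E" for x
    using that by (auto simp: piece_diagram_action_of)
  have closed: "act B (kappa k \<gamma>) y \<in> piece ?A (rng E k)"
    if k: "k \<in> Arr E" and \<gamma>: "\<gamma> \<in> carrier (Grp E (src E k))" and y: "y \<in> piece ?A (src E k)" for k \<gamma> y
    using homeomorphic_imp_surjective_map[OF homeo[OF k \<gamma>]] y
    unfolding top[OF cone.src_Obj[OF k]] top[OF cone.rng_Obj[OF k]] by blast
  show ?thesis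
    unfolding is_diagram_action_def
  proof (intro conjI allI impI ballI)
    show "piece ?A x = {}" if "x \<notin> Obj E" for x using that by (simp add: diagram_action_of_def)
    show "dact ?A k \<gamma> y = undefined"
      if "\<not> (k \<in> Arr E \<and> \<gamma> \<in> corr_set E k \<and> y \<in> piece ?A (src E k))" for k \<gamma> y
      using that by (auto simp: diagram_action_of_def cone.src_Obj)
    show "(\<Union>x\<in>Obj E. piece ?A x) = topspace Y"
    proof (intro equalityI subsetI)
      fix y assume y: "y \<in> topspace Y"
      from left_actionD(1)[OF B y] obtain x where "x \<in> Obj E" "anchor B y = (\<one>\<^bsub>\<Pi>\<^sub>1\<^esub>, x, x)" by auto
      then show "y \<in> (\<Union>x\<in>Obj E. piece ?A x)" using y by (auto simp: piece_diagram_action_of)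
    qed (auto simp: piece_diagram_action_of)
    show "disjoint_family_on (piece ?A) (Obj E)"
      by (auto simp: disjoint_family_on_def piece_diagram_action_of)
    note anchor = left_actionD(5)[OF B, unfolded obj_topo_product]
    show "openin Y (piece ?A x)" if x: "x \<in> Obj E" for x
      using openin_continuous_map_preimage[OF anchor, of "{(\<one>\<^bsub>\<Pi>\<^sub>1\<^esub>, x, x)}"] x
      by (simp add: piece_diagram_action_of)
    show "closedin Y (piece ?A x)" if x: "x \<in> Obj E" for x
      using closedin_continuous_map_preimage[OF anchor, of "{(\<one>\<^bsub>\<Pi>\<^sub>1\<^esub>, x, x)}"] x
      by (simp add: piece_diagram_action_of)
    fix k l assume kl: "composable E k l"
    have kl': "k \<in> Arr E" "l \<in> Arr E" "src E k = rng E l" using kl by (auto simp: composable_def)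
    fix \<gamma>\<^sub>1 \<gamma>\<^sub>2 y assume "\<gamma>\<^sub>1 \<in> corr_set E k" "\<gamma>\<^sub>2 \<in> corr_set E l" and y: "y \<in> piece ?A (src E l)"
    then have \<gamma>: "\<gamma>\<^sub>1 \<in> carrier (Grp E (src E k))" "\<gamma>\<^sub>2 \<in> carrier (Grp E (src E l))"
      by (simp_all add: corr_set_def)
    interpret X: group "Grp E (src E l)" by (rule cone.group_Grp[OF cone.src_Obj[OF kl'(2)]])
    have corr: "corr_mult E k l \<gamma>\<^sub>1 \<gamma>\<^sub>2 \<in> carrier (Grp E (src E (cmp E k l)))"
      unfolding corr_mult_def cone.src_cmp[OF kl]
      using cone.cocyc_closed[OF kl] cone.phi_closed[OF kl'(2)] \<gamma> kl'(3) by simp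
    have "dact ?A k \<gamma>\<^sub>1 (dact ?A l \<gamma>\<^sub>2 y) = act B (kappa k \<gamma>\<^sub>1) (act B (kappa l \<gamma>\<^sub>2) y)"
      using dact_diagram_action_of[OF kl'(2) \<gamma>(2) y] closed[OF kl'(2) \<gamma>(2) y] kl'(3)
        dact_diagram_action_of[OF kl'(1) \<gamma>(1), of _ Y B] by simp
    also have "\<dots> = act B (cmp \<P> (kappa k \<gamma>\<^sub>1) (kappa l \<gamma>\<^sub>2)) y"
      using left_actionD(3)[OF B composable_kappa[OF kl \<gamma>]] y act_dom_kappa[OF kl'(2) \<gamma>(2), of y Y B] by simp
    also have "\<dots> = dact ?A (cmp E k l) (corr_mult E k l \<gamma>\<^sub>1 \<gamma>\<^sub>2) y"
      unfolding kappa_mult[OF kl \<gamma>]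
      using dact_diagram_action_of[OF cone.cmp_Arr[OF kl] corr, of y Y B] y by (simp add: cone.src_cmp[OF kl])
    finally show "dact ?A k \<gamma>\<^sub>1 (dact ?A l \<gamma>\<^sub>2 y) = dact ?A (cmp E k l) (corr_mult E k l \<gamma>\<^sub>1 \<gamma>\<^sub>2) y" .
  next
    fix k assume k: "k \<in> Arr E"
    interpret X: group "Grp E (src E k)" by (rule cone.group_Grp[OF cone.src_Obj[OF k]])
    note x = cone.src_Obj[OF k] cone.rng_Obj[OF k]
    let ?S = "subtopology Y (piece ?A (src E k))" and ?R = "subtopology Y (piece ?A (rng E k))"
    have dact_homeo: "homeomorphic_map ?S ?R (\<lambda>y. (\<lambda>(\<gamma>, y). dact ?A k \<gamma> y) (\<gamma>, y))"
      if \<gamma>: "\<gamma> \<in> carrier (Grp E (src E k))" for \<gamma>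
      by (rule homeomorphic_map_eq[OF homeo[OF k \<gamma>]])
        (simp add: top[OF x(1)] dact_diagram_action_of[OF k \<gamma>, of _ Y B] del: topspace_subtopology)
    have "continuous_map (subtopology (prod_topology (discrete_topology (carrier (Grp E (src E k)))) ?S)
        (carrier (Grp E (src E k)) \<times> topspace ?S)) ?R (\<lambda>(\<gamma>, y). dact ?A k \<gamma> y)"
      by (rule continuous_map_from_discrete_product)
        (auto intro!: continuous_map_from_subtopology
          homeomorphic_imp_continuous_map[OF dact_homeo, simplified])
    then have "continuous_map (prod_topology (discrete_topology (carrier (Grp E (src E k)))) ?S) ?R
        (\<lambda>(\<gamma>, y). dact ?A k \<gamma> y)"
      by (metis subtopology_topspace topspace_discrete_topology topspace_prod_topology)
    moreover have "open_map (prod_topology (discrete_topology (carrier (Grp E (src E k)))) ?S) ?R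
        (\<lambda>(\<gamma>, y). dact ?A k \<gamma> y)"
      by (rule open_map_from_discrete_product) (rule homeomorphic_imp_open_map[OF dact_homeo])
    moreover have "(\<lambda>(\<gamma>, y). dact ?A k \<gamma> y) ` (carrier (Grp E (src E k)) \<times> piece ?A (src E k))
        = piece ?A (rng E k)"
    proof (intro equalityI subsetI)
      fix z assume "z \<in> piece ?A (rng E k)"
      then have "z \<in> (\<lambda>y. dact ?A k \<one>\<^bsub>Grp E (src E k)\<^esub> y) ` piece ?A (src E k)"
        using homeomorphic_imp_surjective_map[OF dact_homeo[OF X.one_closed]]
        unfolding top[OF x(1)] top[OF x(2)] by simp
      then show "z \<in> (\<lambda>(\<gamma>, y). dact ?A k \<gamma> y) ` (carrier (Grp E (src E k)) \<times> piece ?A (src E k))"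
        using X.one_closed by blast
    next
      fix z assume "z \<in> (\<lambda>(\<gamma>, y). dact ?A k \<gamma> y) ` (carrier (Grp E (src E k)) \<times> piece ?A (src E k))"
      then obtain \<gamma> y where "\<gamma> \<in> carrier (Grp E (src E k))" "y \<in> piece ?A (src E k)"
        "z = dact ?A k \<gamma> y" by auto
      then show "z \<in> piece ?A (rng E k)"
        using closed[OF k] dact_diagram_action_of[OF k, of \<gamma> y Y B] by simp
    qed
    ultimately show "let X = prod_topology (discrete_topology (corr_set E k)) ?S; Z = ?R;
        m = (\<lambda>(\<gamma>, y). dact ?A k \<gamma> y)
      in continuous_map X Z m \<and> open_map X Z m \<and> m ` topspace X = topspace Z"
      unfolding Let_def corr_set_def topspace_prod_topology topspace_discrete_topology
        top[OF x(1)] top[OF x(2)] by blast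
    fix \<gamma> \<gamma>' y y' assume "\<gamma> \<in> corr_set E k" "\<gamma>' \<in> corr_set E k"
      and y: "y \<in> piece ?A (src E k)" "y' \<in> piece ?A (src E k)"
      and eq: "dact ?A k \<gamma> y = dact ?A k \<gamma>' y'"
    then have \<gamma>: "\<gamma> \<in> carrier (Grp E (src E k))" "\<gamma>' \<in> carrier (Grp E (src E k))"
      by (simp_all add: corr_set_def)
    define \<eta> where "\<eta> = inv\<^bsub>Grp E (src E k)\<^esub> \<gamma> \<otimes>\<^bsub>Grp E (src E k)\<^esub> \<gamma>'"
    have \<eta>: "\<eta> \<in> carrier (Grp E (src E k))" "\<gamma> \<otimes>\<^bsub>Grp E (src E k)\<^esub> \<eta> = \<gamma>'"
      using \<gamma> by (simp_all add: \<eta>_def X.m_assoc[symmetric])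
    have s: "src E k \<in> Arr E" "src E (src E k) = src E k" "rng E (src E k) = src E k"
      using x(1) cone.Obj_subset by (auto simp: cone.src_ident cone.rng_ident)
    have y'': "act B (kappa (src E k) \<eta>) y' \<in> piece ?A (src E k)"
      using closed[of "src E k" \<eta> y'] \<eta> s y by simp
    have "act B (kappa k \<gamma>) y = act B (kappa k \<gamma>') y'"
      using eq dact_diagram_action_of[OF k, of \<gamma> y Y B] dact_diagram_action_of[OF k, of \<gamma>' y' Y B] \<gamma> y
      by simp
    also have "\<dots> = act B (kappa k \<gamma>) (act B (kappa (src E k) \<eta>) y')"
      using left_actionD(3)[OF B kappa_split(1)[OF k \<gamma>(1) \<eta>(1)], of y']
        act_dom_kappa[of "src E k" \<eta> y' Y B] \<eta> s y
      unfolding kappa_split(2)[OF k \<gamma>(1) \<eta>(1)] by simp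
    finally have e: "act B (kappa k \<gamma>) y = act B (kappa k \<gamma>) (act B (kappa (src E k) \<eta>) y')" .
    have "y = act B (kappa (src E k) \<eta>) y'"
      using homeomorphic_imp_injective_map[OF homeo[OF k \<gamma>(1)]] unfolding top[OF x(1)]
      by (rule inj_onD[OF _ e y(1) y''])
    also have "\<dots> = dact ?A (src E k) \<eta> y'"
      using dact_diagram_action_of[of "src E k" \<eta> y' Y B] \<eta> s y by simp
    finally show "\<exists>\<eta> \<in> carrier (Grp E (src E k)).
        \<gamma>' = corr_right E k \<gamma> \<eta> \<and> y = dact ?A (src E k) \<eta> y'"
      using \<eta> by (auto simp: corr_right_def)
  qed
qed

text \<open>The arrows with which \<open>f\<close> commutes are closed under composition and inverses.  If \<open>f\<close> is equivariant
  for the diagram, they include all \<open>kappa k \<gamma>\<close>, and these generate \<open>\<P>\<close>.\<close>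

lemma equivariant_iff:
  assumes B: "left_action \<P> Y B" and B': "left_action \<P> Y' B'"
    and f: "f ` topspace Y \<subseteq> topspace Y'"
  shows "equivariant \<P> Y B B' f \<longleftrightarrow>
    diagram_equivariant E (diagram_action_of Y B) (diagram_action_of Y' B') f"
proof
  assume eq: "equivariant \<P> Y B B' f"
  have piece: "f y \<in> piece (diagram_action_of Y' B') x"
    if "x \<in> Obj E" "y \<in> piece (diagram_action_of Y B) x" for x y
    using that f eq by (auto simp: piece_diagram_action_of equivariant_def)
  show "diagram_equivariant E (diagram_action_of Y B) (diagram_action_of Y' B') f"
    unfolding diagram_equivariant_def corr_set_def
  proof (intro conjI ballI)
    fix k \<gamma> y assume *: "k \<in> Arr E" "\<gamma> \<in> carrier (Grp E (src E k))"
      "y \<in> piece (diagram_action_of Y B) (src E k)"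
    then have "f (act B (kappa k \<gamma>) y) = act B' (kappa k \<gamma>) (f y)"
      using eq act_dom_kappa[of k \<gamma> y Y B] unfolding equivariant_def by blast
    then show "f (dact (diagram_action_of Y B) k \<gamma> y) = dact (diagram_action_of Y' B') k \<gamma> (f y)"
        using dact_diagram_action_of[OF *]
          dact_diagram_action_of[OF *(1,2) piece[OF cone.src_Obj[OF *(1)] *(3)]] by simp
  qed (use piece in blast)
next
  assume eq: "diagram_equivariant E (diagram_action_of Y B) (diagram_action_of Y' B') f"
  have anchor: "anchor B' (f y) = anchor B y" if y: "y \<in> topspace Y" for y
  proof -
    from left_actionD(1)[OF B y] obtain x where x: "x \<in> Obj E" "anchor B y = (\<one>\<^bsub>\<Pi>\<^sub>1\<^esub>, x, x)" by auto
    then have "f y \<in> piece (diagram_action_of Y' B') x"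
      using eq y unfolding diagram_equivariant_def by (auto simp: piece_diagram_action_of)
    then show ?thesis using x by (simp add: piece_diagram_action_of)
  qed
  have dom: "(p, f y) \<in> act_dom \<P> Y' B'" if "(p, y) \<in> act_dom \<P> Y B" for p y
    using that f anchor by (auto simp: act_dom_def)
  define Q where "Q = {p. \<forall>y. (p, y) \<in> act_dom \<P> Y B \<longrightarrow> f (act B p y) = act B' p (f y)}"
  have "Arr \<P> \<subseteq> Q"
  proof (rule kappa_generates)
    show "kappa k \<gamma> \<in> Q" if k: "k \<in> Arr E" and \<gamma>: "\<gamma> \<in> carrier (Grp E (src E k))" for k \<gamma>
      unfolding Q_def mem_Collect_eq
    proof (intro allI impI)
      fix y assume y: "(kappa k \<gamma>, y) \<in> act_dom \<P> Y B"
      then have y': "y \<in> piece (diagram_action_of Y B) (src E k)"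
        "f y \<in> piece (diagram_action_of Y' B') (src E k)"
        using y dom[OF y] act_dom_kappa[OF k \<gamma>, of y Y B] act_dom_kappa[OF k \<gamma>, of "f y" Y' B']
        by simp_all
      have "f (dact (diagram_action_of Y B) k \<gamma> y) = dact (diagram_action_of Y' B') k \<gamma> (f y)"
        using eq k \<gamma> y'(1) unfolding diagram_equivariant_def corr_set_def by blast
      then show "f (act B (kappa k \<gamma>) y) = act B' (kappa k \<gamma>) (f y)"
        using dact_diagram_action_of[OF k \<gamma> y'(1)] dact_diagram_action_of[OF k \<gamma> y'(2)] by simp
    qed
    show "cmp \<P> p q \<in> Q" if Q: "p \<in> Q" "q \<in> Q" and pq: "composable \<P> p q" for p q
      unfolding Q_def mem_Collect_eq
    proof (intro allI impI)
      fix y assume y: "(cmp \<P> p q, y) \<in> act_dom \<P> Y B"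
      have q: "(q, y) \<in> act_dom \<P> Y B"
        using y pq product.src_cmp[OF pq] by (simp add: act_dom_def composable_def del: group_times_pair_simps)
      have p: "(p, act B q y) \<in> act_dom \<P> Y B"
        using left_actionD(2)[OF B q] product.act_closed[OF B q] pq
        by (simp add: act_dom_def composable_def del: group_times_pair_simps)
      show "f (act B (cmp \<P> p q) y) = act B' (cmp \<P> p q) (f y)"
        using Q p q left_actionD(3)[OF B pq q] left_actionD(3)[OF B' pq dom[OF q]]
        by (simp add: Q_def)
    qed
    show "ginv \<P> p \<in> Q" if Q: "p \<in> Q" and p: "p \<in> Arr \<P>" for p
      unfolding Q_def mem_Collect_eq
    proof (intro allI impI)
      fix y assume y: "(ginv \<P> p, y) \<in> act_dom \<P> Y B"
      define z where "z = act B (ginv \<P> p) y"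
      have c: "composable \<P> p (ginv \<P> p)" "composable \<P> (ginv \<P> p) p"
        using p product.ginv_Arr[OF p] product.src_ginv[OF p] product.rng_ginv[OF p]
        by (simp_all add: composable_def del: group_times_pair_simps)
      have yt: "y \<in> topspace Y" "rng \<P> p = anchor B y"
        using y product.src_ginv[OF p] by (simp_all add: act_dom_def del: group_times_pair_simps)
      have z: "(p, z) \<in> act_dom \<P> Y B"
        using left_actionD(2)[OF B y] product.act_closed[OF B y] p product.rng_ginv[OF p]
        by (simp add: act_dom_def z_def del: group_times_pair_simps)
      have pz: "act B p z = y"
        using left_actionD(3)[OF B c(1) y] left_actionD(4)[OF B yt(1)] product.cmp_ginv_right[OF p] yt
        by (simp add: z_def del: group_times_pair_simps)
      have fz: "f y = act B' p (f z)" using Q z pz by (auto simp: Q_def)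
      have "act B' (ginv \<P> p) (f y) = act B' (src \<P> p) (f z)"
        using left_actionD(3)[OF B' c(2) dom[OF z]] product.cmp_ginv_left[OF p]
        by (simp add: fz del: group_times_pair_simps)
      also have "\<dots> = f z"
        using left_actionD(4)[OF B', of "f z"] dom[OF z]
        by (simp add: act_dom_def del: group_times_pair_simps)
      finally show "f (act B (ginv \<P> p) y) = act B' (ginv \<P> p) (f y)" by (simp add: z_def)
    qed
  qed
  have "f (act B p y) = act B' p (f y)" if "(p, y) \<in> act_dom \<P> Y B" for p y
  proof -
    have "p \<in> Arr \<P>" using that unfolding act_dom_def by blast
    then have "p \<in> Q" using \<open>Arr \<P> \<subseteq> Q\<close> by blast
    then show ?thesis using that unfolding Q_def by blast
  qed
  then show "equivariant \<P> Y B B' f"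
    using anchor unfolding equivariant_def by auto
qed

text \<open>If two actions induce the same action of the diagram, then the identity map is equivariant between
  them.\<close>

lemma diagram_action_of_inj:
  assumes B: "left_action \<P> Y B" and B': "left_action \<P> Y B'"
    and eq: "diagram_action_of Y B = diagram_action_of Y B'"
  shows "B = B'"
proof -
  have "diagram_equivariant E (diagram_action_of Y B) (diagram_action_of Y B') id"
    by (simp add: eq diagram_equivariant_def)
  then have equi: "equivariant \<P> Y B B' id" using equivariant_iff[OF B B', of id] by simp
  then have anchor: "anchor B y = anchor B' y" if "y \<in> topspace Y" for y
    using that by (simp add: equivariant_def)
  have "anchor B = anchor B'"
    by (rule extensionalityI[of _ "topspace Y"]) (use B B' anchor in \<open>auto simp: left_action_def\<close>)
  moreover have "act B p y = act B' p y" for p y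
  proof (cases "(p, y) \<in> act_dom \<P> Y B")
    case True
    then show ?thesis using equi by (auto simp: equivariant_def)
  next
    case False
    then have "(p, y) \<notin> act_dom \<P> Y B'" using anchor by (auto simp: act_dom_def)
    moreover have "\<forall>p y. (p, y) \<notin> act_dom \<P> Y B \<longrightarrow> act B p y = undefined"
      using B unfolding left_action_def by (elim conjE)
    moreover have "\<forall>p y. (p, y) \<notin> act_dom \<P> Y B' \<longrightarrow> act B' p y = undefined"
      using B' unfolding left_action_def by (elim conjE)
    ultimately show ?thesis using False by metis
  qed
  ultimately show ?thesis by (intro groupoid_action.equality ext) simp_all
qed

text \<open>The arrow from an object to \<open>\<infinity>\<close> along which the pieces are identified with the piece at \<open>\<infinity>\<close>.\<close>

fun cone_arrow :: "'a ext_arrow \<Rightarrow> 'a ext_arrow" where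
  "cone_arrow (Base x) = Cone x"
| "cone_arrow k = k"

lemma cone_arrow:
  assumes "x \<in> Obj E"
  shows "cone_arrow x \<in> Arr E" "src E (cone_arrow x) = x" "rng E (cone_arrow x) = Apex"
  using assms Obj_subset by (auto simp: extended_data_simps src_ident)

text \<open>The unit elements at the cone arrows give the charts \<open>\<beta> x\<close> from the pieces to \<open>Z\<close>, the piece at \<open>\<infinity>\<close>.
  Read in these charts, \<open>\<gamma> \<in> \<X>\<^sub>k\<close> acts on \<open>Z\<close> as the homeomorphism \<open>\<sigma> k \<gamma>\<close>, and the multiplication law of the
  action shows that the \<open>\<sigma>\<close> of the generators satisfy the relations of \<open>\<Pi>\<^sub>1\<close>.  So \<open>\<Pi>\<^sub>1\<close> acts on \<open>Z\<close>, and
  undoing the charts gives the \<open>\<P>\<close>-action.\<close>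

lemma diagram_action_of_surj:
  assumes A: "is_diagram_action E Y A"
  shows "\<exists>B. left_action \<P> Y B \<and> diagram_action_of Y B = A"
proof -
  interpret A: diagram_action E Y A
    by unfold_locales (fact A)
  define Z where "Z = subtopology Y (piece A Apex)"
  have apex: "Apex \<in> Obj E" "Apex \<in> Arr E" "src E Apex = Apex" "rng E Apex = Apex"
    by (simp_all add: extended_data_simps)
  have Z: "topspace Z = piece A Apex" using A.piece_subset[OF apex(1)] by (auto simp: Z_def)
  define \<beta> where "\<beta> x = dact A (cone_arrow x) \<one>\<^bsub>Grp E x\<^esub>" for x
  have one: "\<one>\<^bsub>Grp E x\<^esub> \<in> carrier (Grp E x)" if "x \<in> Obj E" for x
    using cone.group_Grp[OF that] by (simp add: group.is_monoid)
  have "homeomorphic_map (subtopology Y (piece A x)) Z (\<beta> x)" if x: "x \<in> Obj E" for x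
    using A.dact_homeomorphic[OF cone_arrow(1)[OF x], of "\<one>\<^bsub>Grp E x\<^esub>"] one[OF x]
    unfolding cone_arrow(2,3)[OF x] \<beta>_def Z_def by simp
  then have "\<forall>x\<in>Obj E. \<exists>b. homeomorphic_maps (subtopology Y (piece A x)) Z (\<beta> x) b"
    by (simp add: homeomorphic_map_maps)
  from bchoice[OF this] obtain b where
    b: "\<And>x. x \<in> Obj E \<Longrightarrow> homeomorphic_maps (subtopology Y (piece A x)) Z (\<beta> x) (b x)" by blast
  have top: "topspace (subtopology Y (piece A x)) = piece A x" if "x \<in> Obj E" for x
    using A.piece_subset[OF that] by auto
  have chart: "y \<in> piece A x \<Longrightarrow> \<beta> x y \<in> topspace Z" "z \<in> topspace Z \<Longrightarrow> b x z \<in> piece A x"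
    "y \<in> piece A x \<Longrightarrow> b x (\<beta> x y) = y" "z \<in> topspace Z \<Longrightarrow> \<beta> x (b x z) = z"
    if x: "x \<in> Obj E" for x y z
  proof -
    have *: "continuous_map (subtopology Y (piece A x)) Z (\<beta> x)"
      "continuous_map Z (subtopology Y (piece A x)) (b x)"
      using b[OF x] by (auto simp: homeomorphic_maps_def)
    show "y \<in> piece A x \<Longrightarrow> \<beta> x y \<in> topspace Z" "z \<in> topspace Z \<Longrightarrow> b x z \<in> piece A x"
      using continuous_map_image_subset_topspace[OF *(1)] continuous_map_image_subset_topspace[OF *(2)]
      unfolding top[OF x] by blast+
    show "y \<in> piece A x \<Longrightarrow> b x (\<beta> x y) = y" "z \<in> topspace Z \<Longrightarrow> \<beta> x (b x z) = z"
      using b[OF x] unfolding homeomorphic_maps_def top[OF x] by blast+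
  qed
  let ?H = "homeo_group Z"
  interpret H: group ?H by (rule group_homeo_group)
  define \<sigma> where "\<sigma> k \<gamma> = (\<lambda>z\<in>topspace Z. \<beta> (rng E k) (dact A k \<gamma> (b (src E k) z)))" for k \<gamma>
  have \<sigma>_closed: "\<sigma> k \<gamma> \<in> carrier ?H"
    if k: "k \<in> Arr E" and \<gamma>: "\<gamma> \<in> carrier (Grp E (src E k))" for k \<gamma>
    unfolding carrier_homeo_group
  proof
    show "\<sigma> k \<gamma> \<in> extensional (topspace Z)" by (simp add: \<sigma>_def)
    have "homeomorphic_map Z (subtopology Y (piece A (src E k))) (b (src E k))"
      "homeomorphic_map (subtopology Y (piece A (rng E k))) Z (\<beta> (rng E k))"
      using b[OF cone.src_Obj[OF k]] b[OF cone.rng_Obj[OF k]] homeomorphic_maps_map by blast+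
    from homeomorphic_map_compose[OF homeomorphic_map_compose[OF this(1) A.dact_homeomorphic[OF k \<gamma>]] this(2)]
    show "homeomorphic_map Z Z (\<sigma> k \<gamma>)"
      by (rule homeomorphic_map_eq) (simp add: \<sigma>_def)
  qed
  have \<sigma>_mult: "\<sigma> k \<gamma> \<otimes>\<^bsub>?H\<^esub> \<sigma> l \<gamma>' = \<sigma> m \<eta>"
    if k: "k \<in> Arr E" "\<gamma> \<in> carrier (Grp E (src E k))" and l: "l \<in> Arr E" "\<gamma>' \<in> carrier (Grp E (src E l))"
      and s: "src E k = rng E l" and m: "src E m = src E l" "rng E m = rng E k"
      and eq: "\<And>y. y \<in> piece A (src E l) \<Longrightarrow> dact A k \<gamma> (dact A l \<gamma>' y) = dact A m \<eta> y"
    for k l m \<gamma> \<gamma>' \<eta>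
  proof -
    have "(\<sigma> k \<gamma> \<otimes>\<^bsub>?H\<^esub> \<sigma> l \<gamma>') z = \<sigma> m \<eta> z" for z
    proof (cases "z \<in> topspace Z")
      case True
      have y: "b (src E l) z \<in> piece A (src E l)" by (rule chart(2)[OF cone.src_Obj[OF l(1)] True])
      note w = A.dact_closed[OF l y]
      show ?thesis
        using True chart(1)[OF cone.rng_Obj[OF l(1)] w] chart(3)[OF cone.rng_Obj[OF l(1)] w] eq[OF y]
        by (simp add: mult_homeo_group \<sigma>_closed k l compose_def) (simp add: \<sigma>_def s m)
    next
      case False
      then show ?thesis
        by (simp add: mult_homeo_group \<sigma>_closed k l compose_def) (simp add: \<sigma>_def)
    qed
    then show ?thesis by (rule ext)
  qed
  have \<sigma>_one: "\<sigma> x \<one>\<^bsub>Grp E x\<^esub> = \<one>\<^bsub>?H\<^esub>" if x: "x \<in> Obj E" for x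
    unfolding one_homeo_group \<sigma>_def cone.src_ident[OF x] cone.rng_ident[OF x]
    using A.dact_one[OF x] chart[OF x] by (intro restrict_ext) simp
  have obj: "x \<in> Arr E" "src E x = x" "rng E x = x" if "x \<in> Obj E" for x
    using that cone.Obj_subset by (auto simp: cone.src_ident cone.rng_ident)
  have \<sigma>_split: "\<sigma> k \<one>\<^bsub>Grp E (src E k)\<^esub> \<otimes>\<^bsub>?H\<^esub> \<sigma> (src E k) \<gamma> = \<sigma> k \<gamma>"
    if k: "k \<in> Arr E" and \<gamma>: "\<gamma> \<in> carrier (Grp E (src E k))" for k \<gamma>
  proof -
    note x = cone.src_Obj[OF k]
    interpret X: group "Grp E (src E k)" using x by (rule cone.group_Grp)
    show ?thesis
      by (rule \<sigma>_mult) (use k \<gamma> obj[OF x] A.dact_split[OF k X.one_closed \<gamma>] in auto)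
  qed
  define f where "f s = (case s of Arrow g \<Rightarrow> \<sigma> (Base g) \<one>\<^bsub>Grp D (src D g)\<^esub> | Elt x \<gamma> \<Rightarrow> \<sigma> (Base x) \<gamma>)" for s
  have base: "Base g \<in> Arr E" "src E (Base g) = Base (src D g)" "rng E (Base g) = Base (rng D g)"
    "Grp E (Base (src D g)) = Grp D (src D g)" "Base (src D g) \<in> Obj E" "Base (rng D g) \<in> Obj E"
    "\<one>\<^bsub>Grp D (src D g)\<^esub> \<in> carrier (Grp D (src D g))"
    if "g \<in> Arr D" for g
    using that src_Obj[OF that] rng_Obj[OF that] group.is_monoid[OF group_Grp[OF src_Obj[OF that]]]
    by (simp_all add: extended_data_simps)
  have base_obj: "Base x \<in> Obj E" "Grp E (Base x) = Grp D x" if "x \<in> Obj D" for x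
    using that by (simp_all add: extended_data_simps)
  have f_closed: "f \<in> pi1_gens D \<rightarrow> carrier ?H"
    using base base_obj obj \<sigma>_closed by (fastforce simp: f_def pi1_gens_def)
  have elt_elt: "\<sigma> (Base x) \<gamma>\<^sub>1 \<otimes>\<^bsub>?H\<^esub> \<sigma> (Base x) \<gamma>\<^sub>2 = \<sigma> (Base x) (\<gamma>\<^sub>1 \<otimes>\<^bsub>Grp D x\<^esub> \<gamma>\<^sub>2)"
    if x: "x \<in> Obj D" and \<gamma>: "\<gamma>\<^sub>1 \<in> carrier (Grp D x)" "\<gamma>\<^sub>2 \<in> carrier (Grp D x)" for x \<gamma>\<^sub>1 \<gamma>\<^sub>2
    by (rule \<sigma>_mult)
      (use \<gamma> obj[OF base_obj(1)[OF x]] base_obj[OF x] A.dact_group[OF base_obj(1)[OF x], of \<gamma>\<^sub>1 \<gamma>\<^sub>2]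
        in auto)
  have arrow_elt: "\<sigma> (Base g) \<one>\<^bsub>Grp D (src D g)\<^esub> \<otimes>\<^bsub>?H\<^esub> \<sigma> (Base (src D g)) \<gamma> = \<sigma> (Base g) \<gamma>"
    if g: "g \<in> Arr D" and \<gamma>: "\<gamma> \<in> carrier (Grp D (src D g))" for g \<gamma>
    using \<sigma>_split[of "Base g" \<gamma>] base[OF g] \<gamma> by simp
  have elt_arrow: "\<sigma> (Base (rng D g)) \<gamma> \<otimes>\<^bsub>?H\<^esub> \<sigma> (Base g) \<one>\<^bsub>Grp D (src D g)\<^esub> = \<sigma> (Base g) (phi D g \<gamma>)"
    if g: "g \<in> Arr D" and \<gamma>: "\<gamma> \<in> carrier (Grp D (rng D g))" for g \<gamma>
  proof -
    interpret X: group "Grp D (src D g)" using g by (intro group_Grp src_Obj)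
    have "phi D g \<gamma> \<otimes>\<^bsub>Grp D (src D g)\<^esub> \<one>\<^bsub>Grp D (src D g)\<^esub> = phi D g \<gamma>"
      using phi_closed[OF g \<gamma>] by simp
    then show ?thesis
      by (intro \<sigma>_mult)
        (use base[OF g] base_obj[OF rng_Obj[OF g]] obj[OF base(6)[OF g]] \<gamma>
          A.dact_left[OF base(1)[OF g], of \<gamma> "\<one>\<^bsub>Grp D (src D g)\<^esub>"]
          in \<open>auto simp: extended_data_simps(7)\<close>)
  qed
  have arrow_arrow: "\<sigma> (Base g) \<one>\<^bsub>Grp D (src D g)\<^esub> \<otimes>\<^bsub>?H\<^esub> \<sigma> (Base h) \<one>\<^bsub>Grp D (src D h)\<^esub>
      = \<sigma> (Base (cmp D g h)) (cocyc D g h)" if gh: "composable D g h" for g h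
  proof -
    have g: "g \<in> Arr D" and h: "h \<in> Arr D" and s: "src D g = rng D h"
      using gh by (auto simp: composable_def)
    interpret X: group "Grp D (src D h)" using h by (intro group_Grp src_Obj)
    have c: "composable E (Base g) (Base h)" using gh by (simp add: composable_extended_data)
    have "corr_mult E (Base g) (Base h) \<one>\<^bsub>Grp D (src D g)\<^esub> \<one>\<^bsub>Grp D (src D h)\<^esub> = cocyc D g h"
      using cocyc_closed[OF gh] phi_one[OF h] s by (simp add: corr_mult_def extended_data_simps)
    then show ?thesis
      by (intro \<sigma>_mult)
        (use base[OF g] base[OF h] s A.dact_multiply[OF c, of "\<one>\<^bsub>Grp D (src D g)\<^esub>" "\<one>\<^bsub>Grp D (src D h)\<^esub>"]
          src_cmp[OF gh] rng_cmp[OF gh] in \<open>auto simp: extended_data_simps(3-5)\<close>)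
  qed
  have f_rel: "word_value ?H f v = word_value ?H f w"
    if "(v, w) \<in> pi1_rels D" "v \<in> words (pi1_gens D)" "w \<in> words (pi1_gens D)" for v w
    using that(1) unfolding pi1_rels_def
  proof (elim UnE CollectE exE conjE Pair_inject)
    fix x \<gamma>\<^sub>1 \<gamma>\<^sub>2
    assume "v = elt_word x \<gamma>\<^sub>1 @ elt_word x \<gamma>\<^sub>2" "w = elt_word x (\<gamma>\<^sub>1 \<otimes>\<^bsub>Grp D x\<^esub> \<gamma>\<^sub>2)"
      and x: "x \<in> Obj D" "\<gamma>\<^sub>1 \<in> carrier (Grp D x)" "\<gamma>\<^sub>2 \<in> carrier (Grp D x)"
    moreover interpret X: group "Grp D x" using x(1) by (rule group_Grp)
    have "f (Elt x \<gamma>) \<in> carrier ?H" if "\<gamma> \<in> carrier (Grp D x)" for \<gamma>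
      using f_closed pi1_gensI(2)[OF x(1) that] by blast
    ultimately show ?thesis
      using elt_elt[OF x] by (simp add: f_def)
  next
    fix g \<gamma>
    assume "v = arrow_word g @ elt_word (src D g) (phi D g \<gamma>)" "w = elt_word (rng D g) \<gamma> @ arrow_word g"
      and g: "g \<in> Arr D" and \<gamma>: "\<gamma> \<in> carrier (Grp D (rng D g))"
    moreover have "f (Arrow g) \<in> carrier ?H" "f (Elt (src D g) (phi D g \<gamma>)) \<in> carrier ?H"
      using f_closed pi1_gensI(1)[OF g] pi1_gensI(2)[OF src_Obj[OF g] phi_closed[OF g \<gamma>]] by blast+
    ultimately show ?thesis
      using arrow_elt[OF g phi_closed[OF g \<gamma>]] elt_arrow[OF g \<gamma>] by (simp add: f_def)
  next
    fix g h
    assume "v = arrow_word g @ arrow_word h" "w = arrow_word (cmp D g h) @ elt_word (src D h) (cocyc D g h)"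
      and gh: "composable D g h"
    moreover have g: "g \<in> Arr D" and h: "h \<in> Arr D" using gh by (auto simp: composable_def)
    moreover have "f (Arrow h) \<in> carrier ?H" "f (Elt (src D h) (cocyc D g h)) \<in> carrier ?H"
      using f_closed pi1_gensI(1)[OF h] pi1_gensI(2)[OF src_Obj[OF h] cocyc_closed[OF gh]] by blast+
    ultimately show ?thesis
      using arrow_arrow[OF gh] arrow_elt[OF cmp_Arr[OF gh], of "cocyc D g h"] cocyc_closed[OF gh]
      by (simp add: f_def src_cmp[OF gh])
  next
    fix x assume "v = arrow_word x" "w = []" and x: "x \<in> Obj D"
    then show ?thesis
      using \<sigma>_one[OF base_obj(1)[OF x]] base_obj(2)[OF x]
      by (simp add: f_def src_ident one_homeo_group[symmetric])
  qed
  obtain h where h: "h \<in> hom \<Pi>\<^sub>1 ?H" and hf: "\<And>s. s \<in> pi1_gens D \<Longrightarrow> h (pi1_class [(True, s)]) = f s"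
    using H.presented_group_universal[OF f_closed f_rel]
    unfolding fundamental_group_def pi1_class_def by metis
  have h_one: "h \<one>\<^bsub>\<Pi>\<^sub>1\<^esub> = \<one>\<^bsub>?H\<^esub>" using hom_one[OF h Pi1.is_group H.is_group] .
  have h_closed: "h p \<in> carrier ?H" if "p \<in> carrier \<Pi>\<^sub>1" for p using h that by (auto simp: hom_def)
  (* Only the generators of the base enter the construction of h.  A cone arrow has the same class in
     the group as the arrow of the base below it, so it remains to see that it also has the same
     sigma: along (g,0) and then (r(g),0) to the apex is along (g,oo). *)
  have h_kappa: "h (arrow_class k \<otimes>\<^bsub>\<Pi>\<^sub>1\<^esub> elt_class (src E k) \<gamma>) = \<sigma> k \<gamma>"
    if k: "k \<in> Arr E" and \<gamma>: "\<gamma> \<in> carrier (Grp E (src E k))" for k \<gamma>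
  proof -
    have base_case: "h (arrow_class (Base g) \<otimes>\<^bsub>\<Pi>\<^sub>1\<^esub> elt_class (Base (src D g)) \<gamma>) = \<sigma> (Base g) \<gamma>"
      if g: "g \<in> Arr D" and \<gamma>: "\<gamma> \<in> carrier (Grp D (src D g))" for g
      using hom_mult[OF h arrow_class_closed[OF base(1)[OF g]] elt_class_closed[OF base(5)[OF g], of \<gamma>]]
        arrow_elt[OF g \<gamma>] hf[OF pi1_gensI(1)[OF g]] hf[OF pi1_gensI(2)[OF src_Obj[OF g] \<gamma>]] base[OF g] \<gamma>
      by (simp add: f_def)
    from k consider (base) g where "g \<in> Arr D" "k = Base g" | (cone) g where "g \<in> Arr D" "k = Cone g"
      | (apex) "k = Apex" by (auto simp: extended_data_simps)
    then show ?thesis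
    proof cases
      case base
      then show ?thesis using base_case[of g] \<gamma> \<open>\<And>g. g \<in> Arr D \<Longrightarrow> Grp E (Base (src D g)) = Grp D (src D g)\<close>
        by (simp add: extended_data_simps)
    next
      case cone
      note g = cone(1)
      have \<gamma>': "\<gamma> \<in> carrier (Grp D (src D g))" using \<gamma> cone by (simp add: extended_data_simps)
      interpret X: group "Grp D (src D g)" using g by (intro group_Grp src_Obj)
      interpret R: group "Grp D (rng D g)" using g by (intro group_Grp rng_Obj)
      have rng: "rng D g \<in> Obj D" "rng D g \<in> Arr D" using rng_Obj[OF g] Obj_subset by auto
      have c: "composable E (Cone (rng D g)) (Base g)"
        using g rng by (simp add: composable_extended_data) (simp add: composable_def src_ident)
      have corr: "corr_mult E (Cone (rng D g)) (Base g) \<one>\<^bsub>Grp D (rng D g)\<^esub> \<gamma> = \<gamma>"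
        using g \<gamma>' by (simp add: corr_mult_def extended_data_simps cocyc_ident_left phi_one)
      have "\<sigma> (Base g) \<gamma> z = \<sigma> (Cone g) \<gamma> z" for z
      proof (cases "z \<in> topspace Z")
        case True
        have y: "b (Base (src D g)) z \<in> piece A (Base (src D g))"
          by (rule chart(2)[OF _ True]) (simp add: extended_data_simps src_Obj g)
        have "\<beta> (Base (rng D g)) (dact A (Base g) \<gamma> (b (Base (src D g)) z))
            = dact A (Cone g) \<gamma> (b (Base (src D g)) z)"
          using A.dact_multiply[OF c, of "\<one>\<^bsub>Grp D (rng D g)\<^esub>" \<gamma> "b (Base (src D g)) z"] y \<gamma>' corr rng
            cmp_ident_left[OF g]
          by (simp add: \<beta>_def extended_data_simps src_ident)
        moreover have "dact A (Cone g) \<gamma> (b (Base (src D g)) z) \<in> piece A Apex"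
          using A.dact_closed[of "Cone g" \<gamma> "b (Base (src D g)) z"] g \<gamma>' y
          by (simp add: extended_data_simps)
        then have "\<beta> Apex (dact A (Cone g) \<gamma> (b (Base (src D g)) z))
            = dact A (Cone g) \<gamma> (b (Base (src D g)) z)"
          using A.dact_one[OF apex(1)] by (simp add: \<beta>_def)
        ultimately show ?thesis using True by (simp add: \<sigma>_def extended_data_simps)
      qed (simp add: \<sigma>_def)
      then have "\<sigma> (Base g) \<gamma> = \<sigma> (Cone g) \<gamma>" by (rule ext)
      then show ?thesis using base_case[OF g \<gamma>'] cone by (simp add: extended_data_simps)
    next
      case apex
      then have "\<gamma> = \<one>\<^bsub>Grp E Apex\<^esub>" using \<gamma> by (simp add: extended_data_simps)
      then show ?thesis
        using apex \<sigma>_one[OF \<open>Apex \<in> Obj E\<close>] h_one by (simp add: extended_data_simps(3) h_one)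
    qed
  qed
  interpret T: trivialized_space \<Pi>\<^sub>1 "Obj E" Y Z "piece A" \<beta> b h
  proof unfold_locales
    show "openin Y (piece A x)" if "x \<in> Obj E" for x using that by (rule A.piece_openin)
    show "(\<Union>x\<in>Obj E. piece A x) = topspace Y" by (rule A.piece_cover)
    show "x = x'" if "x \<in> Obj E" "x' \<in> Obj E" "y \<in> piece A x" "y \<in> piece A x'" for x x' y
      using that by (rule A.piece_disjoint)
    show "homeomorphic_maps (subtopology Y (piece A x)) Z (\<beta> x) (b x)" if "x \<in> Obj E" for x
      using that by (rule b)
    show "continuous_map Z Z (h p)" if "p \<in> carrier \<Pi>\<^sub>1" for p
      using h_closed[OF that] by (simp add: carrier_homeo_group homeomorphic_imp_continuous_map)
    show "h (p \<otimes>\<^bsub>\<Pi>\<^sub>1\<^esub> q) z = h p (h q z)"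
      if "p \<in> carrier \<Pi>\<^sub>1" "q \<in> carrier \<Pi>\<^sub>1" "z \<in> topspace Z" for p q z
      using hom_mult[OF h that(1,2)] that(3)
        mult_homeo_group[OF h_closed[OF that(1)] h_closed[OF that(2)]] by (simp add: compose_def)
    show "h \<one>\<^bsub>\<Pi>\<^sub>1\<^esub> z = z" if "z \<in> topspace Z" for z
      using that by (simp add: h_one one_homeo_group)
  qed
  let ?B = "T.trivialized_action"
  have B: "left_action \<P> Y ?B" by (rule T.left_action_trivialized)
  have label: "y \<in> topspace Y \<and> anchor ?B y = (\<one>\<^bsub>\<Pi>\<^sub>1\<^esub>, x, x) \<longleftrightarrow> y \<in> piece A x" if x: "x \<in> Obj E" for x y
    using T.anchor_trivialized_iff[OF x, of y] T.piece_topspace[OF x, of y] by blast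
  have "diagram_action_of Y ?B = A"
  proof (rule diagram_action.equality)
    show "piece (diagram_action_of Y ?B) = piece A"
    proof
      show "piece (diagram_action_of Y ?B) x = piece A x" for x
        using label[of x] A.piece_empty[of x] by (cases "x \<in> Obj E") (auto simp: diagram_action_of_def)
    qed
    show "dact (diagram_action_of Y ?B) = dact A"
    proof (intro ext)
      fix k \<gamma> y
      show "dact (diagram_action_of Y ?B) k \<gamma> y = dact A k \<gamma> y"
      proof (cases "k \<in> Arr E \<and> \<gamma> \<in> carrier (Grp E (src E k)) \<and> y \<in> piece A (src E k)")
        case True
        then have k: "k \<in> Arr E" and \<gamma>: "\<gamma> \<in> carrier (Grp E (src E k))" and y: "y \<in> piece A (src E k)"
          by auto
        note s = cone.src_Obj[OF k] and r = cone.rng_Obj[OF k]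
        have "dact (diagram_action_of Y ?B) k \<gamma> y = act ?B (kappa k \<gamma>) y"
          using label[OF s, of y] k \<gamma> y by (simp add: diagram_action_of_def corr_set_def)
        also have "\<dots> = b (rng E k) (\<sigma> k \<gamma> (\<beta> (src E k) y))"
          unfolding kappa_def
          using T.act_trivialized[OF Pi1.m_closed[OF arrow_class_closed[OF k] elt_class_closed[OF s \<gamma>]] r s y]
            h_kappa[OF k \<gamma>] by simp
        also have "\<dots> = dact A k \<gamma> y"
          using chart(1,3)[OF s y] chart(3)[OF r A.dact_closed[OF k \<gamma> y]] by (simp add: \<sigma>_def)
        finally show ?thesis .
      next
        case False
        then have "dact (diagram_action_of Y ?B) k \<gamma> y = undefined"
          using label[of "src E k" y] cone.src_Obj[of k]
          by (auto simp: diagram_action_of_def corr_set_def)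
        then show ?thesis using A.dact_undefined[OF False] by simp
      qed
    qed
  qed simp
  then show ?thesis using B by blast
qed

theorem groupoid_model_cone: "groupoid_model TYPE('y) E \<P>"
proof -
  have "bij_betw (diagram_action_of Y) {B. left_action \<P> Y B} {A. is_diagram_action E Y A}"
    for Y :: "'y topology"
    unfolding bij_betw_def
  proof
    show "inj_on (diagram_action_of Y) {B. left_action \<P> Y B}"
      by (rule inj_onI) (simp add: diagram_action_of_inj del: group_times_pair_simps)
    show "diagram_action_of Y ` {B. left_action \<P> Y B} = {A. is_diagram_action E Y A}"
      using is_diagram_action_of[of Y] diagram_action_of_surj[of Y] by blast
  qed
  moreover have "equivariant \<P> Y B B' f \<longleftrightarrow>
      diagram_equivariant E (diagram_action_of Y B) (diagram_action_of Y' B') f"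
    if "left_action \<P> Y B" "left_action \<P> Y' B'" "continuous_map Y Y' f"
    for Y Y' :: "'y topology" and B B' f
    using equivariant_iff[OF that(1,2)] continuous_map_image_subset_topspace[OF that(3)] by blast
  ultimately show ?thesis
    unfolding groupoid_model_def using product.etale_groupoid_axioms
    by (intro conjI exI[of _ diagram_action_of]) blast+
qed

end

section \<open>The groupoid model is the product of the fundamental group with a pair groupoid\<close>

theorem theorem7p4:
  fixes D :: "('a, 'g) diagram_data"
    and U :: "'u top_groupoid"
    and i :: "'u \<Rightarrow> 'y"
    and j :: "('a, 'g) pi1_gen word set \<times> ('a ext_arrow \<times> 'a ext_arrow) \<Rightarrow> 'y"
  assumes data: "tight_diagram_data D"
    and universe_contains_U: "inj i"
    and universe_contains_product: "inj j"
    and model: "groupoid_model TYPE('y) (extended_data D) U"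
  shows "isomorphic_groupoids U
           (prod_groupoid (group_groupoid (fundamental_group D))
             (pair_groupoid (Obj (extended_data D))))
         \<and> morita_equivalent U (group_groupoid (fundamental_group D))"
proof
  interpret tight_diagram_data D by (fact data)
  show iso: "isomorphic_groupoids U \<P>"
    by (rule groupoid_models_isomorphic[OF universe_contains_U universe_contains_product model
          groupoid_model_cone])
  then obtain f where f: "groupoid_iso U \<P> f" by (auto simp: isomorphic_groupoids_def)
  interpret U: etale_groupoid U using model by (simp add: groupoid_model_def)
  have "Obj E \<noteq> {}" by (simp add: extended_data_simps)
  then show "morita_equivalent U (group_groupoid \<Pi>\<^sub>1)"
    using morita_equivalent_group_times_pair[OF U.topological_groupoid_axioms group_fundamental_group _ f]
    by blast
qed

end
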